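(* Let $\alpha\in(2k\pi,(2k+1)\pi)$ for some $k\in\mathbb Z$, and put $c_1=\cot\alpha$, $c_2=\csc\alpha$. Let $m\in\mathbb R$, let $L$ be a slowly varying function at the origin, and let $f,u\in\mathcal S_0'(\mathbb R)$ be such that $f(\varepsilon x)\sim\varepsilon^mL(\varepsilon)u(x)$ as $\varepsilon\to0^+$ in $\mathcal S_0'(\mathbb R)$. Then for every window $g\in\mathcal S_0(\mathbb R)\setminus\{0\}$ the fractional Stockwell transform of $f$ satisfies $$e^{-ic_1(\varepsilon\xi)^2/2}\,S^{\alpha}_{g_{1/\varepsilon^2}}f(\varepsilon x,\varepsilon\xi)\sim\frac{\sqrt{1-ic_1}}{c_2^{m}}\,\varepsilon^{m+2}L(\varepsilon)\,S_g(M_{\xi/c_2}u)\Big(xc_2,\frac{\xi}{c_2}\Big)\quad\text{as }\varepsilon\to0^+\text{ in }\mathcal S'(\mathbb Y).$$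
   Context: Spaces: $\mathcal S(\mathbb R)$ is the Schwartz space with dual $\mathcal S'(\mathbb R)$; $\mathcal S_0(\mathbb R)=\{\varphi\in\mathcal S(\mathbb R): \int_{\mathbb R}x^k\varphi(x)\,dx=0\ \forall k\in\mathbb N_0\}$, a closed subspace of $\mathcal S(\mathbb R)$, with dual $\mathcal S_0'(\mathbb R)$ (Lizorkin distributions). $\mathbb Y=\mathbb R\times(\mathbb R\setminus\{0\})$, and $\mathcal S(\mathbb Y)$ is the space of $\Phi\in C^\infty(\mathbb Y)$ with $\sup_{(x,\xi)\in\mathbb Y}(|\xi|^s+|\xi|^{-s})|x^r\partial_\xi^l\partial_x^m\Phi(x,\xi)|<\infty$ for all $m,l,s,r\in\mathbb N_0$, topologized by these seminorms; $\mathcal S'(\mathbb Y)$ is its dual. Slowly varying at the origin: $L$ is a measurable positive function on some $(0,A]$, $A>0$, with $\lim_{\varepsilon\to0^+}L(a\varepsilon)/L(\varepsilon)=1$ for each $a>0$. Quasiasymptotics: $f(\varepsilon x)\sim\varepsilon^mL(\varepsilon)u(x)$ as $\varepsilon\to0^+$ in $\mathcal S_0'(\mathbb R)$ means $\lim_{\varepsilon\to0^+}\langle f(\varepsilon x)/(\varepsilon^mL(\varepsilon)),\varphi(x)\rangle=\langle u,\varphi\rangle$ for every $\varphi\in\mathcal S_0(\mathbb R)$ (then $u$ is homogeneous of degree $m$). Similarly, $F_\varepsilon\sim\varepsilon^{p}L(\varepsilon)G$ in $\mathcal S'(\mathbb Y)$ means $\langle F_\varepsilon,\Phi\rangle/(\varepsilon^{p}L(\varepsilon))\to\langle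 G,\Phi\rangle$ for every $\Phi\in\mathcal S(\mathbb Y)$. Notation: $M_af(t)=e^{iat}f(t)$; $g_\varepsilon(t)=g(\varepsilon t)$, so $g_{1/\varepsilon^2}(t)=g(t/\varepsilon^2)$. Transforms: for $\alpha$ not a multiple of $\pi$, $K_\alpha(t,\xi)=C_\alpha e^{i(\frac{t^2+\xi^2}{2}c_1-t\xi c_2)}$ with $C_\alpha=\sqrt{\frac{1-ic_1}{2\pi}}$. The fractional Stockwell transform is $S_g^\alpha f(x,\xi)=|\xi|\int_{\mathbb R}f(t)\overline{g(\xi(t-x))}K_\alpha(t,\xi)\,dt$, and the Stockwell transform is $S_gf(x,\xi)=S_g^{\pi/2}f(x,\xi)=\frac{|\xi|}{\sqrt{2\pi}}\int_{\mathbb R}f(t)\overline{g(\xi(t-x))}e^{-i\xi t}\,dt$, for $(x,\xi)\in\mathbb Y$. For $f\in\mathcal S_0'(\mathbb R)$ the integrals are understood as dual pairings in $t$, e.g. $S_g^\alpha f(x,\xi)=|\xi|\langle f(t),\overline{g(\xi(t-x))}K_\alpha(t,\xi)\rangle$; where the function paired with $f$ lies in $\mathcal S(\mathbb R)$ but not in $\mathcal S_0(\mathbb R)$, $f$ is extended to a continuous functional on $\mathcal S(\mathbb R)$ (Hahn–Banach), denoted by the same letter. In $S_g(M_{\xi/c_2}u)(xc_2,\xi/c_2)$ the modulation parameter is tied to the evaluation point, so it equals $\frac{|\xi/c_2|}{\sqrt{2\pi}}\langle u(t),\overline{g}(\tfrac{\xi}{c_2}(t-xc_2))\rangle$. *)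

theory Defs
  imports "HOL-Analysis.Analysis"
begin

section \<open>Function spaces topologized by seminorms, and their duals\<close>

definition seminorm_topology ::
  "('a \<Rightarrow> complex) set \<Rightarrow> (('a \<Rightarrow> complex) \<Rightarrow> real) set \<Rightarrow> ('a \<Rightarrow> complex) topology" where
  "seminorm_topology V P = topology_generated_by
     {{\<psi> \<in> V. p (\<lambda>x. \<psi> x - \<phi> x) < r} | p \<phi> r. p \<in> P \<and> \<phi> \<in> V}"

text \<open>Only the values of a functional on the underlying test functions
  (the \<^const>\<open>topspace\<close>) are significant.\<close>

definition dual :: "('a \<Rightarrow> complex) topology \<Rightarrow> (('a \<Rightarrow> complex) \<Rightarrow> complex) set" where
  "dual X = {T.
     (\<forall>\<phi>\<in>topspace X. \<forall>\<psi>\<in>topspace X. T (\<lambda>x. \<phi> x + \<psi> x) = T \<phi> + T \<psi>) \<and>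
     (\<forall>c. \<forall>\<phi>\<in>topspace X. T (\<lambda>x. c * \<phi> x) = c * T \<phi>) \<and>
     continuous_map X euclidean T}"

section \<open>Schwartz and Lizorkin spaces on the line\<close>

definition vderiv :: "(real \<Rightarrow> complex) \<Rightarrow> real \<Rightarrow> complex" where
  "vderiv \<phi> t = vector_derivative \<phi> (at t)"

definition schwartz :: "(real \<Rightarrow> complex) set" where
  "schwartz = {\<phi>.
     (\<forall>k t. (vderiv ^^ k) \<phi> differentiable (at t)) \<and>
     (\<forall>j k. bdd_above (range (\<lambda>t. norm (t ^ j *\<^sub>R (vderiv ^^ k) \<phi> t))))}"

definition schwartz_seminorm :: "nat \<Rightarrow> nat \<Rightarrow> (real \<Rightarrow> complex) \<Rightarrow> real" where
  "schwartz_seminorm j k \<phi> = (SUP t. norm (t ^ j *\<^sub>R (vderiv ^^ k) \<phi> t))"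

definition schwartz_topology :: "(real \<Rightarrow> complex) topology" where
  "schwartz_topology = seminorm_topology schwartz {schwartz_seminorm j k | j k. True}"

definition lizorkin :: "(real \<Rightarrow> complex) set" where
  "lizorkin = {\<phi> \<in> schwartz. \<forall>k::nat. (LBINT x. x ^ k *\<^sub>R \<phi> x) = 0}"

definition lizorkin_topology :: "(real \<Rightarrow> complex) topology" where
  "lizorkin_topology = subtopology schwartz_topology lizorkin"

definition is_extension ::
  "((real \<Rightarrow> complex) \<Rightarrow> complex) \<Rightarrow> ((real \<Rightarrow> complex) \<Rightarrow> complex) \<Rightarrow> bool" where
  "is_extension f f' \<longleftrightarrow> f' \<in> dual schwartz_topology \<and> (\<forall>\<phi>\<in>lizorkin. f' \<phi> = f \<phi>)"

section \<open>The space of test functions on \<open>\<real> \<times> (\<real> - {0})\<close>\<close>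

definition Y :: "(real \<times> real) set" where
  "Y = UNIV \<times> (UNIV - {0})"

definition partial_x :: "(real \<times> real \<Rightarrow> complex) \<Rightarrow> real \<times> real \<Rightarrow> complex" where
  "partial_x \<Phi> = (\<lambda>(x, \<xi>). vector_derivative (\<lambda>y. \<Phi> (y, \<xi>)) (at x))"

definition partial_xi :: "(real \<times> real \<Rightarrow> complex) \<Rightarrow> real \<times> real \<Rightarrow> complex" where
  "partial_xi \<Phi> = (\<lambda>(x, \<xi>). vector_derivative (\<lambda>\<eta>. \<Phi> (x, \<eta>)) (at \<xi>))"

text \<open>\<open>C\<^sup>\<infinity>(Y)\<close>: all iterated partial derivatives, in any order, are totally differentiable at
  each point of \<open>Y\<close>. As \<open>Y\<close> is open, values on \<open>Y\<close> of these derivatives do not depend on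
  the values of \<open>\<Phi>\<close> outside \<open>Y\<close>.\<close>

definition smooth_Y :: "(real \<times> real \<Rightarrow> complex) \<Rightarrow> bool" where
  "smooth_Y \<Phi> \<longleftrightarrow> (\<forall>ds. set ds \<subseteq> {partial_x, partial_xi} \<longrightarrow>
     (\<forall>z\<in>Y. foldr (\<lambda>d. d) ds \<Phi> differentiable (at z)))"

definition weighted_deriv_Y ::
  "nat \<Rightarrow> nat \<Rightarrow> nat \<Rightarrow> nat \<Rightarrow> (real \<times> real \<Rightarrow> complex) \<Rightarrow> real \<times> real \<Rightarrow> real" where
  "weighted_deriv_Y m l s r \<Phi> = (\<lambda>(x, \<xi>). (\<bar>\<xi>\<bar> ^ s + inverse (\<bar>\<xi>\<bar> ^ s)) *
     norm (x ^ r *\<^sub>R (partial_xi ^^ l) ((partial_x ^^ m) \<Phi>) (x, \<xi>)))"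

definition schwartz_Y :: "(real \<times> real \<Rightarrow> complex) set" where
  "schwartz_Y = {\<Phi>. smooth_Y \<Phi> \<and> (\<forall>m l s r. bdd_above (weighted_deriv_Y m l s r \<Phi> ` Y))}"

definition schwartz_Y_seminorm ::
  "nat \<Rightarrow> nat \<Rightarrow> nat \<Rightarrow> nat \<Rightarrow> (real \<times> real \<Rightarrow> complex) \<Rightarrow> real" where
  "schwartz_Y_seminorm m l s r \<Phi> = (SUP z\<in>Y. weighted_deriv_Y m l s r \<Phi> z)"

definition schwartz_Y_topology :: "(real \<times> real \<Rightarrow> complex) topology" where
  "schwartz_Y_topology =
     seminorm_topology schwartz_Y {schwartz_Y_seminorm m l s r | m l s r. True}"

text \<open>A function on \<open>Y\<close> acts on test functions by integration against \<open>dx d\<xi>\<close>.\<close>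

definition regular_functional ::
  "(real \<times> real \<Rightarrow> complex) \<Rightarrow> (real \<times> real \<Rightarrow> complex) \<Rightarrow> complex" where
  "regular_functional F \<Phi> = (LINT z:Y|lborel. F z * \<Phi> z)"

definition regular_dual_Y :: "(real \<times> real \<Rightarrow> complex) \<Rightarrow> bool" where
  "regular_dual_Y F \<longleftrightarrow>
     (\<forall>\<Phi>\<in>schwartz_Y. set_integrable lborel Y (\<lambda>z. F z * \<Phi> z)) \<and>
     regular_functional F \<in> dual schwartz_Y_topology"

section \<open>Slow variation and asymptotics\<close>

definition slowly_varying_at_0 :: "(real \<Rightarrow> real) \<Rightarrow> bool" where
  "slowly_varying_at_0 L \<longleftrightarrow>
     (\<exists>A>0. L \<in> borel_measurable (lebesgue_on {0<..A}) \<and> (\<forall>\<epsilon>\<in>{0<..A}. L \<epsilon> > 0)) \<and>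
     (\<forall>a>0. ((\<lambda>\<epsilon>. L (a * \<epsilon>) / L \<epsilon>) \<longlongrightarrow> 1) (at_right 0))"

text \<open>The distribution \<open>f(\<epsilon>x)\<close>.\<close>

definition dilate :: "real \<Rightarrow> ((real \<Rightarrow> complex) \<Rightarrow> complex) \<Rightarrow> (real \<Rightarrow> complex) \<Rightarrow> complex" where
  "dilate \<epsilon> f \<phi> = f (\<lambda>x. \<phi> (x / \<epsilon>)) / of_real \<bar>\<epsilon>\<bar>"

text \<open>\<open>f(\<epsilon>x) \<sim> \<epsilon>\<^sup>m L(\<epsilon>) u(x)\<close> in the dual of the Lizorkin space.\<close>

definition quasiasymptotic ::
  "((real \<Rightarrow> complex) \<Rightarrow> complex) \<Rightarrow> real \<Rightarrow> (real \<Rightarrow> real) \<Rightarrow>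
   ((real \<Rightarrow> complex) \<Rightarrow> complex) \<Rightarrow> bool" where
  "quasiasymptotic f m L u \<longleftrightarrow>
     (\<forall>\<phi>\<in>lizorkin.
       ((\<lambda>\<epsilon>. dilate \<epsilon> f \<phi> / of_real (\<epsilon> powr m * L \<epsilon>)) \<longlongrightarrow> u \<phi>) (at_right 0))"

text \<open>\<open>F\<^sub>\<epsilon> \<sim> \<epsilon>\<^sup>p L(\<epsilon>) G\<close> in the dual of \<^const>\<open>schwartz_Y\<close>, for functions \<open>F\<^sub>\<epsilon>\<close> and \<open>G\<close>;
  that these functions define elements of the dual is part of the assertion.\<close>

definition asymptotic_Y ::
  "(real \<Rightarrow> real \<times> real \<Rightarrow> complex) \<Rightarrow> real \<Rightarrow> (real \<Rightarrow> real) \<Rightarrow>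
   (real \<times> real \<Rightarrow> complex) \<Rightarrow> bool" where
  "asymptotic_Y F p L G \<longleftrightarrow>
     (\<forall>\<epsilon>>0. regular_dual_Y (F \<epsilon>)) \<and> regular_dual_Y G \<and>
     (\<forall>\<Phi>\<in>schwartz_Y.
       ((\<lambda>\<epsilon>. regular_functional (F \<epsilon>) \<Phi> / of_real (\<epsilon> powr p * L \<epsilon>))
          \<longlongrightarrow> regular_functional G \<Phi>) (at_right 0))"

section \<open>The fractional Stockwell transform\<close>

definition csc :: "real \<Rightarrow> real" where
  "csc \<alpha> = 1 / sin \<alpha>"

definition frac_kernel :: "real \<Rightarrow> real \<Rightarrow> real \<Rightarrow> complex" where
  "frac_kernel \<alpha> t \<xi> =
     csqrt ((1 - \<i> * of_real (cot \<alpha>)) / of_real (2 * pi)) *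
     exp (\<i> * of_real ((t\<^sup>2 + \<xi>\<^sup>2) / 2 * cot \<alpha> - t * \<xi> * csc \<alpha>))"

definition frac_stockwell ::
  "real \<Rightarrow> (real \<Rightarrow> complex) \<Rightarrow> ((real \<Rightarrow> complex) \<Rightarrow> complex) \<Rightarrow> real \<Rightarrow> real \<Rightarrow> complex" where
  "frac_stockwell \<alpha> g f x \<xi> =
     of_real \<bar>\<xi>\<bar> * f (\<lambda>t. cnj (g (\<xi> * (t - x))) * frac_kernel \<alpha> t \<xi>)"

definition stockwell ::
  "(real \<Rightarrow> complex) \<Rightarrow> ((real \<Rightarrow> complex) \<Rightarrow> complex) \<Rightarrow> real \<Rightarrow> real \<Rightarrow> complex" where
  "stockwell = frac_stockwell (pi / 2)"

text \<open>The functional \<open>e\<^bsup>iat\<^esup> f(t)\<close>. It acts on those functions \<open>\<phi>\<close> for which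
  \<open>e\<^bsup>iat\<^esup> \<phi>(t)\<close> belongs to the domain of \<open>f\<close>.\<close>

definition modulate :: "real \<Rightarrow> ((real \<Rightarrow> complex) \<Rightarrow> complex) \<Rightarrow> (real \<Rightarrow> complex) \<Rightarrow> complex" where
  "modulate a f \<phi> = f (\<lambda>t. exp (\<i> * of_real (a * t)) * \<phi> t)"

end

theory Submission
  imports Defs
begin

text \<open>Put \<open>q(s) = c1 s\<^sup>2 / 2 - c2 \<xi> s\<close>. Substituting \<open>t = \<epsilon> s\<close> turns the left-hand side into
  \<open>C \<epsilon>\<^sup>2 \<bar>\<xi>\<bar>\<close> times the pairing of \<open>f(\<epsilon> s)\<close> with \<open>cnj (g (\<xi> (s - x))) exp (\<i> \<epsilon>\<^sup>2 q(s))\<close>. These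
  test functions are not in the Lizorkin space, on which alone the asymptotics of \<open>f\<close> is known,
  but \<open>cnj (g (\<xi> (s - x))) q(s)\<^sup>n\<close> is. In the Taylor expansion of the exponential the
  terms with \<open>n \<ge> 1\<close> therefore vanish in the limit, and the \<open>N\<close>-th remainder is \<open>O(\<epsilon>\<^sup>2\<^sup>N)\<close> in
  every Schwartz seminorm, which beats the polynomial loss in the bound for the extension of
  \<open>f\<close>, since \<open>L\<close> is bounded below by a power of \<open>\<epsilon>\<close>. Uniform boundedness on the Lizorkin space
  dominates the quotients by powers of \<open>\<bar>x\<bar>\<close>, \<open>\<bar>\<xi>\<bar>\<close> and \<open>1 / \<bar>\<xi>\<bar>\<close>, so that the pointwise limit can be
  integrated against test functions on \<open>Y\<close>. The factor \<open>c2\<^sup>m\<close> comes from the homogeneity of \<open>u\<close>.\<close>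

section \<open>Seminorm topologies\<close>

text \<open>The obstacle is that \<open>f'\<close> is an arbitrary extension of \<open>f\<close>:
  outside the Lizorkin space nothing is known about it except a bound by seminorms of some order
  \<open>n\<close>. Dilation by \<epsilon> worsens this bound by about
  \<open>\<epsilon> powr (- n - 1)\<close>, and division by
  \<open>\<epsilon> powr m * L \<epsilon>\<close> may worsen it further. The order of the Taylor
  expansion therefore depends on \<open>f'\<close> and \<open>m\<close>, and the remainder must be
  small in all derivatives and weights at once, uniformly in x and \<xi> up to polynomial factors.
  The calculus of parametrised families serves this purpose. Two uniformities are missing from the
  hypotheses. Slow variation is pointwise in the ratio, and a lower bound for \<open>L\<close> needs
  some uniformity in it; measurability supplies this by a Steinhaus argument. The quasiasymptotics
  are pointwise on the Lizorkin space, and seminorm bounds uniform in \<epsilon> come from the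
  completeness of that space. Uniform boundedness and dominated convergence are both applied along
  sequences tending to 0.\<close>

lemma topspace_seminorm_topology:
  assumes "p \<in> P" "\<And>p. p \<in> P \<Longrightarrow> p (\<lambda>x. 0) = 0"
  shows "topspace (seminorm_topology V P) = V"
proof
  show "topspace (seminorm_topology V P) \<subseteq> V"
    unfolding seminorm_topology_def topology_generated_by_topspace by auto
  show "V \<subseteq> topspace (seminorm_topology V P)"
  proof
    fix f assume "f \<in> V"
    then have "f \<in> {g \<in> V. p (\<lambda>x. g x - f x) < 1}"
      using assms(2)[OF assms(1)] by simp
    then show "f \<in> topspace (seminorm_topology V P)"
      unfolding seminorm_topology_def topology_generated_by_topspace
      using assms(1) \<open>f \<in> V\<close> by blast
  qed
qed

text \<open>The generating balls may be centred anywhere. The triangle inequality shrinks one that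
  contains \<open>f\<close> to a ball about \<open>f\<close>, and a finite intersection joins the
  seminorms and takes the smaller radius.\<close>

lemma openin_seminorm_topology_nhd:
  assumes "openin (seminorm_topology V P) U" "f \<in> U" "f \<in> V"
    and tri: "\<And>p a b c. p \<in> P \<Longrightarrow> a \<in> V \<Longrightarrow> b \<in> V \<Longrightarrow> c \<in> V \<Longrightarrow>
      p (\<lambda>x. a x - c x) \<le> p (\<lambda>x. a x - b x) + p (\<lambda>x. b x - c x)"
  shows "\<exists>F r. finite F \<and> F \<subseteq> P \<and> r > 0 \<and>
    (\<forall>g\<in>V. (\<forall>p\<in>F. p (\<lambda>x. g x - f x) < r) \<longrightarrow> g \<in> U)"
proof -
  have "generate_topology_on {{g \<in> V. p (\<lambda>x. g x - f x) < r} | p f r. p \<in> P \<and> f \<in> V} U"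
    using assms(1) unfolding seminorm_topology_def openin_topology_generated_by_iff .
  then show ?thesis
    using \<open>f \<in> U\<close>
  proof (induction rule: generate_topology_on.induct)
    case Empty
    then show ?case by simp
  next
    case (Int a b)
    from Int.IH(1) Int.prems obtain F r where "finite F" "F \<subseteq> P" "r > 0"
      "\<forall>g\<in>V. (\<forall>p\<in>F. p (\<lambda>x. g x - f x) < r) \<longrightarrow> g \<in> a"
      by blast
    moreover from Int.IH(2) Int.prems obtain G s where "finite G" "G \<subseteq> P" "s > 0"
      "\<forall>g\<in>V. (\<forall>p\<in>G. p (\<lambda>x. g x - f x) < s) \<longrightarrow> g \<in> b"
      by blast
    ultimately show ?case
      by (intro exI[of _ "F \<union> G"] exI[of _ "min r s"]) auto
  next
    case (UN K)
    then obtain k where "k \<in> K" "f \<in> k" by blast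
    then obtain F r where "finite F" "F \<subseteq> P" "r > 0"
      "\<forall>g\<in>V. (\<forall>p\<in>F. p (\<lambda>x. g x - f x) < r) \<longrightarrow> g \<in> k"
      using UN.IH[OF \<open>k \<in> K\<close> \<open>f \<in> k\<close>] by blast
    then show ?case
      using \<open>k \<in> K\<close> by (intro exI[of _ F] exI[of _ r]) auto
  next
    case (Basis s)
    then obtain p h r where s: "s = {g \<in> V. p (\<lambda>x. g x - h x) < r}" "p \<in> P" "h \<in> V"
      by blast
    have "g \<in> s" if "g \<in> V" "p (\<lambda>x. g x - f x) < r - p (\<lambda>x. f x - h x)" for g
      using tri[OF s(2) that(1) assms(3) s(3)] that s by simp
    then show ?case
      using s Basis
      by (intro exI[of _ "{p}"] exI[of _ "r - p (\<lambda>x. f x - h x)"]) auto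
  qed
qed

lemma dual_seminorm_bound:
  fixes V :: "('a \<Rightarrow> complex) set"
  assumes T: "T \<in> dual (subtopology (seminorm_topology V P) W)"
    and top: "topspace (seminorm_topology V P) = V" and "W \<subseteq> V"
    and zero: "(\<lambda>x. 0) \<in> W"
    and scale: "\<And>c a. a \<in> W \<Longrightarrow> (\<lambda>x. c * a x) \<in> W"
    and nonneg: "\<And>p a. p \<in> P \<Longrightarrow> a \<in> V \<Longrightarrow> 0 \<le> p a"
    and hom: "\<And>p a c. p \<in> P \<Longrightarrow> a \<in> V \<Longrightarrow> p (\<lambda>x. c * a x) = norm c * p a"
    and tri: "\<And>p a b c. p \<in> P \<Longrightarrow> a \<in> V \<Longrightarrow> b \<in> V \<Longrightarrow> c \<in> V \<Longrightarrow>
      p (\<lambda>x. a x - c x) \<le> p (\<lambda>x. a x - b x) + p (\<lambda>x. b x - c x)"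
  shows "\<exists>F C. finite F \<and> F \<subseteq> P \<and> C \<ge> 0 \<and> (\<forall>f\<in>W. norm (T f) \<le> C * (\<Sum>p\<in>F. p f))"
proof -
  let ?X = "subtopology (seminorm_topology V P) W"
  have topX: "topspace ?X = W"
    using top \<open>W \<subseteq> V\<close> by auto
  have cont: "continuous_map ?X euclidean T"
    and lin: "\<And>c f. f \<in> W \<Longrightarrow> T (\<lambda>x. c * f x) = c * T f"
    using T topX unfolding dual_def by auto
  have T0: "T (\<lambda>x. 0) = 0"
    using lin[OF zero, of 0] by simp
  have "openin ?X {f \<in> topspace ?X. T f \<in> ball 0 1}"
    using cont by (rule openin_continuous_map_preimage) simp
  then obtain U where U: "openin (seminorm_topology V P) U" "{f \<in> W. T f \<in> ball 0 1} = U \<inter> W"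
    unfolding openin_subtopology topX by blast
  have "(\<lambda>x. 0) \<in> U \<inter> W"
    unfolding U(2)[symmetric] using zero T0 by simp
  then have "(\<lambda>x. 0) \<in> U" by blast
  moreover have "(\<lambda>x. 0) \<in> V"
    using zero \<open>W \<subseteq> V\<close> by blast
  ultimately have "\<exists>F r. finite F \<and> F \<subseteq> P \<and> r > 0 \<and>
      (\<forall>g\<in>V. (\<forall>p\<in>F. p (\<lambda>x. g x - 0) < r) \<longrightarrow> g \<in> U)"
    by (rule openin_seminorm_topology_nhd[OF U(1)]) (rule tri)
  then obtain F r where F: "finite F" "F \<subseteq> P" "r > 0"
    and FU: "\<And>g. g \<in> V \<Longrightarrow> (\<forall>p\<in>F. p (\<lambda>x. g x - 0) < r) \<Longrightarrow> g \<in> U"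
    by blast
  have bound: "norm (T f) \<le> 2 / r * (\<Sum>p\<in>F. p f)" if f: "f \<in> W" for f
  proof (rule field_le_epsilon)
    fix e :: real assume "e > 0"
    \<comment> \<open>The slack \<open>d\<close> keeps the divisor \<open>S + d\<close> positive
      when every seminorm in \<open>F\<close> vanishes at \<open>f\<close>; it costs exactly
      \<open>e\<close> in the final bound.\<close>
    define d where "d = e * r / 2"
    define S where "S = (\<Sum>p\<in>F. p f)"
    have "d > 0" using \<open>e > 0\<close> F by (simp add: d_def)
    have "f \<in> V" using f \<open>W \<subseteq> V\<close> by blast
    have pS: "p f \<le> S" if "p \<in> F" for p
      unfolding S_def using that F nonneg \<open>f \<in> V\<close>
      by (intro member_le_sum) auto
    have "S \<ge> 0" unfolding S_def using F nonneg \<open>f \<in> V\<close> by (intro sum_nonneg) auto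
    define c where "c = complex_of_real (r / (2 * (S + d)))"
    have nc: "norm c = r / (2 * (S + d))"
      unfolding c_def norm_of_real using \<open>S \<ge> 0\<close> \<open>d > 0\<close> F by simp
    have "p (\<lambda>x. c * f x) < r" if "p \<in> F" for p
    proof -
      have "p (\<lambda>x. c * f x) = r / (2 * (S + d)) * p f"
        using hom[of p f c] that F \<open>f \<in> V\<close> nc by auto
      also have "\<dots> \<le> r / (2 * (S + d)) * (S + d)"
        using pS[OF that] \<open>S \<ge> 0\<close> \<open>d > 0\<close> F by (intro mult_left_mono) auto
      also have "\<dots> = r / 2" using \<open>S \<ge> 0\<close> \<open>d > 0\<close> by (simp add: divide_simps)
      also have "\<dots> < r" using F by simp
      finally show ?thesis .
    qed
    moreover have "(\<lambda>x. c * f x) \<in> W" by (rule scale[OF f])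
    ultimately have "(\<lambda>x. c * f x) \<in> U \<inter> W"
      using FU[of "\<lambda>x. c * f x"] \<open>W \<subseteq> V\<close> by auto
    then have "norm (T (\<lambda>x. c * f x)) < 1"
      unfolding U(2)[symmetric] by simp
    then have "norm c * norm (T f) < 1"
      using lin[OF f] by (simp add: norm_mult)
    then have "norm (T f) < 2 * (S + d) / r"
      unfolding nc using \<open>S \<ge> 0\<close> \<open>d > 0\<close> F by (simp add: field_simps)
    also have "2 * (S + d) / r = 2 / r * S + e"
      unfolding d_def using F by (simp add: field_simps)
    finally show "norm (T f) \<le> 2 / r * (\<Sum>p\<in>F. p f) + e"
      unfolding S_def by simp
  qed
  then show ?thesis
    using F by (intro exI[of _ F] exI[of _ "2 / r"]) auto
qed

lemma dual_seminorm_topologyI: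
  fixes V :: "('a \<Rightarrow> complex) set"
  assumes top: "topspace (seminorm_topology V P) = V"
    and "finite F" "F \<subseteq> P" "C \<ge> 0"
    and bound: "\<And>f. f \<in> V \<Longrightarrow> norm (T f) \<le> C * (\<Sum>p\<in>F. p f)"
    and add: "\<And>a b. a \<in> V \<Longrightarrow> b \<in> V \<Longrightarrow> T (\<lambda>x. a x + b x) = T a + T b"
    and scale: "\<And>c a. a \<in> V \<Longrightarrow> T (\<lambda>x. c * a x) = c * T a"
    and diff: "\<And>a b. a \<in> V \<Longrightarrow> b \<in> V \<Longrightarrow> (\<lambda>x. a x - b x) \<in> V"
    and zero: "\<And>p. p \<in> P \<Longrightarrow> p (\<lambda>x. 0) = 0"
  shows "T \<in> dual (seminorm_topology V P)"
proof -
  let ?X = "seminorm_topology V P"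
  have Tdiff: "T (\<lambda>x. a x - b x) = T a - T b" if "a \<in> V" "b \<in> V" for a b
    using add[OF diff[OF that] that(2)] by simp
  have "openin ?X {f \<in> topspace ?X. T f \<in> U}" if "open U" for U
    unfolding top
  proof (subst openin_subopen, rule ballI)
    fix f assume "f \<in> {f \<in> V. T f \<in> U}"
    then have f: "f \<in> V" "T f \<in> U" by auto
    obtain e where e: "e > 0" "ball (T f) e \<subseteq> U"
      using \<open>open U\<close> f(2) open_contains_ball by blast
    \<comment> \<open>The added ones avoid division by zero when \<open>C = 0\<close> or
      \<open>F\<close> is empty, and make the final estimate strict.\<close>
    define r where "r = e / ((C + 1) * (real (card F) + 1))"
    have "r > 0" using e \<open>C \<ge> 0\<close> by (simp add: r_def)
    \<comment> \<open>For empty \<open>F\<close> the intersection alone would be the whole type; the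
      factor \<open>V\<close> keeps \<open>N\<close> inside the space.\<close>
    define N where "N = V \<inter> \<Inter> ((\<lambda>p. {g \<in> V. p (\<lambda>x. g x - f x) < r}) ` F)"
    have "openin ?X (\<Inter> (insert V ((\<lambda>p. {g \<in> V. p (\<lambda>x. g x - f x) < r}) ` F)))"
    proof (rule openin_Inter)
      show "finite (insert V ((\<lambda>p. {g \<in> V. p (\<lambda>x. g x - f x) < r}) ` F))"
        using \<open>finite F\<close> by simp
      have "openin ?X {g \<in> V. p (\<lambda>x. g x - f x) < r}" if "p \<in> F" for p
        unfolding seminorm_topology_def openin_topology_generated_by_iff
        using that \<open>F \<subseteq> P\<close> f by (intro generate_topology_on.Basis) blast
      moreover have "openin ?X V"
        using openin_topspace[of ?X] top by simp
      ultimately show "openin ?X X"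
        if "X \<in> insert V ((\<lambda>p. {g \<in> V. p (\<lambda>x. g x - f x) < r}) ` F)" for X
        using that by auto
    qed simp
    then have "openin ?X N"
      by (simp add: N_def)
    moreover have "p (\<lambda>x. f x - f x) < r" if "p \<in> F" for p
      using zero[of p] that \<open>F \<subseteq> P\<close> \<open>r > 0\<close> by auto
    then have "f \<in> N"
      using f unfolding N_def by blast
    moreover have "N \<subseteq> {f \<in> V. T f \<in> U}"
    proof
      fix g assume "g \<in> N"
      then have g: "g \<in> V" "\<And>p. p \<in> F \<Longrightarrow> p (\<lambda>x. g x - f x) < r"
        unfolding N_def by auto
      have "norm (T g - T f) \<le> C * (\<Sum>p\<in>F. p (\<lambda>x. g x - f x))"
        using bound[OF diff[OF g(1) f(1)]] Tdiff g f by simp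
      also have "\<dots> \<le> C * (\<Sum>p\<in>F. r)"
        using g(2) \<open>C \<ge> 0\<close> by (intro mult_left_mono sum_mono) (auto intro: less_imp_le)
      also have "\<dots> = C * (real (card F) * r)" by simp
      also have "\<dots> < (C + 1) * ((real (card F) + 1) * r)"
        using \<open>C \<ge> 0\<close> \<open>r > 0\<close> by (rule_tac mult_strict_mono) auto
      also have "\<dots> = e" using \<open>C \<ge> 0\<close> by (simp add: r_def)
      finally have "T g \<in> ball (T f) e"
        by (simp add: dist_norm norm_minus_commute)
      then show "g \<in> {f \<in> V. T f \<in> U}" using e g by auto
    qed
    ultimately show "\<exists>N. openin ?X N \<and> f \<in> N \<and> N \<subseteq> {f \<in> V. T f \<in> U}" by blast
  qed
  then have "continuous_map ?X euclidean T"
    unfolding continuous_map_def by (auto simp: open_openin[symmetric])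
  then show ?thesis
    unfolding dual_def top using add scale by blast
qed

section \<open>Schwartz functions\<close>

lemma power_add_le:
  fixes a b :: real
  assumes "0 \<le> a" "0 \<le> b"
  shows "(a + b) ^ n \<le> 2 ^ n * (a ^ n + b ^ n)"
proof -
  have "(a + b) ^ n \<le> (2 * max a b) ^ n" using assms by (intro power_mono) auto
  also have "\<dots> \<le> 2 ^ n * (a ^ n + b ^ n)"
    unfolding power_mult_distrib using assms by (intro mult_left_mono) (auto simp: max_def)
  finally show ?thesis .
qed

section \<open>Iterated derivatives\<close>

definition smooth :: "(real \<Rightarrow> complex) \<Rightarrow> bool" where
  "smooth f \<longleftrightarrow> (\<forall>k t. (vderiv ^^ k) f differentiable (at t))"

lemma vderivI: "(f has_vector_derivative d) (at t) \<Longrightarrow> vderiv f t = d"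
  unfolding vderiv_def by (rule vector_derivative_at)

lemma vderiv_works:
  "f differentiable (at t) \<Longrightarrow> (f has_vector_derivative vderiv f t) (at t)"
  unfolding vderiv_def by (simp add: vector_derivative_works)

lemma smooth_vderiv_works:
  "smooth f \<Longrightarrow> ((vderiv ^^ k) f has_vector_derivative (vderiv ^^ Suc k) f t) (at t)"
  using vderiv_works[of "(vderiv ^^ k) f" t] unfolding smooth_def by simp

text \<open>Guessing all derivatives at once reduces each closure property below to a single
  differentiation rule, with no further induction on the order.\<close>

lemma smooth_eqI:
  assumes "D 0 = f" "\<And>k t. (D k has_vector_derivative D (Suc k) t) (at t)"
  shows "smooth f" "(vderiv ^^ k) f = D k"
proof -
  have eq: "(vderiv ^^ k) f = D k" for k
  proof (induction k)
    case (Suc k)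
    show ?case using vderivI[OF assms(2)] by (auto simp: Suc)
  qed (simp add: assms(1))
  show "smooth f"
    unfolding smooth_def eq using assms(2) by (auto intro: differentiableI_vector)
  show "(vderiv ^^ k) f = D k" by (rule eq)
qed

text \<open>Real linearity suffices, so this covers complex multiples, negation and conjugation
  together.\<close>

lemma smooth_linear:
  assumes "smooth f" "bounded_linear A"
  shows "smooth (\<lambda>x. A (f x))" "(vderiv ^^ k) (\<lambda>x. A (f x)) = (\<lambda>x. A ((vderiv ^^ k) f x))"
proof -
  have D: "((\<lambda>x. A ((vderiv ^^ k) f x)) has_vector_derivative A ((vderiv ^^ Suc k) f t)) (at t)" for k t
    by (rule bounded_linear.has_vector_derivative[OF assms(2) smooth_vderiv_works[OF assms(1)]])
  show "smooth (\<lambda>x. A (f x))" "(vderiv ^^ k) (\<lambda>x. A (f x)) = (\<lambda>x. A ((vderiv ^^ k) f x))"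
    using smooth_eqI[where D = "\<lambda>k x. A ((vderiv ^^ k) f x)" and f = "\<lambda>x. A (f x)", OF _ D] by auto
qed

lemma smooth_add:
  assumes "smooth f" "smooth g"
  shows "smooth (\<lambda>x. f x + g x)"
    "(vderiv ^^ k) (\<lambda>x. f x + g x) = (\<lambda>x. (vderiv ^^ k) f x + (vderiv ^^ k) g x)"
proof -
  have D: "((\<lambda>x. (vderiv ^^ k) f x + (vderiv ^^ k) g x) has_vector_derivative
      (vderiv ^^ Suc k) f t + (vderiv ^^ Suc k) g t) (at t)" for k t
    by (rule has_vector_derivative_add[OF smooth_vderiv_works[OF assms(1)] smooth_vderiv_works[OF assms(2)]])
  show "smooth (\<lambda>x. f x + g x)"
    "(vderiv ^^ k) (\<lambda>x. f x + g x) = (\<lambda>x. (vderiv ^^ k) f x + (vderiv ^^ k) g x)"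
    using smooth_eqI[where D = "\<lambda>k x. (vderiv ^^ k) f x + (vderiv ^^ k) g x"
        and f = "\<lambda>x. f x + g x", OF _ D] by auto
qed

lemma smooth_affine:
  assumes "smooth f"
  shows "smooth (\<lambda>x. f (a * (x - b)))"
    "(vderiv ^^ k) (\<lambda>x. f (a * (x - b))) = (\<lambda>x. a ^ k *\<^sub>R (vderiv ^^ k) f (a * (x - b)))"
proof -
  have "((\<lambda>x. (vderiv ^^ k) f (a * (x - b))) has_vector_derivative
      a *\<^sub>R (vderiv ^^ Suc k) f (a * (t - b))) (at t)" for k t
  proof -
    have "((\<lambda>x. a * (x - b)) has_vector_derivative a) (at t)"
      unfolding has_real_derivative_iff_has_vector_derivative[symmetric]
      by (auto intro!: derivative_eq_intros)
    from vector_diff_chain_at[OF this smooth_vderiv_works[OF assms]]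
    show ?thesis by (simp add: o_def del: funpow.simps)
  qed
  note D = bounded_linear.has_vector_derivative[OF bounded_linear_scaleR_right this]
  have D': "((\<lambda>x. a ^ k *\<^sub>R (vderiv ^^ k) f (a * (x - b))) has_vector_derivative
      a ^ Suc k *\<^sub>R (vderiv ^^ Suc k) f (a * (t - b))) (at t)" for k t
    using D[of "a ^ k" k t] by (simp add: mult.commute del: funpow.simps)
  show "smooth (\<lambda>x. f (a * (x - b)))"
    "(vderiv ^^ k) (\<lambda>x. f (a * (x - b))) = (\<lambda>x. a ^ k *\<^sub>R (vderiv ^^ k) f (a * (x - b)))"
    using smooth_eqI[where D = "\<lambda>k x. a ^ k *\<^sub>R (vderiv ^^ k) f (a * (x - b))"
        and f = "\<lambda>x. f (a * (x - b))", OF _ D'] by auto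
qed

section \<open>Schwartz functions and their seminorms\<close>

lemma schwartz_iff:
  "f \<in> schwartz \<longleftrightarrow> smooth f \<and> (\<forall>j k. \<exists>B. \<forall>t. norm (t ^ j *\<^sub>R (vderiv ^^ k) f t) \<le> B)"
  unfolding schwartz_def smooth_def bdd_above_def by auto

lemma schwartz_smooth: "f \<in> schwartz \<Longrightarrow> smooth f"
  by (simp add: schwartz_iff)

lemma schwartz_bdd:
  "f \<in> schwartz \<Longrightarrow> bdd_above (range (\<lambda>t. norm (t ^ j *\<^sub>R (vderiv ^^ k) f t)))"
  unfolding schwartz_def by auto

lemma schwartz_seminorm_upper:
  "f \<in> schwartz \<Longrightarrow> norm (t ^ j *\<^sub>R (vderiv ^^ k) f t) \<le> schwartz_seminorm j k f"
  unfolding schwartz_seminorm_def by (rule cSUP_upper[OF UNIV_I schwartz_bdd])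

lemma schwartz_seminorm_least:
  "(\<And>t. norm (t ^ j *\<^sub>R (vderiv ^^ k) f t) \<le> B) \<Longrightarrow> schwartz_seminorm j k f \<le> B"
  unfolding schwartz_seminorm_def by (rule cSUP_least) auto

lemma schwartz_seminorm_nonneg:
  "f \<in> schwartz \<Longrightarrow> 0 \<le> schwartz_seminorm j k f"
  using order_trans[OF norm_ge_zero schwartz_seminorm_upper] .

lemma schwartz_linear:
  assumes "f \<in> schwartz" "bounded_linear A"
  shows "(\<lambda>x. A (f x)) \<in> schwartz"
  unfolding schwartz_iff
proof (intro conjI allI)
  show "smooth (\<lambda>x. A (f x))"
    using smooth_linear(1) assms schwartz_smooth by blast
  fix j k
  obtain K where K: "K \<ge> 0" "\<And>x. norm (A x) \<le> norm x * K"
    using bounded_linear.nonneg_bounded[OF assms(2)] by blast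
  have "norm (t ^ j *\<^sub>R A ((vderiv ^^ k) f t)) \<le> schwartz_seminorm j k f * K" for t
    using order_trans[OF K(2)[of "t ^ j *\<^sub>R (vderiv ^^ k) f t"]
        mult_right_mono[OF schwartz_seminorm_upper[OF assms(1)] K(1)]]
    by (simp add: linear_simps(5)[OF assms(2)])
  then show "\<exists>B. \<forall>t. norm (t ^ j *\<^sub>R (vderiv ^^ k) (\<lambda>x. A (f x)) t) \<le> B"
    unfolding smooth_linear(2)[OF schwartz_smooth[OF assms(1)] assms(2)] by blast
qed

lemma schwartz_cmult: "f \<in> schwartz \<Longrightarrow> (\<lambda>x. c * f x) \<in> schwartz"
  by (rule schwartz_linear[OF _ bounded_linear_mult_right])

lemma schwartz_cnj: "f \<in> schwartz \<Longrightarrow> (\<lambda>x. cnj (f x)) \<in> schwartz"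
  by (rule schwartz_linear[OF _ bounded_linear_cnj])

lemma schwartz_zero: "(\<lambda>x. 0) \<in> schwartz"
  using smooth_eqI[where D = "\<lambda>_ _. 0" and f = "\<lambda>_. 0"] unfolding schwartz_iff by auto

text \<open>The pointwise estimate gives only one inequality; applied again with
  \<open>inverse c\<close>, it gives the other one for nonzero \<open>c\<close>.\<close>

lemma schwartz_seminorm_cmult:
  assumes "f \<in> schwartz"
  shows "schwartz_seminorm j k (\<lambda>x. c * f x) = norm c * schwartz_seminorm j k f"
proof -
  have le: "schwartz_seminorm j k (\<lambda>x. c * g x) \<le> norm c * schwartz_seminorm j k g"
    if "g \<in> schwartz" for c g
  proof (rule schwartz_seminorm_least)
    fix t
    show "norm (t ^ j *\<^sub>R (vderiv ^^ k) (\<lambda>x. c * g x) t) \<le> norm c * schwartz_seminorm j k g"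
      unfolding smooth_linear(2)[OF schwartz_smooth[OF that] bounded_linear_mult_right]
      using mult_left_mono[OF schwartz_seminorm_upper[OF that, of t j k] norm_ge_zero[of c]]
      by (simp add: norm_mult mult_ac)
  qed
  show ?thesis
  proof (cases "c = 0")
    case True
    then show ?thesis
      using le[OF assms, of 0] schwartz_seminorm_nonneg[OF schwartz_zero, of j k] by simp
  next
    case False
    have "schwartz_seminorm j k f \<le> norm (inverse c) * schwartz_seminorm j k (\<lambda>x. c * f x)"
      using le[OF schwartz_cmult[OF assms, of c], of "inverse c"] False
      by (simp add: mult.assoc[symmetric])
    then have "norm c * schwartz_seminorm j k f \<le> schwartz_seminorm j k (\<lambda>x. c * f x)"
      using False by (simp add: norm_inverse norm_divide field_simps)
    then show ?thesis using le[OF assms, of c] by simp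
  qed
qed

lemma schwartz_add:
  assumes "f \<in> schwartz" "g \<in> schwartz"
  shows "(\<lambda>x. f x + g x) \<in> schwartz"
    and schwartz_seminorm_triangle: "schwartz_seminorm j k (\<lambda>x. f x + g x)
      \<le> schwartz_seminorm j k f + schwartz_seminorm j k g"
proof -
  note sm = schwartz_smooth[OF assms(1)] schwartz_smooth[OF assms(2)]
  have *: "norm (t ^ j *\<^sub>R (vderiv ^^ k) (\<lambda>x. f x + g x) t)
      \<le> schwartz_seminorm j k f + schwartz_seminorm j k g" for t j k
    unfolding smooth_add(2)[OF sm] scaleR_add_right
    by (rule norm_triangle_mono[OF schwartz_seminorm_upper[OF assms(1)]
          schwartz_seminorm_upper[OF assms(2)]])
  show "(\<lambda>x. f x + g x) \<in> schwartz"
    using smooth_add(1)[OF sm] * unfolding schwartz_iff by blast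
  show "schwartz_seminorm j k (\<lambda>x. f x + g x)
      \<le> schwartz_seminorm j k f + schwartz_seminorm j k g"
    by (rule schwartz_seminorm_least[OF *])
qed

lemma schwartz_diff:
  assumes "f \<in> schwartz" "g \<in> schwartz"
  shows "(\<lambda>x. f x - g x) \<in> schwartz"
    and vderiv_funpow_diff:
      "(vderiv ^^ k) (\<lambda>x. f x - g x) = (\<lambda>x. (vderiv ^^ k) f x - (vderiv ^^ k) g x)"
proof -
  show "(\<lambda>x. f x - g x) \<in> schwartz"
    using schwartz_add(1)[OF assms(1) schwartz_cmult[OF assms(2), of "-1"]] by simp
  note m = smooth_linear[OF schwartz_smooth[OF assms(2)] bounded_linear_minus[OF bounded_linear_ident]]
  show "(vderiv ^^ k) (\<lambda>x. f x - g x) = (\<lambda>x. (vderiv ^^ k) f x - (vderiv ^^ k) g x)"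
    using smooth_add(2)[OF schwartz_smooth[OF assms(1)] m(1), of k] unfolding m(2) by simp
qed

lemma schwartz_vderiv:
  assumes "f \<in> schwartz"
  shows "vderiv f \<in> schwartz"
proof -
  have "(vderiv ^^ k) (vderiv f) = (vderiv ^^ Suc k) f" for k
    by (simp only: funpow_Suc_right o_def)
  then show ?thesis
    using assms unfolding schwartz_def by (auto simp del: funpow.simps)
qed

text \<open>With \<open>y = a * (t - b)\<close> one has \<open>t = y / a + b\<close>, so the weight
  \<open>t ^ j\<close> is dominated by \<open>y ^ j\<close> and a constant, which the seminorms with
  weights \<open>j\<close> and 0 control.\<close>

lemma schwartz_affine:
  assumes "f \<in> schwartz" "a \<noteq> 0"
  shows "(\<lambda>x. f (a * (x - b))) \<in> schwartz"
  unfolding schwartz_iff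
proof (intro conjI allI)
  show "smooth (\<lambda>x. f (a * (x - b)))"
    using smooth_affine(1) assms(1) schwartz_smooth by blast
  fix j k
  let ?B = "2 ^ j * (schwartz_seminorm j k f / \<bar>a\<bar> ^ j + \<bar>b\<bar> ^ j * schwartz_seminorm 0 k f)"
  have "norm (t ^ j *\<^sub>R a ^ k *\<^sub>R (vderiv ^^ k) f (a * (t - b))) \<le>
    \<bar>a\<bar> ^ k * ?B" for t
  proof -
    define y where "y = a * (t - b)"
    have "t = y / a + b" using assms by (simp add: y_def)
    then have "\<bar>t\<bar> \<le> \<bar>y / a\<bar> + \<bar>b\<bar>"
      by (metis abs_triangle_ineq)
    then have "\<bar>t\<bar> ^ j \<le> (\<bar>y / a\<bar> + \<bar>b\<bar>) ^ j"
      by (intro power_mono) auto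
    also have "\<dots> \<le> 2 ^ j * (\<bar>y / a\<bar> ^ j + \<bar>b\<bar> ^ j)"
      by (rule power_add_le) auto
    finally have "\<bar>t\<bar> ^ j * norm ((vderiv ^^ k) f y)
      \<le> 2 ^ j * (\<bar>y / a\<bar> ^ j + \<bar>b\<bar> ^ j) * norm ((vderiv ^^ k) f y)"
      by (intro mult_right_mono) auto
    also have "\<dots> = 2 ^ j * (norm (y ^ j *\<^sub>R (vderiv ^^ k) f y) / \<bar>a\<bar> ^ j
        + \<bar>b\<bar> ^ j * norm (y ^ 0 *\<^sub>R (vderiv ^^ k) f y))"
      by (simp add: power_abs power_divide algebra_simps)
    also have "\<dots> \<le> ?B"
      using assms by (intro mult_left_mono add_mono divide_right_mono schwartz_seminorm_upper) auto
    finally have "\<bar>a\<bar> ^ k * (\<bar>t\<bar> ^ j * norm ((vderiv ^^ k) f y)) \<le>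
      \<bar>a\<bar> ^ k * ?B"
      by (rule mult_left_mono) simp
    moreover have "norm (t ^ j *\<^sub>R a ^ k *\<^sub>R (vderiv ^^ k) f y)
      = \<bar>a\<bar> ^ k * (\<bar>t\<bar> ^ j * norm ((vderiv ^^ k) f y))"
      by (simp add: abs_mult power_abs)
    ultimately show ?thesis
      unfolding y_def[symmetric] by (simp only:)
  qed
  then show "\<exists>B. \<forall>t. norm (t ^ j *\<^sub>R (vderiv ^^ k) (\<lambda>x. f (a * (x - b))) t) \<le> B"
    unfolding smooth_affine(2)[OF schwartz_smooth[OF assms(1)]] by blast
qed

text \<open>Each weight \<open>t\<close> scales like \<open>r\<close> and each derivative like
  \<open>1 / r\<close>. The negative powers of \<open>r\<close> are the polynomial loss that the
  Taylor remainder has to beat later.\<close>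

lemma schwartz_seminorm_dilate:
  assumes "f \<in> schwartz" "r > 0"
  shows "schwartz_seminorm j k (\<lambda>x. f (x / r)) \<le> r ^ j * (1 / r) ^ k * schwartz_seminorm j k f"
proof (rule schwartz_seminorm_least)
  fix t
  have "norm (t ^ j *\<^sub>R (vderiv ^^ k) (\<lambda>x. f (x / r)) t)
      = norm (t ^ j *\<^sub>R (1 / r) ^ k *\<^sub>R (vderiv ^^ k) f (t / r))"
    using smooth_affine(2)[OF schwartz_smooth[OF assms(1)], of k "1 / r" 0] by simp
  also have "\<dots> = r ^ j * (1 / r) ^ k * norm ((t / r) ^ j *\<^sub>R (vderiv ^^ k) f (t / r))"
    using assms(2) by (simp add: power_divide abs_mult power_abs)
  also have "\<dots> \<le> r ^ j * (1 / r) ^ k * schwartz_seminorm j k f"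
    using assms by (intro mult_left_mono schwartz_seminorm_upper) auto
  finally show "norm (t ^ j *\<^sub>R (vderiv ^^ k) (\<lambda>x. f (x / r)) t)
    \<le> r ^ j * (1 / r) ^ k * schwartz_seminorm j k f" .
qed

text \<open>On Schwartz functions these sums increase with \<open>n\<close> and dominate each single
  seminorm of index at most \<open>n\<close>, so one number replaces a finite set of
  seminorms.\<close>

definition total_seminorm :: "nat \<Rightarrow> (real \<Rightarrow> complex) \<Rightarrow> real" where
  "total_seminorm n f = (\<Sum>j\<le>n. \<Sum>k\<le>n. schwartz_seminorm j k f)"

lemma total_seminorm_nonneg: "f \<in> schwartz \<Longrightarrow> 0 \<le> total_seminorm n f"
  unfolding total_seminorm_def by (intro sum_nonneg schwartz_seminorm_nonneg)

lemma total_seminorm_cmult: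
  "f \<in> schwartz \<Longrightarrow> total_seminorm n (\<lambda>x. c * f x) = norm c * total_seminorm n f"
  unfolding total_seminorm_def by (simp add: schwartz_seminorm_cmult sum_distrib_left)

lemma total_seminorm_triangle:
  assumes "f \<in> schwartz" "g \<in> schwartz"
  shows "total_seminorm n (\<lambda>x. f x + g x) \<le> total_seminorm n f + total_seminorm n g"
  unfolding total_seminorm_def sum.distrib[symmetric]
  by (intro sum_mono schwartz_seminorm_triangle assms)

lemma total_seminorm_diff:
  assumes "a \<in> schwartz" "b \<in> schwartz" "c \<in> schwartz"
  shows "total_seminorm n (\<lambda>x. a x - b x)
    \<le> total_seminorm n (\<lambda>x. a x - c x) + total_seminorm n (\<lambda>x. b x - c x)"
  using total_seminorm_triangle[OF schwartz_diff(1)[OF assms(1,3)]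
      schwartz_cmult[OF schwartz_diff(1)[OF assms(2,3)], of "- 1"], of n]
    total_seminorm_cmult[OF schwartz_diff(1)[OF assms(2,3)], of n "- 1"]
  by simp

lemma total_seminorm_swap:
  assumes "a \<in> schwartz" "b \<in> schwartz"
  shows "total_seminorm n (\<lambda>x. a x - b x) = total_seminorm n (\<lambda>x. b x - a x)"
  using total_seminorm_cmult[OF schwartz_diff(1)[OF assms], of n "- 1"] by simp

lemma total_seminorm_mono:
  assumes "f \<in> schwartz" "n \<le> n'"
  shows "total_seminorm n f \<le> total_seminorm n' f"
proof -
  have "total_seminorm n f \<le> (\<Sum>j\<le>n. \<Sum>k\<le>n'. schwartz_seminorm j k f)"
    unfolding total_seminorm_def using assms
    by (intro sum_mono sum_mono2) (auto intro: schwartz_seminorm_nonneg)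
  also have "\<dots> \<le> total_seminorm n' f"
    unfolding total_seminorm_def using assms
    by (intro sum_mono2) (auto intro!: schwartz_seminorm_nonneg sum_nonneg)
  finally show ?thesis .
qed

lemma schwartz_seminorm_le_total:
  assumes "f \<in> schwartz" "j \<le> n" "k \<le> n"
  shows "schwartz_seminorm j k f \<le> total_seminorm n f"
proof -
  have "schwartz_seminorm j k f \<le> (\<Sum>k\<le>n. schwartz_seminorm j k f)"
    using assms by (intro member_le_sum) (auto intro: schwartz_seminorm_nonneg)
  also have "\<dots> \<le> total_seminorm n f"
    unfolding total_seminorm_def
    using assms by (intro member_le_sum[of j "{..n}" "\<lambda>j. \<Sum>k\<le>n. schwartz_seminorm j k f"])
      (auto intro!: schwartz_seminorm_nonneg sum_nonneg)
  finally show ?thesis .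
qed

lemma total_seminorm_dilate:
  assumes "f \<in> schwartz" "r > 0"
  shows "total_seminorm n (\<lambda>x. f (x / r)) \<le> (1 + r) ^ n * (1 + 1 / r) ^ n * total_seminorm n f"
  unfolding total_seminorm_def sum_distrib_left
proof (intro sum_mono)
  fix j k assume jk: "j \<in> {..n}" "k \<in> {..n}"
  have "r ^ j \<le> (1 + r) ^ n"
    using power_mono[of r "1 + r" j] power_increasing[of j n "1 + r"] assms jk by (force intro: order_trans)
  moreover have "(1 / r) ^ k \<le> (1 + 1 / r) ^ n"
    using power_mono[of "1 / r" "1 + 1 / r" k] power_increasing[of k n "1 + 1 / r"] assms jk by (force intro: order_trans)
  ultimately have "r ^ j * (1 / r) ^ k \<le> (1 + r) ^ n * (1 + 1 / r) ^ n"
    using assms(2) by (intro mult_mono) auto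
  then show "schwartz_seminorm j k (\<lambda>x. f (x / r))
    \<le> (1 + r) ^ n * (1 + 1 / r) ^ n * schwartz_seminorm j k f"
    using schwartz_seminorm_dilate[OF assms, of j k] schwartz_seminorm_nonneg[OF assms(1), of j k]
    by (meson mult_right_mono order_trans)
qed

text \<open>The quantitative form of membership in the dual. Order and constant are explicit
  arguments because they must be common to a sequence of functionals or be followed through a
  dilation.\<close>

definition seminorm_bounded ::
  "(real \<Rightarrow> complex) set \<Rightarrow> nat \<Rightarrow> real \<Rightarrow> ((real \<Rightarrow> complex) \<Rightarrow> complex) \<Rightarrow> bool" where
  "seminorm_bounded V n C T \<longleftrightarrow>
     (\<forall>a\<in>V. \<forall>b\<in>V. T (\<lambda>x. a x + b x) = T a + T b) \<and>
     (\<forall>c. \<forall>a\<in>V. T (\<lambda>x. c * a x) = c * T a) \<and> C \<ge> 0 \<and>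
     (\<forall>a\<in>V. norm (T a) \<le> C * total_seminorm n a)"

lemma topspace_schwartz_topology: "topspace schwartz_topology = schwartz"
  unfolding schwartz_topology_def
  by (rule topspace_seminorm_topology[of "schwartz_seminorm 0 0"])
    (use schwartz_seminorm_cmult[OF schwartz_zero, of _ _ 0] in auto)

lemma dual_imp_seminorm_bounded:
  assumes T: "T \<in> dual (subtopology schwartz_topology W)"
    and W: "W \<subseteq> schwartz" "(\<lambda>x. 0) \<in> W" "\<And>c a. a \<in> W \<Longrightarrow> (\<lambda>x. c * a x) \<in> W"
  shows "\<exists>n C. seminorm_bounded W n C T"
proof -
  let ?P = "{schwartz_seminorm j k | j k. True}"
  have top: "topspace (seminorm_topology schwartz ?P) = schwartz"
    using topspace_schwartz_topology unfolding schwartz_topology_def .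
  have "\<exists>F C. finite F \<and> F \<subseteq> ?P \<and> C \<ge> 0 \<and> (\<forall>f\<in>W. norm (T f) \<le> C * (\<Sum>p\<in>F. p f))"
  proof (rule dual_seminorm_bound[OF T[unfolded schwartz_topology_def] top W])
    fix p a b c assume "p \<in> ?P" and abc: "a \<in> schwartz" "b \<in> schwartz" "c \<in> schwartz"
    then show "p (\<lambda>x. a x - c x) \<le> p (\<lambda>x. a x - b x) + p (\<lambda>x. b x - c x)"
      using schwartz_seminorm_triangle[OF schwartz_diff(1)[OF abc(1,2)] schwartz_diff(1)[OF abc(2,3)]]
      by auto
  qed (auto simp: schwartz_seminorm_nonneg schwartz_seminorm_cmult)
  then obtain F C where F: "finite F" "F \<subseteq> ?P" "C \<ge> 0"
    and bound: "\<And>f. f \<in> W \<Longrightarrow> norm (T f) \<le> C * (\<Sum>p\<in>F. p f)"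
    by blast
  have "\<exists>n. \<forall>f\<in>schwartz. p f \<le> total_seminorm n f" if "p \<in> F" for p
  proof -
    have "p \<in> ?P" using that F(2) by blast
    then obtain j k where "p = schwartz_seminorm j k" by blast
    then show ?thesis
      by (intro exI[of _ "max j k"]) (auto intro: schwartz_seminorm_le_total)
  qed
  then obtain N where N: "\<And>p f. p \<in> F \<Longrightarrow> f \<in> schwartz \<Longrightarrow> p f \<le> total_seminorm (N p) f"
    by metis
  \<comment> \<open>The sum is merely a convenient upper bound for all orders \<open>N p\<close>,
    available for empty \<open>F\<close> as well.\<close>
  define n where "n = (\<Sum>p\<in>F. N p)"
  have "norm (T f) \<le> C * real (card F) * total_seminorm n f" if "f \<in> W" for f
  proof -
    have f: "f \<in> schwartz" using W that by blast
    have "p f \<le> total_seminorm n f" if "p \<in> F" for p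
    proof -
      have "N p \<le> n" unfolding n_def using that F by (intro member_le_sum) auto
      then show ?thesis using N[OF that f] total_seminorm_mono[OF f] order_trans by blast
    qed
    then have "(\<Sum>p\<in>F. p f) \<le> (\<Sum>p\<in>F. total_seminorm n f)" by (intro sum_mono)
    then have "(\<Sum>p\<in>F. p f) \<le> real (card F) * total_seminorm n f" by simp
    then show ?thesis
      using bound[OF that] mult_left_mono[of _ _ C] F(3) by (fastforce simp: mult.assoc)
  qed
  moreover have "topspace (subtopology schwartz_topology W) = W"
    using W(1) by (auto simp: topspace_schwartz_topology)
  ultimately show ?thesis
    using T F(3) unfolding seminorm_bounded_def dual_def
    by (intro exI[of _ n] exI[of _ "C * real (card F)"]) simp
qed

lemma dual_schwartz_imp_bounded:
  "T \<in> dual schwartz_topology \<Longrightarrow> \<exists>n C. seminorm_bounded schwartz n C T"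
  using dual_imp_seminorm_bounded[of T schwartz] schwartz_zero schwartz_cmult
  by (simp add: subtopology_topspace[of schwartz_topology, unfolded topspace_schwartz_topology])

lemma seminorm_boundedD:
  assumes "seminorm_bounded V n C T"
  shows "a \<in> V \<Longrightarrow> b \<in> V \<Longrightarrow> T (\<lambda>x. a x + b x) = T a + T b"
    and "a \<in> V \<Longrightarrow> T (\<lambda>x. c * a x) = c * T a"
    and "C \<ge> 0"
    and "a \<in> V \<Longrightarrow> norm (T a) \<le> C * total_seminorm n a"
  using assms unfolding seminorm_bounded_def by simp_all

lemma seminorm_bounded_diff:
  assumes "seminorm_bounded V n C T" "a \<in> V" "b \<in> V" "(\<lambda>x. - 1 * b x) \<in> V"
  shows "T (\<lambda>x. a x - b x) = T a - T b"
  using seminorm_boundedD(1)[OF assms(1,2,4)] seminorm_boundedD(2)[OF assms(1,3), of "-1"] by simp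

section \<open>Integrability and moments\<close>

lemma schwartz_continuous: "f \<in> schwartz \<Longrightarrow> continuous_on UNIV f"
  using smooth_vderiv_works[OF schwartz_smooth, of f 0]
  by (auto simp: continuous_on_eq_continuous_within intro: has_vector_derivative_continuous)

lemma schwartz_borel: "f \<in> schwartz \<Longrightarrow> f \<in> borel_measurable borel"
  by (rule borel_measurable_continuous_onI[OF schwartz_continuous])

lemma integrable_inverse_square: "integrable lborel (\<lambda>x::real. 1 / (1 + x\<^sup>2))"
proof -
  have "set_integrable lborel (einterval (-\<infinity>) \<infinity>) (\<lambda>x. 1 / (1 + x\<^sup>2))"
  proof (rule interval_integral_FTC_nonneg[where F = arctan and A = "- pi / 2" and B = "pi / 2"])
    show "DERIV arctan x :> 1 / (1 + x\<^sup>2)" for x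
      using DERIV_arctan[of x] by (simp add: inverse_eq_divide)
    show "isCont (\<lambda>x. 1 / (1 + x\<^sup>2)) x" for x :: real
      using add_pos_nonneg[of 1 "x\<^sup>2"] by (intro continuous_intros) auto
    show "((arctan \<circ> real_of_ereal) \<longlongrightarrow> - pi / 2) (at_right (-\<infinity>))"
      using tendsto_arctan_at_bot by (simp add: ereal_tendsto_simps)
    show "((arctan \<circ> real_of_ereal) \<longlongrightarrow> pi / 2) (at_left \<infinity>)"
      using tendsto_arctan_at_top by (simp add: ereal_tendsto_simps)
  qed (auto simp: add_nonneg_nonneg)
  then show ?thesis
    by (simp add: set_integrable_def einterval_def)
qed

text \<open>Two additional powers of \<open>x\<close> pay for the integrable weight
  \<open>1 / (1 + x\<^sup>2)\<close>. The explicit bound makes the moments continuous, which is what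
  closes the Lizorkin space under limits.\<close>

lemma schwartz_moment:
  assumes "f \<in> schwartz"
  shows "integrable lborel (\<lambda>x. x ^ k *\<^sub>R f x)"
    and "norm (LBINT x. x ^ k *\<^sub>R f x) \<le>
      (schwartz_seminorm k 0 f + schwartz_seminorm (k + 2) 0 f) * (LBINT x. 1 / (1 + x\<^sup>2))"
proof -
  let ?B = "schwartz_seminorm k 0 f + schwartz_seminorm (k + 2) 0 f"
  have b: "norm (x ^ k *\<^sub>R f x) \<le> ?B * (1 / (1 + x\<^sup>2))" for x
  proof -
    have "(1 + x\<^sup>2) * norm (x ^ k *\<^sub>R f x) = norm (x ^ k *\<^sub>R f x) + norm (x ^ (k + 2) *\<^sub>R f x)"
      by (simp add: algebra_simps power2_eq_square abs_mult)
    also have "\<dots> \<le> ?B"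
      using schwartz_seminorm_upper[OF assms, of x k 0] schwartz_seminorm_upper[OF assms, of x "k + 2" 0]
      by (intro add_mono) simp_all
    finally show ?thesis
      using add_pos_nonneg[of 1 "x\<^sup>2"] by (simp add: field_simps)
  qed
  have int: "integrable lborel (\<lambda>x. ?B * (1 / (1 + x\<^sup>2)))"
    by (rule integrable_mult_right[OF integrable_inverse_square])
  have meas: "(\<lambda>x. x ^ k *\<^sub>R f x) \<in> borel_measurable lborel"
    using schwartz_borel[OF assms] by simp
  show "integrable lborel (\<lambda>x. x ^ k *\<^sub>R f x)"
    by (rule Bochner_Integration.integrable_bound[OF int meas], rule AE_I2, rule order_trans[OF b])
      (simp only: real_norm_def abs_ge_self)
  have "norm (LBINT x. x ^ k *\<^sub>R f x) \<le> (LBINT x. ?B * (1 / (1 + x\<^sup>2)))"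
    by (rule Bochner_Integration.integral_norm_bound_integral[OF _ int b]) fact
  then show "norm (LBINT x. x ^ k *\<^sub>R f x) \<le> ?B * (LBINT x. 1 / (1 + x\<^sup>2))"
    by (simp only: integral_mult_right_zero)
qed

section \<open>Closure properties of the Lizorkin space\<close>

lemma lizorkin_schwartz: "f \<in> lizorkin \<Longrightarrow> f \<in> schwartz"
  by (simp add: lizorkin_def)

lemma lizorkin_add:
  assumes "f \<in> lizorkin" "g \<in> lizorkin"
  shows "(\<lambda>x. f x + g x) \<in> lizorkin"
  using assms schwartz_add(1)[of f g] schwartz_moment(1)[of f] schwartz_moment(1)[of g]
  unfolding lizorkin_def by (auto simp: scaleR_add_right)

lemma lizorkin_cmult:
  assumes "f \<in> lizorkin"
  shows "(\<lambda>x. c * f x) \<in> lizorkin"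
proof -
  have "(LBINT x. x ^ k *\<^sub>R (c * f x)) = c * (LBINT x. x ^ k *\<^sub>R f x)" for k
    by (subst integral_mult_right_zero[symmetric]) (simp add: mult_scaleR_right)
  then show ?thesis
    using assms schwartz_cmult[of f c] unfolding lizorkin_def by auto
qed

lemma lizorkin_diff:
  "f \<in> lizorkin \<Longrightarrow> g \<in> lizorkin \<Longrightarrow> (\<lambda>x. f x - g x) \<in> lizorkin"
  using lizorkin_add[of f "\<lambda>x. -1 * g x"] lizorkin_cmult[of g "-1"] by simp

lemma lizorkin_zero: "(\<lambda>x. 0) \<in> lizorkin"
  using schwartz_zero unfolding lizorkin_def by simp

lemma lizorkin_cnj:
  assumes "f \<in> lizorkin"
  shows "(\<lambda>x. cnj (f x)) \<in> lizorkin"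
proof -
  have "(LBINT x. x ^ k *\<^sub>R cnj (f x)) = cnj (LBINT x. x ^ k *\<^sub>R f x)" for k
    using Bochner_Integration.integral_cnj[of lborel "\<lambda>x. x ^ k *\<^sub>R f x"] by simp
  then show ?thesis
    using assms schwartz_cnj[of f] unfolding lizorkin_def by auto
qed

lemma lizorkin_affine:
  assumes "f \<in> lizorkin" "a \<noteq> 0"
  shows "(\<lambda>x. f (a * (x - b))) \<in> lizorkin"
proof -
  have sch: "f \<in> schwartz" by (rule lizorkin_schwartz[OF assms(1)])
  \<comment> \<open>After substitution the moment of order \<open>k\<close> carries the factor
    \<open>(y / a + b) ^ k\<close>. The extra monomial \<open>y ^ l\<close> makes the induction
    work: splitting off one factor \<open>y / a + b\<close> either raises \<open>l\<close> by one or
    leaves it unchanged.\<close>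
  have int: "integrable lborel (\<lambda>y. (y ^ l * (y / a + b) ^ k) *\<^sub>R f y) \<and>
      (LBINT y. (y ^ l * (y / a + b) ^ k) *\<^sub>R f y) = 0" for k l
  proof (induction k arbitrary: l)
    case 0
    then show ?case
      using schwartz_moment(1)[OF sch] assms(1) by (simp add: lizorkin_def)
  next
    case (Suc k)
    have eq: "(y ^ l * (y / a + b) ^ Suc k) *\<^sub>R f y =
      (1 / a) *\<^sub>R ((y ^ Suc l * (y / a + b) ^ k) *\<^sub>R f y) + b *\<^sub>R ((y ^ l * (y / a + b) ^ k) *\<^sub>R f y)" for y
      unfolding scaleR_scaleR scaleR_add_left[symmetric] by (simp add: algebra_simps)
    have int: "integrable lborel (\<lambda>y. (1 / a) *\<^sub>R ((y ^ Suc l * (y / a + b) ^ k) *\<^sub>R f y))"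
      "integrable lborel (\<lambda>y. b *\<^sub>R ((y ^ l * (y / a + b) ^ k) *\<^sub>R f y))"
      by (rule integrable_scaleR_right, rule conjunct1[OF Suc])+
    have z: "(LBINT y. (y ^ Suc l * (y / a + b) ^ k) *\<^sub>R f y) = 0"
      "(LBINT y. (y ^ l * (y / a + b) ^ k) *\<^sub>R f y) = 0"
      using Suc[of "Suc l"] Suc[of l] by blast+
    show ?case
      unfolding eq Bochner_Integration.integral_add[OF int] integral_scaleR_right z
      using Bochner_Integration.integrable_add[OF int] by (simp only: scaleR_zero_right add_0 simp_thms)
  qed
  have "(LBINT x. x ^ k *\<^sub>R f (a * (x - b))) = 0" for k
  proof -
    have "(LBINT y. (y ^ 0 * (y / a + b) ^ k) *\<^sub>R f y)
        = \<bar>a\<bar> *\<^sub>R (LBINT x. (((- a * b) + a * x) / a + b) ^ k *\<^sub>R f ((- a * b) + a * x))"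
      by (subst lborel_integral_real_affine[of a _ "- a * b"]) (use assms in auto)
    also have "\<dots> = \<bar>a\<bar> *\<^sub>R (LBINT x. x ^ k *\<^sub>R f (a * (x - b)))"
    proof -
      have "((- a * b) + a * x) / a + b = x" "(- a * b) + a * x = a * (x - b)" for x
        using assms by (simp_all add: field_simps)
      then show ?thesis by simp
    qed
    finally show ?thesis using int[of 0 k] assms by simp
  qed
  then show ?thesis
    using schwartz_affine[OF sch assms(2)] unfolding lizorkin_def by auto
qed

lemma lizorkin_dilate: "f \<in> lizorkin \<Longrightarrow> a \<noteq> 0 \<Longrightarrow> (\<lambda>x. f (x / a)) \<in> lizorkin"
  using lizorkin_affine[of f "1 / a" 0] by simp

text \<open>Multiplication by a polynomial only combines higher moments, all of which vanish. For
  the phases it is applied to, membership in the Schwartz space comes from the calculus of rapidly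
  decreasing families, hence it is a hypothesis here.\<close>

lemma lizorkin_mult_poly:
  assumes "f \<in> lizorkin" "(\<lambda>x. of_real (a * x\<^sup>2 + b * x) * f x) \<in> schwartz"
  shows "(\<lambda>x. of_real (a * x\<^sup>2 + b * x) * f x) \<in> lizorkin"
proof -
  have eq: "x ^ k *\<^sub>R (of_real (a * x\<^sup>2 + b * x) * f x) =
    a *\<^sub>R (x ^ (k + 2) *\<^sub>R f x) + b *\<^sub>R (x ^ (k + 1) *\<^sub>R f x)" for k x
    unfolding scaleR_conv_of_real by (simp add: algebra_simps power2_eq_square)
  note int = schwartz_moment(1)[OF lizorkin_schwartz[OF assms(1)]]
  have "(LBINT x. x ^ k *\<^sub>R (of_real (a * x\<^sup>2 + b * x) * f x)) = 0" for k
  proof -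
    have "(LBINT x. x ^ k *\<^sub>R (of_real (a * x\<^sup>2 + b * x) * f x)) =
      a *\<^sub>R (LBINT x. x ^ (k + 2) *\<^sub>R f x) + b *\<^sub>R (LBINT x. x ^ (k + 1) *\<^sub>R f x)"
      unfolding eq integral_scaleR_right[symmetric]
      by (rule Bochner_Integration.integral_add; rule integrable_scaleR_right; rule int)
    moreover have "(LBINT x. x ^ n *\<^sub>R f x) = 0" for n
      using assms(1) unfolding lizorkin_def by blast
    ultimately show ?thesis by (simp only: scaleR_zero_right add_0)
  qed
  then show ?thesis using assms(2) unfolding lizorkin_def by blast
qed

section \<open>Completeness and uniform boundedness\<close>

text \<open>All derivatives converge pointwise, and uniformly with every polynomial weight. The
  uniformity identifies the limits of the derivatives as the derivatives of the limit.\<close>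

lemma schwartz_complete:
  fixes F :: "nat \<Rightarrow> real \<Rightarrow> complex"
  assumes sch: "\<And>n. F n \<in> schwartz"
    and cauchy: "\<And>j k e. e > 0 \<Longrightarrow> \<exists>N. \<forall>m\<ge>N. \<forall>n\<ge>N. schwartz_seminorm j k (\<lambda>x. F m x - F n x) \<le> e"
  obtains f where "f \<in> schwartz"
    "\<And>j k e. e > 0 \<Longrightarrow> \<exists>N. \<forall>n\<ge>N. schwartz_seminorm j k (\<lambda>x. F n x - f x) \<le> e"
proof -
  define D where "D k n = (vderiv ^^ k) (F n)" for k n
  have up: "norm (x ^ j *\<^sub>R (D k m x - D k n x)) \<le> schwartz_seminorm j k (\<lambda>x. F m x - F n x)" for j k m n x
    using schwartz_seminorm_upper[OF schwartz_diff(1)[OF sch sch]]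
    unfolding vderiv_funpow_diff[OF sch sch] D_def .
  have cauchyD: "\<exists>N. \<forall>m\<ge>N. \<forall>n\<ge>N. \<forall>x. norm (x ^ j *\<^sub>R (D k m x - D k n x)) \<le> e" if "e > 0" for j k e
  proof -
    obtain N where "\<forall>m\<ge>N. \<forall>n\<ge>N. schwartz_seminorm j k (\<lambda>x. F m x - F n x) \<le> e"
      using cauchy[OF \<open>e > 0\<close>] by blast
    then show ?thesis
      by (intro exI[of _ N] allI impI order_trans[OF up]) simp
  qed
  have "Cauchy (\<lambda>n. D k n x)" for k x
  proof (rule CauchyI)
    fix e :: real assume "e > 0"
    then obtain N where "\<forall>m\<ge>N. \<forall>n\<ge>N. \<forall>x. norm (x ^ 0 *\<^sub>R (D k m x - D k n x)) \<le> e / 2"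
      using cauchyD[of "e / 2" 0 k] by auto
    then have "\<forall>m\<ge>N. \<forall>n\<ge>N. norm (D k m x - D k n x) \<le> e / 2" by simp
    moreover have "e / 2 < e" using \<open>e > 0\<close> by simp
    ultimately show "\<exists>M. \<forall>m\<ge>M. \<forall>n\<ge>M. norm (D k m x - D k n x) < e"
      using le_less_trans by blast
  qed
  then have "\<exists>l. (\<lambda>n. D k n x) \<longlonglongrightarrow> l" for k x
    using Cauchy_convergent_iff convergent_def by blast
  then obtain d where d: "\<And>k x. (\<lambda>n. D k n x) \<longlonglongrightarrow> d k x" by metis
  \<comment> \<open>Letting the second index tend to infinity in the Cauchy estimate yields
    convergence uniform in \<open>x\<close>.\<close>
  have lim: "\<exists>N. \<forall>n\<ge>N. \<forall>x. norm (x ^ j *\<^sub>R (D k n x - d k x)) \<le> e" if "e > 0" for j k e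
  proof -
    obtain N where N: "\<And>m n x. m \<ge> N \<Longrightarrow> n \<ge> N \<Longrightarrow> norm (x ^ j *\<^sub>R (D k m x - D k n x)) \<le> e"
      using cauchyD[OF \<open>e > 0\<close>] by metis
    have "norm (x ^ j *\<^sub>R (D k m x - d k x)) \<le> e" if "m \<ge> N" for m x
    proof (rule LIMSEQ_le_const2)
      show "(\<lambda>n. norm (x ^ j *\<^sub>R (D k m x - D k n x))) \<longlonglongrightarrow> norm (x ^ j *\<^sub>R (D k m x - d k x))"
        by (intro tendsto_intros d)
      show "\<exists>M. \<forall>n\<ge>M. norm (x ^ j *\<^sub>R (D k m x - D k n x)) \<le> e"
        using N that by blast
    qed
    then show ?thesis by blast
  qed
  have deriv: "(d k has_vector_derivative d (Suc k) t) (at t)" for k t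
  proof -
    \<comment> \<open>Uniformly convergent derivatives and convergence at the single point 0 give a
      differentiable limit \<open>g\<close>; uniqueness of pointwise limits then identifies it with
      \<open>d k\<close>.\<close>
    have "\<exists>g. \<forall>x\<in>UNIV. (\<lambda>n. D k n x) \<longlonglongrightarrow> g x \<and> (g has_derivative (\<lambda>h. h *\<^sub>R d (Suc k) x)) (at x within UNIV)"
    proof (rule has_derivative_sequence[where f' = "\<lambda>n x h. h *\<^sub>R D (Suc k) n x"])
      show "(D k n has_derivative (\<lambda>h. h *\<^sub>R D (Suc k) n x)) (at x within UNIV)" for n x
        using smooth_vderiv_works[OF schwartz_smooth[OF sch]]
        unfolding D_def has_vector_derivative_def .
      show "\<forall>\<^sub>F n in sequentially. \<forall>x\<in>UNIV. \<forall>h. norm (h *\<^sub>R D (Suc k) n x - h *\<^sub>R d (Suc k) x) \<le> e * norm h"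
        if "e > 0" for e
      proof -
        obtain N where N: "\<And>n x. n \<ge> N \<Longrightarrow> norm (x ^ 0 *\<^sub>R (D (Suc k) n x - d (Suc k) x)) \<le> e"
          using lim[OF \<open>e > 0\<close>] by metis
        show ?thesis
          unfolding eventually_sequentially
        proof (intro exI[of _ N] allI impI ballI)
          fix n x and h :: real assume "n \<ge> N"
          show "norm (h *\<^sub>R D (Suc k) n x - h *\<^sub>R d (Suc k) x) \<le> e * norm h"
            using N[OF \<open>n \<ge> N\<close>, of x] mult_left_mono[of "norm (D (Suc k) n x - d (Suc k) x)" e "\<bar>h\<bar>"]
            by (simp add: scaleR_diff_right[symmetric] mult.commute)
        qed
      qed
      show "(\<lambda>n. D k n 0) \<longlonglongrightarrow> d k 0" by (rule d)
    qed auto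
    then obtain g where g: "\<And>x. (\<lambda>n. D k n x) \<longlonglongrightarrow> g x"
      "\<And>x. (g has_derivative (\<lambda>h. h *\<^sub>R d (Suc k) x)) (at x)" by auto
    have "g = d k" using LIMSEQ_unique[OF g(1) d] by auto
    then show ?thesis using g(2) unfolding has_vector_derivative_def by simp
  qed
  have sm: "smooth (d 0)" "\<And>k. (vderiv ^^ k) (d 0) = d k"
    using smooth_eqI[of d "d 0", OF refl deriv] by auto
  have "d 0 \<in> schwartz"
    unfolding schwartz_iff
  proof (intro conjI allI)
    fix j k
    obtain N where N: "\<And>n x. n \<ge> N \<Longrightarrow> norm (x ^ j *\<^sub>R (D k n x - d k x)) \<le> 1"
      using lim[of 1 j k] by auto
    have "norm (x ^ j *\<^sub>R d k x) \<le> schwartz_seminorm j k (F N) + 1" for x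
    proof -
      have "norm (x ^ j *\<^sub>R d k x) \<le> norm (x ^ j *\<^sub>R D k N x) + norm (x ^ j *\<^sub>R (D k N x - d k x))"
        using norm_triangle_ineq4[of "x ^ j *\<^sub>R D k N x" "x ^ j *\<^sub>R (D k N x - d k x)"]
        by (simp add: scaleR_diff_right)
      then show ?thesis
        using N[of N x] schwartz_seminorm_upper[OF sch, of x j k N] unfolding D_def by simp
    qed
    then show "\<exists>B. \<forall>t. norm (t ^ j *\<^sub>R (vderiv ^^ k) (d 0) t) \<le> B"
      unfolding sm by blast
  qed (rule sm)
  moreover have "\<exists>N. \<forall>n\<ge>N. schwartz_seminorm j k (\<lambda>x. F n x - d 0 x) \<le> e" if "e > 0" for j k e
  proof -
    obtain N where N: "\<And>n x. n \<ge> N \<Longrightarrow> norm (x ^ j *\<^sub>R (D k n x - d k x)) \<le> e"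
      using lim[OF \<open>e > 0\<close>] by metis
    have "schwartz_seminorm j k (\<lambda>x. F n x - d 0 x) \<le> e" if "n \<ge> N" for n
      by (rule schwartz_seminorm_least)
        (use N[OF that] in \<open>simp add: vderiv_funpow_diff[OF sch \<open>d 0 \<in> schwartz\<close>] sm D_def\<close>)
    then show ?thesis by blast
  qed
  ultimately show ?thesis by (rule that)
qed

text \<open>Since the moments of \<open>F N\<close> vanish, a moment of the limit \<open>f\<close>
  is minus that of \<open>F N - f\<close>, which is bounded by two seminorms tending to
  zero.\<close>

lemma lizorkin_complete:
  fixes F :: "nat \<Rightarrow> real \<Rightarrow> complex"
  assumes liz: "\<And>n. F n \<in> lizorkin"
    and cauchy: "\<And>j k e. e > 0 \<Longrightarrow> \<exists>N. \<forall>m\<ge>N. \<forall>n\<ge>N. schwartz_seminorm j k (\<lambda>x. F m x - F n x) \<le> e"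
  obtains f where "f \<in> lizorkin"
    "\<And>j k e. e > 0 \<Longrightarrow> \<exists>N. \<forall>n\<ge>N. schwartz_seminorm j k (\<lambda>x. F n x - f x) \<le> e"
proof -
  obtain f where f: "f \<in> schwartz"
    and lim: "\<And>j k e. e > 0 \<Longrightarrow> \<exists>N. \<forall>n\<ge>N. schwartz_seminorm j k (\<lambda>x. F n x - f x) \<le> e"
    using schwartz_complete[OF lizorkin_schwartz[OF liz] cauchy] by metis
  have "(LBINT x. x ^ k *\<^sub>R f x) = 0" for k
  proof -
    define I where "I = (LBINT x::real. 1 / (1 + x\<^sup>2))"
    have "I \<ge> 0" unfolding I_def by (rule integral_nonneg_AE) (auto simp: add_nonneg_nonneg)
    have "norm (LBINT x. x ^ k *\<^sub>R f x) \<le> 0 + e" if "e > 0" for e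
    proof -
      define r where "r = e / (2 * (I + 1))"
      have "r > 0" using \<open>I \<ge> 0\<close> that by (simp add: r_def)
      obtain N where N: "schwartz_seminorm k 0 (\<lambda>x. F N x - f x) \<le> r"
        "schwartz_seminorm (k + 2) 0 (\<lambda>x. F N x - f x) \<le> r"
        using lim[OF \<open>r > 0\<close>, of k 0] lim[OF \<open>r > 0\<close>, of "k + 2" 0]
        by (metis linorder_le_cases order_trans)
      have "(LBINT x. x ^ k *\<^sub>R (F N x - f x)) = - (LBINT x. x ^ k *\<^sub>R f x)"
        using liz[of N] schwartz_moment(1)[OF lizorkin_schwartz[OF liz]] schwartz_moment(1)[OF f]
        by (simp add: scaleR_diff_right lizorkin_def)
      then have "norm (LBINT x. x ^ k *\<^sub>R f x) \<le> (schwartz_seminorm k 0 (\<lambda>x. F N x - f x)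
          + schwartz_seminorm (k + 2) 0 (\<lambda>x. F N x - f x)) * I"
        using schwartz_moment(2)[OF schwartz_diff(1)[OF lizorkin_schwartz[OF liz[of N]] f], of k]
        unfolding I_def by simp
      also have "\<dots> \<le> (r + r) * (I + 1)"
        using N \<open>I \<ge> 0\<close> \<open>r > 0\<close> by (intro mult_mono add_mono) auto
      also have "\<dots> = r * (2 * (I + 1))" by (simp add: algebra_simps)
      also have "\<dots> = e" using \<open>I \<ge> 0\<close> by (simp add: r_def)
      finally show ?thesis by simp
    qed
    then have "norm (LBINT x. x ^ k *\<^sub>R f x) \<le> 0" by (rule field_le_epsilon)
    then show ?thesis by simp
  qed
  then have "f \<in> lizorkin" using f by (simp add: lizorkin_def)
  then show ?thesis using lim by (rule that)
qed

text \<open>Telescoping: step \<open>n\<close> is small in the seminorm of order \<open>N n\<close>,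
  which dominates the one of order \<open>N i\<close>. Strictly increasing natural numbers grow by
  at least one per step, so the errors are dominated by a geometric series with sum at most
  \<open>2 * (1 / 2) ^ N i\<close>.\<close>

lemma cauchy_of_geometric:
  fixes F :: "nat \<Rightarrow> real \<Rightarrow> complex"
  assumes sch: "\<And>n. F n \<in> schwartz"
    and N: "strict_mono N"
    and step: "\<And>i. total_seminorm (N i) (\<lambda>x. F (Suc i) x - F i x) \<le> (1 / 2) ^ N i"
  shows "i \<le> m \<Longrightarrow> total_seminorm (N i) (\<lambda>x. F m x - F i x) \<le> 2 * (1 / 2) ^ N i"
proof -
  assume "i \<le> m"
  have "total_seminorm (N i) (\<lambda>x. F m x - F i x) \<le> (\<Sum>l\<in>{i..<m}. (1 / 2) ^ N l)"
    using \<open>i \<le> m\<close>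
  proof (induction m rule: dec_induct)
    case base
    then show ?case
      using total_seminorm_cmult[OF schwartz_zero, of _ 0] by simp
  next
    case (step n)
    have "total_seminorm (N i) (\<lambda>x. (F (Suc n) x - F n x) + (F n x - F i x)) \<le>
      total_seminorm (N i) (\<lambda>x. F (Suc n) x - F n x) + total_seminorm (N i) (\<lambda>x. F n x - F i x)"
      by (rule total_seminorm_triangle; rule schwartz_diff; rule sch)
    also have "total_seminorm (N i) (\<lambda>x. F (Suc n) x - F n x)
      \<le> total_seminorm (N n) (\<lambda>x. F (Suc n) x - F n x)"
      using \<open>i \<le> n\<close> N by (intro total_seminorm_mono schwartz_diff sch) (simp add: strict_mono_less_eq)
    also have "\<dots> \<le> (1 / 2) ^ N n" by fact
    also note step.IH
    finally show ?case using \<open>i \<le> n\<close> by (simp add: add.commute)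
  qed
  also have "\<dots> \<le> (\<Sum>l\<in>{i..<m}. (1 / 2) ^ N i * (1 / 2) ^ (l - i))"
  proof (rule sum_mono)
    fix l assume l: "l \<in> {i..<m}"
    have "N i + (l - i) \<le> N l"
    proof -
      have "N i + d \<le> N (i + d)" for d
      proof (induction d)
        case (Suc d)
        have "N (i + d) < N (i + Suc d)" using N by (simp add: strict_mono_less)
        then show ?case using Suc by linarith
      qed simp
      from this[of "l - i"] show ?thesis using l by simp
    qed
    then have "(1 / 2 :: real) ^ N l \<le> (1 / 2) ^ (N i + (l - i))" by (intro power_decreasing) auto
    then show "(1 / 2 :: real) ^ N l \<le> (1 / 2) ^ N i * (1 / 2) ^ (l - i)" by (simp add: power_add)
  qed
  also have "\<dots> = (1 / 2) ^ N i * (\<Sum>l<m - i. (1 / 2) ^ l)"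
    unfolding sum_distrib_left[symmetric]
    using sum.shift_bounds_nat_ivl[of "\<lambda>l. (1 / 2 :: real) ^ (l - i)" 0 i "m - i"] \<open>i \<le> m\<close>
    by (simp add: atLeast0LessThan)
  also have "\<dots> \<le> (1 / 2) ^ N i * 2"
    by (intro mult_left_mono) (simp_all add: geometric_sum)
  finally show ?thesis by simp
qed

text \<open>Gliding hump: if the conclusion failed, a rapidly converging series of Lizorkin
  functions could be chosen whose partial sums make some of the \<open>T i\<close> arbitrarily large.\<close>

lemma lizorkin_uniform_boundedness:
  fixes T :: "nat \<Rightarrow> (real \<Rightarrow> complex) \<Rightarrow> complex"
  assumes bnd: "\<And>i. \<exists>n C. seminorm_bounded lizorkin n C (T i)"
    and pw: "\<And>g. g \<in> lizorkin \<Longrightarrow> \<exists>B. \<forall>i. norm (T i g) \<le> B"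
  shows "\<exists>n C. \<forall>i. seminorm_bounded lizorkin n C (T i)"
proof (rule ccontr)
  assume neg: "\<nexists>n C. \<forall>i. seminorm_bounded lizorkin n C (T i)"
  have add: "T i (\<lambda>x. a x + b x) = T i a + T i b" if "a \<in> lizorkin" "b \<in> lizorkin" for i a b
    using bnd[of i] seminorm_boundedD(1)[OF _ that] by blast
  have scale: "T i (\<lambda>x. c * a x) = c * T i a" if "a \<in> lizorkin" for i a c
    using bnd[of i] seminorm_boundedD(2)[OF _ that] by blast
  have diff: "T i (\<lambda>x. a x - b x) = T i a - T i b" if "a \<in> lizorkin" "b \<in> lizorkin" for i a b
    using bnd[of i] seminorm_bounded_diff[OF _ that lizorkin_cmult[OF that(2)]] by blast
  \<comment> \<open>Every \<open>T i\<close> is linear, so a failure of uniformity must lie in the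
    estimate itself.\<close>
  have hump: "\<exists>i. \<exists>g\<in>lizorkin. norm (T i g) > C * total_seminorm n g" if "C \<ge> 0" for n C
  proof (rule ccontr)
    assume "\<not> ?thesis"
    then have "\<forall>i. seminorm_bounded lizorkin n C (T i)"
      unfolding seminorm_bounded_def using \<open>C \<ge> 0\<close> add scale by (auto simp: not_less)
    then show False using neg by blast
  qed
  \<comment> \<open>A state is a partial sum with a seminorm order. The new order \<open>N'\<close>
    is so large that whatever is added afterwards, including the passage to the limit, changes the
    witnessing \<open>T i\<close> by at most 1.\<close>
  define Q where "Q = (\<lambda>(j::nat) (F, N) (F', N'). N < N' \<and>
    total_seminorm N (\<lambda>x. F' x - F x) \<le> (1 / 2) ^ N \<and>
    (\<exists>i. norm (T i F') \<ge> real j \<and>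
      (\<forall>g\<in>lizorkin. total_seminorm N' g \<le> 3 * (1 / 2) ^ N' \<longrightarrow> norm (T i g) \<le> 1)))"
  have "\<exists>f. \<forall>j. fst (f j) \<in> lizorkin \<and> Q j (f j) (f (Suc j))"
  proof (rule dependent_nat_choice)
    show "\<exists>p :: (real \<Rightarrow> complex) \<times> nat. fst p \<in> lizorkin"
      by (rule exI[of _ "((\<lambda>x. 0), 0 :: nat)"]) (simp add: lizorkin_zero)
    fix p :: "(real \<Rightarrow> complex) \<times> nat" and j
    assume p: "fst p \<in> lizorkin"
    obtain F N where [simp]: "p = (F, N)" by force
    have F: "F \<in> lizorkin" using p by simp
    obtain B where B: "\<And>i. norm (T i F) \<le> B" using pw[OF F] by blast
    have "B \<ge> 0" using order_trans[OF norm_ge_zero B] .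
    \<comment> \<open>\<open>A\<close> outweighs the bound \<open>B\<close> at the previous sum and
      leaves at least \<open>j\<close>. The factor \<open>2 ^ N\<close> in the next line makes the
      hump, normalised so that \<open>T i\<close> has norm \<open>A\<close> on it, at most
      \<open>(1 / 2) ^ N\<close> in the seminorm of order \<open>N\<close>.\<close>
    define A where "A = real j + B + 1"
    have "A > 0" using \<open>B \<ge> 0\<close> by (simp add: A_def)
    obtain i h where h: "h \<in> lizorkin" "norm (T i h) > (2 ^ N * A) * total_seminorm N h"
      using hump[of "2 ^ N * A" N] \<open>A > 0\<close> by auto
    define t where "t = norm (T i h)"
    have nn: "total_seminorm N h \<ge> 0" using h by (intro total_seminorm_nonneg lizorkin_schwartz)
    then have "(2 ^ N * A) * total_seminorm N h \<ge> 0" using \<open>A > 0\<close> by simp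
    then have "t > 0" using h(2) unfolding t_def by linarith
    define w where "w = (\<lambda>x. of_real (A / t) * h x)"
    have w: "w \<in> lizorkin" unfolding w_def by (rule lizorkin_cmult[OF h(1)])
    have "norm (T i w) = A"
      unfolding w_def scale[OF h(1)] norm_mult norm_of_real using \<open>t > 0\<close> \<open>A > 0\<close>
      by (simp add: t_def)
    have "total_seminorm N w = A / t * total_seminorm N h"
      unfolding w_def total_seminorm_cmult[OF lizorkin_schwartz[OF h(1)]] norm_of_real
      using \<open>t > 0\<close> \<open>A > 0\<close> by simp
    also have "\<dots> \<le> (1 / 2) ^ N"
      using h(2) \<open>t > 0\<close> unfolding t_def[symmetric] by (simp add: field_simps power_one_over)
    finally have pw: "total_seminorm N w \<le> (1 / 2) ^ N" .
    define F' where "F' = (\<lambda>x. F x + w x)"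
    have F': "F' \<in> lizorkin" unfolding F'_def by (rule lizorkin_add[OF F w])
    have "norm (T i F') \<ge> norm (T i w) - norm (T i F)"
      unfolding F'_def add[OF F w] by (metis add.commute norm_diff_ineq)
    then have big: "norm (T i F') \<ge> real j"
      using B[of i] \<open>norm (T i w) = A\<close> by (simp add: A_def)
    obtain n C where nC: "seminorm_bounded lizorkin n C (T i)" using bnd by blast
    have "C \<ge> 0" by (rule seminorm_boundedD(3)[OF nC])
    obtain k where k: "(1 / 2 :: real) ^ k < 1 / (3 * (C + 1))"
      using real_arch_pow_inv[of "1 / (3 * (C + 1))" "1 / 2"] \<open>C \<ge> 0\<close> by auto
    \<comment> \<open>\<open>n\<close> brings the continuity bound of \<open>T i\<close> into force,
      \<open>k\<close> makes its constant harmless, and \<open>N + 1\<close> keeps the orders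
      strictly increasing.\<close>
    define N' where "N' = k + n + N + 1"
    have "norm (T i g) \<le> 1" if "g \<in> lizorkin" "total_seminorm N' g \<le> 3 * (1 / 2) ^ N'" for g
    proof -
      have "norm (T i g) \<le> C * total_seminorm n g"
        by (rule seminorm_boundedD(4)[OF nC that(1)])
      also have "\<dots> \<le> C * total_seminorm N' g"
        using that(1) \<open>C \<ge> 0\<close> by (intro mult_left_mono total_seminorm_mono lizorkin_schwartz) (auto simp: N'_def)
      also have "\<dots> \<le> C * (3 * (1 / 2) ^ N')"
        using that(2) \<open>C \<ge> 0\<close> by (intro mult_left_mono) auto
      also have "\<dots> \<le> C * (3 * (1 / 2) ^ k)"
        using \<open>C \<ge> 0\<close> by (intro mult_left_mono power_decreasing) (auto simp: N'_def)
      also have "\<dots> \<le> C * (3 * (1 / (3 * (C + 1))))"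
        using \<open>C \<ge> 0\<close> k by (intro mult_left_mono) auto
      also have "\<dots> \<le> 1" using \<open>C \<ge> 0\<close> by (simp add: field_simps)
      finally show ?thesis .
    qed
    then have "Q j p (F', N')"
      unfolding Q_def using pw big by (auto simp: F'_def N'_def)
    then show "\<exists>q. fst q \<in> lizorkin \<and> Q j p q" using F' by (metis fst_conv)
  qed
  then obtain f where f: "\<And>j. fst (f j) \<in> lizorkin" "\<And>j. Q j (f j) (f (Suc j))" by blast
  define F where "F j = fst (f j)" for j
  define N where "N j = snd (f j)" for j
  have Q: "N j < N (Suc j)" "total_seminorm (N j) (\<lambda>x. F (Suc j) x - F j x) \<le> (1 / 2) ^ N j"
    "\<exists>i. norm (T i (F (Suc j))) \<ge> real j \<and>
      (\<forall>g\<in>lizorkin. total_seminorm (N (Suc j)) g \<le> 3 * (1 / 2) ^ N (Suc j) \<longrightarrow> norm (T i g) \<le> 1)" for j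
    using f(2)[of j] unfolding Q_def F_def N_def by (auto simp: case_prod_beta)
  have liz: "F j \<in> lizorkin" for j unfolding F_def by (rule f)
  note sch = lizorkin_schwartz[OF liz]
  have mono: "strict_mono N" using Q(1) by (simp add: strict_mono_Suc_iff)
  have geo: "total_seminorm (N i) (\<lambda>x. F m x - F i x) \<le> 2 * (1 / 2) ^ N i" if "i \<le> m" for i m
    by (rule cauchy_of_geometric[OF sch mono Q(2) that])
  have "\<exists>M. \<forall>m\<ge>M. \<forall>n\<ge>M. schwartz_seminorm j k (\<lambda>x. F m x - F n x) \<le> e" if e: "e > 0" for j k e
  proof -
    obtain l where l: "(1 / 2 :: real) ^ l < e / 4"
      using real_arch_pow_inv[of "e / 4" "1 / 2"] e by auto
    define M where "M = l + j + k"
    have "N M \<ge> M" using mono by (rule strict_mono_imp_increasing)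
    then have "(1 / 2 :: real) ^ N M \<le> (1 / 2) ^ l" by (intro power_decreasing) (auto simp: M_def)
    then have small: "4 * (1 / 2 :: real) ^ N M \<le> e" using l by linarith
    have "schwartz_seminorm j k (\<lambda>x. F m x - F n x) \<le> e" if "m \<ge> M" "n \<ge> M" for m n
    proof -
      have "schwartz_seminorm j k (\<lambda>x. F m x - F n x) \<le> total_seminorm (N M) (\<lambda>x. F m x - F n x)"
        using \<open>N M \<ge> M\<close> by (intro schwartz_seminorm_le_total schwartz_diff sch) (auto simp: M_def)
      also have "\<dots> \<le> total_seminorm (N M) (\<lambda>x. F m x - F M x)
          + total_seminorm (N M) (\<lambda>x. F n x - F M x)"
        by (rule total_seminorm_diff[OF sch sch sch])
      finally show ?thesis using geo[OF that(1)] geo[OF that(2)] small by linarith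
    qed
    then show ?thesis by blast
  qed
  then obtain g where g: "g \<in> lizorkin"
    and lim: "\<And>j k e. e > 0 \<Longrightarrow> \<exists>M. \<forall>n\<ge>M. schwartz_seminorm j k (\<lambda>x. F n x - g x) \<le> e"
    using lizorkin_complete[where F = F, OF liz] by metis
  note schg = lizorkin_schwartz[OF g]
  have "(\<lambda>n. schwartz_seminorm j k (\<lambda>x. F n x - g x)) \<longlonglongrightarrow> 0" for j k
  proof (rule LIMSEQ_I)
    fix r :: real assume "r > 0"
    obtain M where M: "\<And>n. n \<ge> M \<Longrightarrow> schwartz_seminorm j k (\<lambda>x. F n x - g x) \<le> r / 2"
      using lim[of "r / 2"] \<open>r > 0\<close> by (metis half_gt_zero)
    show "\<exists>M. \<forall>n\<ge>M. norm (schwartz_seminorm j k (\<lambda>x. F n x - g x) - 0) < r"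
      using M \<open>r > 0\<close> schwartz_seminorm_nonneg[OF schwartz_diff(1)[OF sch schg]]
      by (intro exI[of _ M]) (force simp: abs_of_nonneg)
  qed
  then have total: "(\<lambda>n. total_seminorm l (\<lambda>x. F n x - g x)) \<longlonglongrightarrow> 0" for l
    unfolding total_seminorm_def by (intro tendsto_null_sum)
  obtain B where B: "\<And>i. norm (T i g) \<le> B" using pw[OF g] by blast
  \<comment> \<open>The tail after stage \<open>j\<close> changes \<open>T i\<close> by at most 1,
    so the value at \<open>F (Suc j)\<close> would be at most \<open>B + 1\<close>, while by
    construction it is at least \<open>j\<close>.\<close>
  define j where "j = nat \<lceil>B + 2\<rceil>"
  have "real j \<ge> B + 2" unfolding j_def by linarith
  obtain i where i: "norm (T i (F (Suc j))) \<ge> real j"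
    "\<And>g. g \<in> lizorkin \<Longrightarrow> total_seminorm (N (Suc j)) g \<le> 3 * (1 / 2) ^ N (Suc j) \<Longrightarrow> norm (T i g) \<le> 1"
    using Q(3) by blast
  have "\<exists>M. \<forall>n\<ge>M. total_seminorm (N (Suc j)) (\<lambda>x. F n x - g x) < (1 / 2) ^ N (Suc j)"
    using order_tendstoD(2)[OF total, of "(1 / 2) ^ N (Suc j)"] by (simp add: eventually_sequentially)
  then obtain M where M: "\<And>n. n \<ge> M \<Longrightarrow> total_seminorm (N (Suc j)) (\<lambda>x. F n x - g x) < (1 / 2) ^ N (Suc j)"
    by blast
  \<comment> \<open>Going through the late sum \<open>F n\<close> explains the constant 3: two units
    come from the geometric tail and one from the distance of \<open>F n\<close> to its
    limit.\<close>
  define n where "n = max M (Suc j)"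
  have "total_seminorm (N (Suc j)) (\<lambda>x. F (Suc j) x - g x) \<le> 3 * (1 / 2) ^ N (Suc j)"
    using total_seminorm_diff[OF sch[of "Suc j"] schg sch[of n], of "N (Suc j)"]
      total_seminorm_swap[OF sch[of "Suc j"] sch[of n]] total_seminorm_swap[OF schg sch[of n]]
      geo[of "Suc j" n] M[of n] by (simp add: n_def)
  then have "norm (T i (\<lambda>x. F (Suc j) x - g x)) \<le> 1"
    by (intro i lizorkin_diff g liz)
  then have "norm (T i (F (Suc j))) \<le> norm (T i g) + 1"
    unfolding diff[OF liz g] by norm
  then show False using i(1) B[of i] \<open>real j \<ge> B + 2\<close> by linarith
qed

section \<open>Slowly varying functions\<close>

text \<open>An argument of Egorov type: pointwise convergence makes the increasing sets
  \<open>E n\<close> exhaust an interval of length 3, and continuity of measure pushes them above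
  \<open>11 / 4\<close>. The bound \<open>A / 4\<close> keeps all arguments \<open>e k * t\<close>
  in the interval on which \<open>L\<close> is measurable and positive.\<close>

lemma slowly_varying_level_sets:
  fixes L :: "real \<Rightarrow> real" and e :: "nat \<Rightarrow> real"
  assumes meas: "L \<in> borel_measurable (lebesgue_on {0<..A})"
    and pos: "\<And>x. x \<in> {0<..A} \<Longrightarrow> L x > 0"
    and lim: "\<And>a. a > 0 \<Longrightarrow> ((\<lambda>\<epsilon>. L (a * \<epsilon>) / L \<epsilon>) \<longlongrightarrow> 1) (at_right 0)"
    and e: "\<And>k. 0 < e k" "\<And>k. e k \<le> A / 4" "e \<longlonglongrightarrow> 0"
  defines "E \<equiv> \<lambda>n. {t \<in> {1..4}. \<forall>k\<ge>n. \<bar>ln (L (e k * t)) - ln (L (e k))\<bar> \<le> 1 / 2}"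
  shows "\<And>n. E n \<in> lmeasurable" "\<exists>N. \<forall>n\<ge>N. measure lebesgue (E n) > 11 / 4"
proof -
  define M where "M k = {t \<in> {1..4}. \<bar>ln (L (e k * t)) - ln (L (e k))\<bar> \<le> 1 / 2}" for k
  have M: "M k \<in> sets lebesgue" for k
  proof -
    have "(\<lambda>x. \<bar>ln (L x) - ln (L (e k))\<bar>) \<in> borel_measurable (lebesgue_on {0<..A})"
      by (intro borel_measurable_abs borel_measurable_diff borel_measurable_ln borel_measurable_const meas)
    then have "{x \<in> space (lebesgue_on {0<..A}). \<bar>ln (L x) - ln (L (e k))\<bar> \<le> 1 / 2} \<in> sets (lebesgue_on {0<..A})"
      by (rule borel_measurable_le) (rule borel_measurable_const)
    then have S: "{x \<in> {0<..A}. \<bar>ln (L x) - ln (L (e k))\<bar> \<le> 1 / 2} \<in> sets lebesgue" (is "?S \<in> _")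
      unfolding space_lebesgue_on
      by (subst (asm) sets_restrict_space_iff) (simp, blast)
    have "M k = {1..4} \<inter> ((*\<^sub>R) (e k) -` ?S \<inter> space lebesgue)"
    proof -
      have "e k * t \<in> {0<..A}" if "t \<in> {1..4}" for t
        using that e(1)[of k] mult_mono[of "e k" "A / 4" t 4] e(2)[of k] by auto
      then show ?thesis unfolding M_def by auto
    qed
    also have "\<dots> \<in> sets lebesgue"
      by (rule sets.Int[OF _ measurable_sets[OF lebesgue_measurable_scaling S]]) simp
    finally show ?thesis .
  qed
  have E_eq: "E n = (\<Inter>k\<in>{n..}. M k)" for n
    unfolding E_def M_def by auto
  have "E n \<in> sets lebesgue" for n
    unfolding E_eq using M by (intro sets.countable_INT) auto
  moreover have "E n \<subseteq> {1..4}" for n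
    unfolding E_def by auto
  ultimately show Em: "E n \<in> lmeasurable" for n
    using lmeasurable_interval(1)[of "1::real" 4] fmeasurableI2 by (metis cbox_interval lmeasurable_cbox)
  have "(\<Union>n. E n) = {1..4}"
  proof
    show "{1..4} \<subseteq> (\<Union>n. E n)"
    proof
      fix t :: real assume t: "t \<in> {1..4}"
      have e0: "filterlim e (at_right 0) sequentially"
        using e by (intro filterlim_atI tendsto_imp_filterlim_at_right) (auto intro!: tendsto_imp_filterlim_at_right always_eventually)
      have "(\<lambda>k. L (t * e k) / L (e k)) \<longlonglongrightarrow> 1"
        using filterlim_compose[OF lim e0, of t] t by simp
      then have "(\<lambda>k. ln (L (t * e k) / L (e k))) \<longlonglongrightarrow> ln 1"
        by (intro tendsto_ln) auto
      moreover have "ln (L (t * e k) / L (e k)) = ln (L (e k * t)) - ln (L (e k))" for k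
      proof -
        have "e k * t \<in> {0<..A}" "e k \<in> {0<..A}"
          using t e(1)[of k] mult_mono[of "e k" "A / 4" t 4] e(2)[of k] by auto
        then have "0 < L (e k * t)" "0 < L (e k)" using pos by auto
        then show ?thesis by (simp add: ln_div mult.commute)
      qed
      ultimately have "(\<lambda>k. ln (L (e k * t)) - ln (L (e k))) \<longlonglongrightarrow> 0" by simp
      from LIMSEQ_D[OF this, of "1/2"] obtain N
        where "\<And>k. k \<ge> N \<Longrightarrow> \<bar>ln (L (e k * t)) - ln (L (e k))\<bar> < 1 / 2"
        by auto
      then have "t \<in> E N" using t unfolding E_def by (auto intro: less_imp_le)
      then show "t \<in> (\<Union>n. E n)" by blast
    qed
  qed (auto simp: E_def)
  moreover have "(\<lambda>n. measure lebesgue (E n)) \<longlonglongrightarrow> measure lebesgue (\<Union>n. E n)"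
  proof (rule Lim_measure_incseq)
    show "incseq E" unfolding incseq_def E_def by auto
    show "emeasure lebesgue (\<Union>n. E n) \<noteq> \<infinity>" unfolding \<open>(\<Union>n. E n) = {1..4}\<close> by simp
  qed (use Em in \<open>auto simp: fmeasurable_def\<close>)
  ultimately have "(\<lambda>n. measure lebesgue (E n)) \<longlonglongrightarrow> 3" by simp
  then show "\<exists>N. \<forall>n\<ge>N. measure lebesgue (E n) > 11 / 4"
    using order_tendstoD(1)[of "\<lambda>n. measure lebesgue (E n)" 3 sequentially "11 / 4"]
    by (simp add: eventually_sequentially)
qed

text \<open>A weak form of the uniform convergence theorem for slowly varying functions. If it
  failed along \<open>e k\<close> and \<open>a k * e k\<close>, both sequences would have large
  level sets, and the second, stretched by \<open>a k\<close>, would meet the first. A common point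
  gives a value of \<open>L\<close> whose logarithm is within \<open>1 / 2\<close> of both
  others.\<close>

lemma slowly_varying_locally_bounded:
  assumes "slowly_varying_at_0 L"
  obtains \<delta> where "\<delta> > 0" "\<And>\<epsilon>. 0 < \<epsilon> \<Longrightarrow> \<epsilon> \<le> \<delta> \<Longrightarrow> L \<epsilon> > 0"
    "\<And>\<epsilon> a. 0 < \<epsilon> \<Longrightarrow> \<epsilon> \<le> \<delta> \<Longrightarrow> 1 \<le> a \<Longrightarrow> a \<le> 2 \<Longrightarrow> a * \<epsilon> \<le> \<delta> \<Longrightarrow> \<bar>ln (L (a * \<epsilon>)) - ln (L \<epsilon>)\<bar> \<le> 1"
proof -
  obtain A where A: "A > 0" and meas: "L \<in> borel_measurable (lebesgue_on {0<..A})"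
    and pos: "\<And>x. x \<in> {0<..A} \<Longrightarrow> L x > 0"
    and lim: "\<And>a. a > 0 \<Longrightarrow> ((\<lambda>\<epsilon>. L (a * \<epsilon>) / L \<epsilon>) \<longlongrightarrow> 1) (at_right 0)"
    using assms unfolding slowly_varying_at_0_def by blast
  have "\<exists>\<delta>>0. \<delta> \<le> A \<and> (\<forall>\<epsilon> a. 0 < \<epsilon> \<and> \<epsilon> \<le> \<delta> \<and> 1 \<le> a \<and> a \<le> 2 \<longrightarrow> \<bar>ln (L (a * \<epsilon>)) - ln (L \<epsilon>)\<bar> \<le> 1)"
  proof (rule ccontr)
    assume neg: "\<not> ?thesis"
    \<comment> \<open>The 8 leaves room for the factor \<open>a \<le> 2\<close>, so that both
      \<open>e k\<close> and \<open>a k * e k\<close> are at most \<open>A / 4\<close>.\<close>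
    have "\<exists>\<epsilon> a. 0 < \<epsilon> \<and> \<epsilon> \<le> A / (8 * real (Suc k)) \<and> 1 \<le> a \<and> a \<le> 2 \<and> \<bar>ln (L (a * \<epsilon>)) - ln (L \<epsilon>)\<bar> > 1" for k
    proof -
      have "A / (8 * real (Suc k)) > 0" using A by simp
      moreover have "A / (8 * real (Suc k)) \<le> A" using A by (simp add: field_simps)
      ultimately show ?thesis using neg by (meson not_le)
    qed
    then obtain e a where e: "\<And>k. 0 < e k" "\<And>k. e k \<le> A / (8 * real (Suc k))"
      and a: "\<And>k. 1 \<le> a k" "\<And>k. a k \<le> 2"
      and big: "\<And>k. \<bar>ln (L (a k * e k)) - ln (L (e k))\<bar> > 1"
      by metis
    have lim0: "(\<lambda>k. A / (8 * real (Suc k))) \<longlonglongrightarrow> 0"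
      using tendsto_mult_right_zero[OF LIMSEQ_inverse_real_of_nat, of "A / 8"]
      by (simp only: divide_inverse inverse_mult_distrib mult.assoc)
    have lim1: "(\<lambda>k. A / (4 * real (Suc k))) \<longlonglongrightarrow> 0"
      using tendsto_mult_right_zero[OF LIMSEQ_inverse_real_of_nat, of "A / 4"]
      by (simp only: divide_inverse inverse_mult_distrib mult.assoc)
    have e4: "e k \<le> A / 4" for k
      by (rule order_trans[OF e(2)]) (use A in \<open>simp add: field_simps\<close>)
    have e_lim: "e \<longlonglongrightarrow> 0"
      by (rule tendsto_sandwich[OF always_eventually always_eventually tendsto_const lim0])
        (rule allI, rule less_imp_le[OF e(1)] e(2))+
    define d where "d k = a k * e k" for k
    have d: "0 < d k" for k using a(1)[of k] e(1)[of k] unfolding d_def by simp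
    have d2: "d k \<le> A / (4 * real (Suc k))" for k
    proof -
      have "d k \<le> 2 * (A / (8 * real (Suc k)))"
        unfolding d_def by (rule mult_mono[OF a(2) e(2)]) (use e(1)[of k] in auto)
      also have "\<dots> = A / (4 * real (Suc k))"
        using times_divide_times_eq[of 2 2 A "4 * real (Suc k)"] by simp
      finally show ?thesis .
    qed
    have d4: "d k \<le> A / 4" for k
      by (rule order_trans[OF d2]) (use A in \<open>simp add: field_simps\<close>)
    have d_lim: "d \<longlonglongrightarrow> 0"
      by (rule tendsto_sandwich[OF always_eventually always_eventually tendsto_const lim1])
        (rule allI, rule less_imp_le[OF d] d2)+
    define E where "E n = {t \<in> {1..4}. \<forall>k\<ge>n. \<bar>ln (L (e k * t)) - ln (L (e k))\<bar> \<le> 1 / 2}" for n :: nat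
    define F where "F n = {t \<in> {1..4}. \<forall>k\<ge>n. \<bar>ln (L (d k * t)) - ln (L (d k))\<bar> \<le> 1 / 2}" for n :: nat
    note Em = slowly_varying_level_sets[OF meas pos lim e(1) e4 e_lim, folded E_def]
    note Fm = slowly_varying_level_sets[OF meas pos lim d d4 d_lim, folded F_def]
    obtain N1 N2 where N: "\<forall>n\<ge>N1. measure lebesgue (E n) > 11 / 4" "\<forall>n\<ge>N2. measure lebesgue (F n) > 11 / 4"
      using Em(2) Fm(2) by auto
    define n where "n = max N1 N2"
    have mE: "measure lebesgue (E n) > 11 / 4" and mF: "measure lebesgue (F n) > 11 / 4"
      using N by (auto simp: n_def)
    define G where "G = (\<lambda>t. a n *\<^sub>R t + 0) ` F n"
    have "G \<subseteq> {1..4 * a n}"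
      unfolding G_def F_def using a(1)[of n] mult_mono[of 1 "a n" 1] by auto
    have "G = (*\<^sub>R) (1 / a n) -` F n \<inter> space lebesgue"
    proof -
      have "a n \<noteq> 0" using a(1)[of n] by linarith
      show ?thesis
      proof (intro set_eqI iffI)
        fix x assume "x \<in> (*\<^sub>R) (1 / a n) -` F n \<inter> space lebesgue"
        then have "x / a n \<in> F n" by simp
        moreover have "x = a n *\<^sub>R (x / a n) + 0" using \<open>a n \<noteq> 0\<close> by simp
        ultimately show "x \<in> G" unfolding G_def by (rule rev_image_eqI)
      qed (use \<open>a n \<noteq> 0\<close> in \<open>auto simp: G_def\<close>)
    qed
    then have "G \<in> sets lebesgue"
      using measurable_sets[OF lebesgue_measurable_scaling fmeasurableD[OF Fm(1)]] by metis
    then have G: "G \<in> lmeasurable"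
      by (rule fmeasurableI2[OF _ \<open>G \<subseteq> {1..4 * a n}\<close>, rotated]) (rule lmeasurable_interval)
    have "measure lebesgue G = a n * measure lebesgue (F n)"
      unfolding G_def using measure_lebesgue_affine[of "a n" 0 "F n"] a(1)[of n] by simp
    then have mG: "measure lebesgue G > a n * (11 / 4)" using mF a(1)[of n] by simp
    \<comment> \<open>If disjoint, the sets would have total measure above
      \<open>11 / 4 * (1 + a n)\<close> in an interval of length \<open>4 * a n - 1\<close>, which
      forces \<open>a n > 3\<close>.\<close>
    have "E n \<inter> G \<noteq> {}"
    proof
      assume "E n \<inter> G = {}"
      then have "measure lebesgue (E n \<union> G) = measure lebesgue (E n) + measure lebesgue G"
        using Em(1) G by (intro measure_Un_AE) auto
      moreover have "E n \<union> G \<subseteq> {1..4 * a n}"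
        using \<open>G \<subseteq> {1..4 * a n}\<close> a(1)[of n] unfolding E_def by auto
      then have "measure lebesgue (E n \<union> G) \<le> measure lebesgue {1..4 * a n}"
        using Em(1) G by (intro measure_mono_fmeasurable) (auto simp: fmeasurableD)
      moreover have "measure lebesgue {1..4 * a n} = 4 * a n - 1" using a(1)[of n] by simp
      ultimately show False using mE mG a(2)[of n] by linarith
    qed
    then obtain t b where t: "t \<in> E n" and b: "b \<in> F n" and tb: "t = a n * b"
      unfolding G_def by auto
    have eq: "e n * t = d n * b" unfolding tb d_def by simp
    have "\<bar>ln (L (d n * b)) - ln (L (e n))\<bar> \<le> 1 / 2"
      using t unfolding E_def eq[symmetric] by blast
    moreover have "\<bar>ln (L (d n * b)) - ln (L (d n))\<bar> \<le> 1 / 2" using b unfolding F_def by blast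
    ultimately have "\<bar>ln (L (d n)) - ln (L (e n))\<bar> \<le> 1" by linarith
    then show False using big[of n] unfolding d_def by linarith
  qed
  then show ?thesis using that pos by auto
qed

text \<open>Halving the argument costs at most a factor \<open>exp 1 \<le> 4\<close>, while
  \<open>x\<^sup>2\<close> drops by exactly 4; this is where the exponent 2 comes from. Dyadic
  induction carries the bound from \<open>d\<close> down to 0.\<close>

lemma slowly_varying_lower_bound:
  assumes "slowly_varying_at_0 L"
  obtains c d where "c > 0" "d > 0" "\<And>x. 0 < x \<Longrightarrow> x \<le> d \<Longrightarrow> L x > 0"
    "\<And>x. 0 < x \<Longrightarrow> x \<le> d \<Longrightarrow> c * x\<^sup>2 \<le> L x"
proof -
  obtain d where d: "d > 0" and pos: "\<And>x. 0 < x \<Longrightarrow> x \<le> d \<Longrightarrow> L x > 0"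
    and osc: "\<And>x a. 0 < x \<Longrightarrow> x \<le> d \<Longrightarrow> 1 \<le> a \<Longrightarrow> a \<le> 2 \<Longrightarrow> a * x \<le> d \<Longrightarrow> \<bar>ln (L (a * x)) - ln (L x)\<bar> \<le> 1"
    using slowly_varying_locally_bounded[OF assms] by metis
  have ratio: "L (a * x) \<le> 4 * L x" "L x \<le> 4 * L (a * x)"
    if "0 < x" "1 \<le> a" "a \<le> 2" "a * x \<le> d" for x a
  proof -
    have "x \<le> a * x" using that by simp
    then have "x \<le> d" using that by linarith
    have p: "L x > 0" "L (a * x) > 0" using pos \<open>x \<le> d\<close> that by auto
    have e4: "exp 1 \<le> (4::real)" using exp_le by linarith
    have "ln (L (a * x)) \<le> 1 + ln (L x)" "ln (L x) \<le> 1 + ln (L (a * x))"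
      using osc[OF that(1) \<open>x \<le> d\<close> that(2-4)] by linarith+
    then have "exp (ln (L (a * x))) \<le> exp (1 + ln (L x))" "exp (ln (L x)) \<le> exp (1 + ln (L (a * x)))"
      by simp_all
    then have "L (a * x) \<le> exp 1 * L x" "L x \<le> exp 1 * L (a * x)"
      using p by (simp_all add: exp_add)
    then show "L (a * x) \<le> 4 * L x" "L x \<le> 4 * L (a * x)"
      using mult_right_mono[OF e4, of "L x"] mult_right_mono[OF e4, of "L (a * x)"] p by linarith+
  qed
  \<comment> \<open>Chosen for the top dyadic interval, where \<open>x\<close> exceeds
    \<open>d / 2\<close> by a factor of at most 2, so \<open>L x\<close> is at least a quarter of
    \<open>L (d / 2)\<close>.\<close>
  define c where "c = L (d / 2) / (4 * d\<^sup>2)"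
  have "c > 0" using pos[of "d / 2"] d by (simp add: c_def)
  have base: "c * x\<^sup>2 \<le> L x" if "d / 2 < x" "x \<le> d" for x
  proof -
    have "c * x\<^sup>2 \<le> c * d\<^sup>2" using that d \<open>c > 0\<close> by (intro mult_left_mono power_mono) auto
    also have "\<dots> = L (d / 2) / 4" using d by (simp add: c_def)
    also have "\<dots> \<le> L x"
      using ratio(2)[of "d / 2" "2 * x / d"] that d by (simp add: field_simps)
    finally show ?thesis .
  qed
  have step: "c * x\<^sup>2 \<le> L x" if "d / 2 ^ Suc n < x" "x \<le> d" for n x
    using that
  proof (induction n arbitrary: x)
    case 0
    then show ?case using base by simp
  next
    case (Suc n)
    show ?case
    proof (cases "d / 2 < x")
      case False
      have "x > 0" using Suc.prems(1) d by (meson divide_pos_pos less_trans zero_less_numeral zero_less_power)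
      have "c * (2 * x)\<^sup>2 \<le> L (2 * x)"
        using Suc.prems False by (intro Suc.IH) (auto simp: field_simps)
      also have "\<dots> \<le> 4 * L x" using ratio(1)[of x 2] \<open>x > 0\<close> False by simp
      finally show ?thesis by (simp add: power_mult_distrib)
    qed (use base Suc.prems in auto)
  qed
  have "c * x\<^sup>2 \<le> L x" if "0 < x" "x \<le> d" for x
  proof -
    obtain n where "(1 / 2 :: real) ^ n < x / d"
      using real_arch_pow_inv[of "x / d" "1 / 2"] \<open>0 < x\<close> d by auto
    then have "d / 2 ^ n < x" using d by (simp add: field_simps power_one_over)
    moreover have "d / 2 ^ Suc n \<le> d / 2 ^ n" using d by (simp add: field_simps)
    ultimately show ?thesis using step[of n x] that by linarith
  qed
  then show ?thesis using that[of c d] \<open>c > 0\<close> d pos by blast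
qed

section \<open>Families of functions depending on parameters\<close>

text \<open>The parameters are \<open>(\<epsilon>, x, \<xi>)\<close>. In \<open>level_bound e i h\<close> the exponents \<open>e\<close> and \<open>i\<close> record decay as
  \<open>\<epsilon> \<rightarrow> 0\<close> and growth in \<open>s\<close>; powers of \<open>weight\<close> are harmless because test functions on \<open>Y\<close> absorb them.\<close>

definition params :: "(real \<times> real \<times> real) set" where
  "params = {0<..} \<times> Y"

definition weight :: "real \<times> real \<times> real \<Rightarrow> real" where
  "weight = (\<lambda>(\<epsilon>, x, \<xi>). 1 + \<epsilon> + \<bar>x\<bar> + \<bar>\<xi>\<bar> + 1 / \<bar>\<xi>\<bar>)"

type_synonym family = "real \<times> real \<times> real \<Rightarrow> real \<Rightarrow> complex"

definition level_bound :: "nat \<Rightarrow> int \<Rightarrow> family \<Rightarrow> bool" where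
  "level_bound e i h \<longleftrightarrow>
     (\<forall>p\<in>params. \<forall>s. h p differentiable (at s)) \<and>
     continuous_on (params \<times> UNIV) (\<lambda>(p, s). h p s) \<and>
     (\<exists>C M. C \<ge> 0 \<and> (\<forall>p\<in>params. \<forall>s.
        norm (h p s) \<le> C * fst p ^ e * weight p ^ M * (1 + \<bar>s\<bar>) powi i))"

lemma level_boundI:
  assumes "\<And>p s. p \<in> params \<Longrightarrow> h p differentiable (at s)"
    and "continuous_on (params \<times> UNIV) (\<lambda>(p, s). h p s)" and "C \<ge> 0"
    and "\<And>p s. p \<in> params \<Longrightarrow> norm (h p s) \<le> C * fst p ^ e * weight p ^ M * (1 + \<bar>s\<bar>) powi i"
  shows "level_bound e i h"
  unfolding level_bound_def using assms by blast

text \<open>All derivatives up to order \<open>K\<close> share the exponents \<open>e\<close> and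
  \<open>i\<close>; only the constants and the power of the weight may change with the order.
  Recursion through the first derivative fits the product and chain rules.\<close>

primrec controlled :: "nat \<Rightarrow> nat \<Rightarrow> int \<Rightarrow> family \<Rightarrow> bool" where
  "controlled 0 e i h \<longleftrightarrow> level_bound e i h"
| "controlled (Suc K) e i h \<longleftrightarrow> level_bound e i h \<and> controlled K e i (\<lambda>p. vderiv (h p))"

lemma open_Y: "open Y"
  unfolding Y_def by (intro open_Times open_UNIV open_Diff) auto

lemma open_params: "open params"
  unfolding params_def by (intro open_Times open_Y) auto

lemma params_pos: "p \<in> params \<Longrightarrow> fst p > 0"
  unfolding params_def by auto

lemma params_nonzero: "p \<in> params \<Longrightarrow> snd (snd p) \<noteq> 0"
  unfolding params_def Y_def by auto

lemma weight_ge: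
  assumes "p \<in> params"
  shows "1 \<le> weight p" "fst p \<le> weight p" "\<bar>fst (snd p)\<bar> \<le> weight p"
    "\<bar>snd (snd p)\<bar> \<le> weight p" "1 + \<bar>fst (snd p)\<bar> + 1 / \<bar>snd (snd p)\<bar> \<le> weight p"
  using params_pos[OF assms] unfolding weight_def by (auto simp: case_prod_beta)

lemma continuous_on_weight: "continuous_on params weight"
  unfolding weight_def case_prod_beta
  by (intro continuous_intros) (auto dest: params_nonzero)

lemma level_bound_cong:
  assumes "\<And>p. p \<in> params \<Longrightarrow> h p = h' p"
  shows "level_bound e i h \<longleftrightarrow> level_bound e i h'"
proof -
  have "continuous_on (params \<times> UNIV) (\<lambda>(p, s). h p s) \<longleftrightarrow> continuous_on (params \<times> UNIV) (\<lambda>(p, s). h' p s)"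
    by (rule continuous_on_cong) (use assms in auto)
  then show ?thesis unfolding level_bound_def using assms by auto
qed

lemma controlled_cong:
  "(\<And>p. p \<in> params \<Longrightarrow> h p = h' p) \<Longrightarrow> controlled K e i h \<longleftrightarrow> controlled K e i h'"
proof (induction K arbitrary: h h')
  case 0
  then show ?case using level_bound_cong[of h h'] by simp
next
  case (Suc K)
  have "controlled K e i (\<lambda>p. vderiv (h p)) \<longleftrightarrow> controlled K e i (\<lambda>p. vderiv (h' p))"
    by (rule Suc.IH) (simp add: Suc.prems)
  then show ?case using level_bound_cong[of h h', OF Suc.prems] by simp
qed

lemma controlled_SucI:
  assumes "level_bound e i h" "controlled K e i h'"
    and "\<And>p s. p \<in> params \<Longrightarrow> (h p has_vector_derivative h' p s) (at s)"
  shows "controlled (Suc K) e i h"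
proof -
  have "vderiv (h p) = h' p" if "p \<in> params" for p
    using vderivI[OF assms(3)[OF that]] by blast
  then show ?thesis
    using controlled_cong[of "\<lambda>p. vderiv (h p)" h'] assms by simp
qed

lemma controlled_level: "controlled K e i h \<Longrightarrow> level_bound e i h"
  by (cases K) auto

lemma controlled_SucD: "controlled (Suc K) e i h \<Longrightarrow> controlled K e i h"
  by (induction K arbitrary: h) auto

lemma controlled_iter:
  "controlled K e i h \<Longrightarrow> k \<le> K \<Longrightarrow> level_bound e i (\<lambda>p. (vderiv ^^ k) (h p))"
proof (induction K arbitrary: h k)
  case 0
  then show ?case by simp
next
  case (Suc K)
  show ?case
  proof (cases k)
    case 0
    then show ?thesis using Suc.prems by simp
  next
    case k: (Suc l)
    have "level_bound e i (\<lambda>p. (vderiv ^^ l) (vderiv (h p)))"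
      using Suc.prems k by (intro Suc.IH) auto
    then show ?thesis unfolding k funpow_Suc_right by simp
  qed
qed

lemma level_bound_differentiable:
  "level_bound e i h \<Longrightarrow> p \<in> params \<Longrightarrow> (h p has_vector_derivative vderiv (h p) s) (at s)"
  unfolding level_bound_def by (intro vderiv_works) blast

text \<open>Surplus powers of \<epsilon> cannot be dropped for large \<epsilon>, but they are
  bounded by powers of the weight, which for this reason contains \<epsilon> as a summand.\<close>

lemma level_bound_mono:
  assumes "level_bound e i h" "e' \<le> e" "i \<le> i'"
  shows "level_bound e' i' h"
proof -
  obtain C M where C: "C \<ge> 0" "\<And>p s. p \<in> params \<Longrightarrow>
      norm (h p s) \<le> C * fst p ^ e * weight p ^ M * (1 + \<bar>s\<bar>) powi i"
    using assms(1) unfolding level_bound_def by blast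
  have "norm (h p s) \<le> C * fst p ^ e' * weight p ^ (M + (e - e')) * (1 + \<bar>s\<bar>) powi i'" if p: "p \<in> params" for p s
  proof -
    note w = weight_ge[OF p] params_pos[OF p]
    have "fst p ^ e = fst p ^ e' * fst p ^ (e - e')"
      using assms(2) by (simp add: power_add[symmetric])
    also have "\<dots> \<le> fst p ^ e' * weight p ^ (e - e')"
      using w by (intro mult_left_mono power_mono) auto
    finally have "C * fst p ^ e * weight p ^ M \<le> C * (fst p ^ e' * weight p ^ (e - e')) * weight p ^ M"
      using C(1) w by (intro mult_left_mono mult_right_mono) auto
    also have "\<dots> = C * fst p ^ e' * weight p ^ (M + (e - e'))"
      by (simp add: power_add)
    finally have "C * fst p ^ e * weight p ^ M * (1 + \<bar>s\<bar>) powi i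
        \<le> C * fst p ^ e' * weight p ^ (M + (e - e')) * (1 + \<bar>s\<bar>) powi i'"
      by (rule mult_mono[OF _ power_int_increasing[OF assms(3)]]) (use C(1) w in auto)
    then show ?thesis using C(2)[OF p, of s] by linarith
  qed
  then show ?thesis using assms(1) C(1) unfolding level_bound_def by blast
qed

lemma controlled_mono:
  "controlled K e i h \<Longrightarrow> e' \<le> e \<Longrightarrow> i \<le> i' \<Longrightarrow> controlled K e' i' h"
  by (induction K arbitrary: h) (auto intro: level_bound_mono)

lemma level_bound_add:
  assumes "level_bound e i h" "level_bound e i h'"
  shows "level_bound e i (\<lambda>p s. h p s + h' p s)"
proof -
  obtain C M where C: "C \<ge> 0" "\<And>p s. p \<in> params \<Longrightarrow>
      norm (h p s) \<le> C * fst p ^ e * weight p ^ M * (1 + \<bar>s\<bar>) powi i"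
    using assms(1) unfolding level_bound_def by blast
  obtain C' M' where C': "C' \<ge> 0" "\<And>p s. p \<in> params \<Longrightarrow>
      norm (h' p s) \<le> C' * fst p ^ e * weight p ^ M' * (1 + \<bar>s\<bar>) powi i"
    using assms(2) unfolding level_bound_def by blast
  have "norm (h p s + h' p s) \<le> (C + C') * fst p ^ e * weight p ^ (M + M') * (1 + \<bar>s\<bar>) powi i"
    if p: "p \<in> params" for p s
  proof -
    note w = weight_ge[OF p] params_pos[OF p]
    have "norm (h p s) \<le> C * fst p ^ e * weight p ^ (M + M') * (1 + \<bar>s\<bar>) powi i"
      by (rule order_trans[OF C(2)[OF p]], intro mult_right_mono mult_left_mono power_increasing)
        (use C(1) w in auto)
    moreover have "norm (h' p s) \<le> C' * fst p ^ e * weight p ^ (M + M') * (1 + \<bar>s\<bar>) powi i"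
      by (rule order_trans[OF C'(2)[OF p]], intro mult_right_mono mult_left_mono power_increasing)
        (use C'(1) w in auto)
    ultimately have "norm (h p s) + norm (h' p s) \<le> C * fst p ^ e * weight p ^ (M + M') * (1 + \<bar>s\<bar>) powi i
        + C' * fst p ^ e * weight p ^ (M + M') * (1 + \<bar>s\<bar>) powi i"
      by (rule add_mono)
    also have "\<dots> = (C + C') * fst p ^ e * weight p ^ (M + M') * (1 + \<bar>s\<bar>) powi i"
      by (simp only: distrib_right)
    finally show ?thesis by (rule order_trans[OF norm_triangle_ineq])
  qed
  moreover have "continuous_on (params \<times> UNIV) (\<lambda>(p, s). h p s + h' p s)"
    using continuous_on_add[of "params \<times> UNIV" "\<lambda>(p, s). h p s" "\<lambda>(p, s). h' p s"] assms
    unfolding level_bound_def by (simp add: case_prod_beta)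
  moreover have "(\<lambda>s. h p s + h' p s) differentiable (at s)" if "p \<in> params" for p s
    using assms that unfolding level_bound_def by (intro differentiable_add) auto
  ultimately show ?thesis
    using C(1) C'(1) by (intro level_boundI[where C = "C + C'" and M = "M + M'"]) auto
qed

lemma controlled_add:
  "controlled K e i h \<Longrightarrow> controlled K e i h' \<Longrightarrow> controlled K e i (\<lambda>p s. h p s + h' p s)"
proof (induction K arbitrary: h h')
  case 0
  then show ?case by (simp add: level_bound_add)
next
  case (Suc K)
  show ?case
  proof (rule controlled_SucI[where h' = "\<lambda>p s. vderiv (h p) s + vderiv (h' p) s"])
    show "((\<lambda>s. h p s + h' p s) has_vector_derivative vderiv (h p) s + vderiv (h' p) s) (at s)"
      if "p \<in> params" for p s
      using Suc.prems that
      by (intro has_vector_derivative_add level_bound_differentiable[OF controlled_level])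
  qed (use Suc in \<open>auto intro: level_bound_add\<close>)
qed

lemma level_bound_mult:
  assumes "level_bound e i h" "level_bound e' i' h'"
  shows "level_bound (e + e') (i + i') (\<lambda>p s. h p s * h' p s)"
proof -
  obtain C M where C: "C \<ge> 0" "\<And>p s. p \<in> params \<Longrightarrow>
      norm (h p s) \<le> C * fst p ^ e * weight p ^ M * (1 + \<bar>s\<bar>) powi i"
    using assms(1) unfolding level_bound_def by blast
  obtain C' M' where C': "C' \<ge> 0" "\<And>p s. p \<in> params \<Longrightarrow>
      norm (h' p s) \<le> C' * fst p ^ e' * weight p ^ M' * (1 + \<bar>s\<bar>) powi i'"
    using assms(2) unfolding level_bound_def by blast
  have "norm (h p s * h' p s) \<le> (C * C') * fst p ^ (e + e') * weight p ^ (M + M') * (1 + \<bar>s\<bar>) powi (i + i')"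
    if p: "p \<in> params" for p s
  proof -
    have nz: "1 + \<bar>s\<bar> \<noteq> 0" by linarith
    have "norm (h p s * h' p s) \<le> (C * fst p ^ e * weight p ^ M * (1 + \<bar>s\<bar>) powi i) *
        (C' * fst p ^ e' * weight p ^ M' * (1 + \<bar>s\<bar>) powi i')"
      unfolding norm_mult by (rule mult_mono'[OF C(2)[OF p] C'(2)[OF p]]) auto
    also have "\<dots> = (C * C') * fst p ^ (e + e') * weight p ^ (M + M') * (1 + \<bar>s\<bar>) powi (i + i')"
      using nz by (simp add: power_add power_int_add)
    finally show ?thesis .
  qed
  moreover have "continuous_on (params \<times> UNIV) (\<lambda>(p, s). h p s * h' p s)"
    using continuous_on_mult[of "params \<times> UNIV" "\<lambda>(p, s). h p s" "\<lambda>(p, s). h' p s"] assms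
    unfolding level_bound_def by (simp add: case_prod_beta)
  moreover have "(\<lambda>s. h p s * h' p s) differentiable (at s)" if "p \<in> params" for p s
    using assms that unfolding level_bound_def by (intro differentiable_mult) auto
  ultimately show ?thesis
    using C(1) C'(1) by (intro level_boundI[where C = "C * C'" and M = "M + M'"]) auto
qed

lemma controlled_mult:
  "controlled K e i h \<Longrightarrow> controlled K e' i' h' \<Longrightarrow>
    controlled K (e + e') (i + i') (\<lambda>p s. h p s * h' p s)"
proof (induction K arbitrary: h h')
  case 0
  then show ?case by (simp add: level_bound_mult)
next
  case (Suc K)
  show ?case
  proof (rule controlled_SucI[where h' = "\<lambda>p s. h p s * vderiv (h' p) s + vderiv (h p) s * h' p s"])
    show "((\<lambda>s. h p s * h' p s) has_vector_derivative h p s * vderiv (h' p) s + vderiv (h p) s * h' p s) (at s)"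
      if "p \<in> params" for p s
      using Suc.prems that
      by (intro has_vector_derivative_mult level_bound_differentiable[OF controlled_level])
    show "controlled K (e + e') (i + i') (\<lambda>p s. h p s * vderiv (h' p) s + vderiv (h p) s * h' p s)"
      using Suc.prems controlled_SucD[OF Suc.prems(1)] controlled_SucD[OF Suc.prems(2)]
      by (intro controlled_add Suc.IH) auto
  qed (use Suc.prems in \<open>auto intro: level_bound_mult\<close>)
qed

section \<open>Constants, the identity and translated windows\<close>

lemma level_bound_const:
  assumes "continuous_on params a" "C \<ge> 0" "\<And>p. p \<in> params \<Longrightarrow> norm (a p) \<le> C * fst p ^ e * weight p ^ M"
  shows "level_bound e 0 (\<lambda>p s. a p)"
proof -
  have "continuous_on (params \<times> UNIV) (\<lambda>(p, s). a p)"
    unfolding case_prod_beta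
    by (rule continuous_on_compose2[OF assms(1)]) (auto intro: continuous_intros)
  then show ?thesis
    unfolding level_bound_def using assms(2,3) by (auto intro!: exI[of _ C] exI[of _ M])
qed

lemma controlled_zero: "controlled K e i (\<lambda>p s. 0)"
proof (induction K)
  case 0
  show ?case by (auto simp: level_bound_def case_prod_beta intro: exI[of _ 0])
next
  case (Suc K)
  show ?case
    by (rule controlled_SucI[OF _ Suc])
      (auto simp: level_bound_def case_prod_beta intro: exI[of _ 0])
qed

lemma controlled_const:
  assumes "continuous_on params a" "C \<ge> 0" "\<And>p. p \<in> params \<Longrightarrow> norm (a p) \<le> C * fst p ^ e * weight p ^ M"
  shows "controlled K e 0 (\<lambda>p s. a p)"
proof (cases K)
  case (Suc K)
  show ?thesis
    unfolding Suc by (rule controlled_SucI[OF level_bound_const[OF assms] controlled_zero]) auto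
qed (use level_bound_const[OF assms] in simp)

lemma controlled_id: "controlled K 0 1 (\<lambda>p s. of_real s)"
proof -
  have der: "(complex_of_real has_vector_derivative 1) (at s)" for s
    using has_vector_derivative_of_real[OF DERIV_ident, of "at s"] by simp
  have lev: "level_bound 0 1 (\<lambda>p s. of_real s)"
    by (rule level_boundI[where C = 1 and M = 0])
      (auto simp: case_prod_beta intro!: continuous_intros differentiableI_vector[OF der])
  show ?thesis
  proof (cases K)
    case (Suc K)
    have "controlled K 0 0 (\<lambda>p s. 1)"
      by (rule controlled_const[where C = 1 and M = 0]) auto
    then have "controlled K 0 1 (\<lambda>p s. 1)"
      by (rule controlled_mono) auto
    then show ?thesis
      unfolding Suc by (rule controlled_SucI[OF lev]) (simp_all add: der)
  qed (use lev in simp)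
qed

text \<open>With \<open>y = \<xi> * (s - x)\<close> one has
  \<open>1 + \<bar>s\<bar> \<le> weight p * (1 + \<bar>y\<bar>)\<close>, so decay in
  \<open>y\<close> becomes decay in \<open>s\<close> at the price of powers of the weight.\<close>

lemma level_bound_schwartz:
  assumes "g \<in> schwartz"
  shows "level_bound 0 i (\<lambda>p s. g (snd (snd p) * (s - fst (snd p))))"
proof -
  let ?h = "\<lambda>p s. g (snd (snd p) * (s - fst (snd p)))"
  \<comment> \<open>For \<open>i \<ge> 0\<close> this is 0, and boundedness of \<open>g\<close> is
    all that is required.\<close>
  define j where "j = nat (- i)"
  define B where "B = 2 ^ j * (schwartz_seminorm 0 0 g + schwartz_seminorm j 0 g)"
  have "B \<ge> 0" unfolding B_def using schwartz_seminorm_nonneg[OF assms] by simp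
  have dec: "(1 + \<bar>y\<bar>) ^ j * norm (g y) \<le> B" for y
  proof -
    have "(1 + \<bar>y\<bar>) ^ j * norm (g y) \<le> 2 ^ j * (1 + \<bar>y\<bar> ^ j) * norm (g y)"
      using power_add_le[of 1 "\<bar>y\<bar>" j] by (intro mult_right_mono) auto
    also have "\<dots> = 2 ^ j * (norm (y ^ 0 *\<^sub>R (vderiv ^^ 0) g y) + norm (y ^ j *\<^sub>R (vderiv ^^ 0) g y))"
      by (simp add: algebra_simps power_abs)
    also have "\<dots> \<le> B"
      unfolding B_def by (intro mult_left_mono add_mono schwartz_seminorm_upper assms) auto
    finally show ?thesis .
  qed
  have "level_bound 0 (- int j) ?h"
    unfolding level_bound_def
  proof (intro conjI ballI allI exI[of _ B] exI[of _ j])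
    fix p s assume "p \<in> params"
    show "?h p differentiable (at s)"
      using smooth_affine(1)[OF schwartz_smooth[OF assms]] unfolding smooth_def by (metis funpow_0)
  next
    show "continuous_on (params \<times> UNIV) (\<lambda>(p, s). ?h p s)"
      unfolding case_prod_beta
      by (rule continuous_on_compose2[OF schwartz_continuous[OF assms]]) (auto intro!: continuous_intros)
  next
    fix p :: "real \<times> real \<times> real" and s :: real assume p: "p \<in> params"
    define x where "x = fst (snd p)"
    define \<xi> where "\<xi> = snd (snd p)"
    define y where "y = \<xi> * (s - x)"
    have "\<xi> \<noteq> 0" using params_nonzero[OF p] by (simp add: \<xi>_def)
    have W: "1 + \<bar>x\<bar> + 1 / \<bar>\<xi>\<bar> \<le> weight p" using weight_ge(5)[OF p] by (simp add: x_def \<xi>_def)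
    have s: "s = y / \<xi> + x" using \<open>\<xi> \<noteq> 0\<close> by (simp add: y_def)
    have "1 + \<bar>s\<bar> \<le> 1 + \<bar>x\<bar> + \<bar>y\<bar> * (1 / \<bar>\<xi>\<bar>)"
      unfolding s using abs_triangle_ineq[of "y / \<xi>" x] by simp
    also have "\<dots> \<le> (1 + \<bar>x\<bar> + 1 / \<bar>\<xi>\<bar>) * (1 + \<bar>y\<bar>)"
    proof -
      have "1 + a + b * r \<le> (1 + a + r) * (1 + b)" if "0 \<le> a" "0 \<le> b" "0 \<le> r" for a b r :: real
        using that by (simp add: algebra_simps)
      from this[of "\<bar>x\<bar>" "\<bar>y\<bar>" "1 / \<bar>\<xi>\<bar>"] show ?thesis by simp
    qed
    also have "\<dots> \<le> weight p * (1 + \<bar>y\<bar>)" using W by (intro mult_right_mono) auto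
    finally have "(1 + \<bar>s\<bar>) ^ j \<le> (weight p * (1 + \<bar>y\<bar>)) ^ j" by (intro power_mono) auto
    then have "(1 + \<bar>s\<bar>) ^ j * norm (g y) \<le> weight p ^ j * ((1 + \<bar>y\<bar>) ^ j * norm (g y))"
      unfolding power_mult_distrib mult.assoc[symmetric] by (intro mult_right_mono) auto
    also have "\<dots> \<le> weight p ^ j * B"
      using dec weight_ge(1)[OF p] by (intro mult_left_mono) auto
    finally have "norm (g y) \<le> weight p ^ j * B / (1 + \<bar>s\<bar>) ^ j"
      using add_pos_nonneg[of 1 "\<bar>s\<bar>"] by (simp add: field_simps)
    then show "norm (?h p s) \<le> B * fst p ^ 0 * weight p ^ j * (1 + \<bar>s\<bar>) powi (- int j)"
      unfolding x_def[symmetric] \<xi>_def[symmetric] y_def[symmetric]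
      by (simp add: power_int_minus divide_inverse mult_ac)
  qed (rule \<open>B \<ge> 0\<close>)
  then show ?thesis
    by (rule level_bound_mono) (auto simp: j_def)
qed

text \<open>Differentiation in \<open>s\<close> produces a factor \<xi>, which the weight absorbs,
  and replaces \<open>g\<close> by its derivative; hence the induction runs over all Schwartz
  functions \<open>g\<close>.\<close>

lemma controlled_schwartz:
  "g \<in> schwartz \<Longrightarrow> controlled K 0 i (\<lambda>p s. g (snd (snd p) * (s - fst (snd p))))"
proof (induction K arbitrary: g)
  case 0
  then show ?case by (simp add: level_bound_schwartz)
next
  case (Suc K)
  show ?case
  proof (rule controlled_SucI[where h' = "\<lambda>p s. of_real (snd (snd p)) * vderiv g (snd (snd p) * (s - fst (snd p)))"])
    show "level_bound 0 i (\<lambda>p s. g (snd (snd p) * (s - fst (snd p))))"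
      by (rule level_bound_schwartz[OF Suc.prems])
    have "controlled K 0 0 (\<lambda>p s. complex_of_real (snd (snd p)))"
      by (rule controlled_const[where C = 1 and M = 1])
        (auto intro!: continuous_intros simp: weight_ge)
    from controlled_mult[OF this Suc.IH[OF schwartz_vderiv[OF Suc.prems]]]
    show "controlled K 0 i (\<lambda>p s. of_real (snd (snd p)) * vderiv g (snd (snd p) * (s - fst (snd p))))"
      by simp
    fix p s
    show "((\<lambda>s. g (snd (snd p) * (s - fst (snd p)))) has_vector_derivative
        of_real (snd (snd p)) * vderiv g (snd (snd p) * (s - fst (snd p)))) (at s)"
      using smooth_vderiv_works[OF smooth_affine(1)[OF schwartz_smooth[OF Suc.prems]], of 0]
        smooth_affine(2)[OF schwartz_smooth[OF Suc.prems], of 1]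
      by (simp add: scaleR_conv_of_real)
  qed
qed

text \<open>Schwartz functions of \<open>s\<close>, uniformly in the parameters up to powers of the
  weight: \<open>i\<close> may be arbitrarily negative, whereas the order \<open>e\<close> of decay
  in \<epsilon> stays fixed.\<close>

definition rapid :: "nat \<Rightarrow> family \<Rightarrow> bool" where
  "rapid e h \<longleftrightarrow> (\<forall>K i. controlled K e i h)"

text \<open>The second factor may grow polynomially, at a rate depending on the number of
  derivatives; the first one compensates with the exponent \<open>i - i'\<close>.\<close>

lemma rapid_mult:
  assumes "rapid e h" "\<And>K. \<exists>i. controlled K e' i h'"
  shows "rapid (e + e') (\<lambda>p s. h p s * h' p s)"
  unfolding rapid_def
proof (intro allI)
  fix K i
  obtain i' where "controlled K e' i' h'" using assms(2) by blast
  moreover have "controlled K e (i - i') h" using assms(1) unfolding rapid_def by blast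
  ultimately show "controlled K (e + e') i (\<lambda>p s. h p s * h' p s)"
    using controlled_mult by fastforce
qed

lemma rapid_bound:
  assumes "rapid e h"
  obtains C M where "C \<ge> 0" "\<And>p s. p \<in> params \<Longrightarrow>
    (1 + \<bar>s\<bar>) ^ j * norm ((vderiv ^^ k) (h p) s) \<le> C * fst p ^ e * weight p ^ M"
proof -
  have "level_bound e (- int j) (\<lambda>p. (vderiv ^^ k) (h p))"
    using assms controlled_iter[of k e "- int j" h k] unfolding rapid_def by simp
  then obtain C M where C: "C \<ge> 0" "\<And>p s. p \<in> params \<Longrightarrow>
      norm ((vderiv ^^ k) (h p) s) \<le> C * fst p ^ e * weight p ^ M * (1 + \<bar>s\<bar>) powi (- int j)"
    unfolding level_bound_def by blast
  have "(1 + \<bar>s\<bar>) ^ j * norm ((vderiv ^^ k) (h p) s) \<le> C * fst p ^ e * weight p ^ M" if "p \<in> params" for p s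
  proof -
    have pos: "(1 + \<bar>s\<bar>) ^ j > 0" using add_pos_nonneg[of 1 "\<bar>s\<bar>"] by simp
    have "(1 + \<bar>s\<bar>) ^ j * norm ((vderiv ^^ k) (h p) s)
        \<le> (1 + \<bar>s\<bar>) ^ j * (C * fst p ^ e * weight p ^ M * (1 + \<bar>s\<bar>) powi (- int j))"
      using pos C(2)[OF that, of s] by (intro mult_left_mono) auto
    also have "\<dots> = C * fst p ^ e * weight p ^ M"
      using pos by (simp add: power_int_minus)
    finally show ?thesis .
  qed
  then show ?thesis using that C(1) by blast
qed

lemma norm_power_scaleR_le:
  fixes v :: complex
  shows "norm (t ^ j *\<^sub>R v) \<le> (1 + \<bar>t\<bar>) ^ j * norm v"
  by (simp add: power_abs mult_right_mono power_mono)

lemma rapid_schwartz: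
  assumes "rapid e h" "p \<in> params"
  shows "h p \<in> schwartz"
  unfolding schwartz_iff smooth_def
proof (intro conjI allI)
  fix k t
  have "level_bound e 0 (\<lambda>p. (vderiv ^^ k) (h p))"
    using assms controlled_iter[of k e 0 h k] unfolding rapid_def by simp
  then show "(vderiv ^^ k) (h p) differentiable (at t)"
    using assms(2) unfolding level_bound_def by blast
next
  fix j k
  obtain C M where C: "\<And>s. (1 + \<bar>s\<bar>) ^ j * norm ((vderiv ^^ k) (h p) s) \<le> C * fst p ^ e * weight p ^ M"
    using rapid_bound[OF assms(1)] assms(2) by metis
  have "norm (t ^ j *\<^sub>R (vderiv ^^ k) (h p) t) \<le> C * fst p ^ e * weight p ^ M" for t
    by (rule order_trans[OF norm_power_scaleR_le C])
  then show "\<exists>B. \<forall>t. norm (t ^ j *\<^sub>R (vderiv ^^ k) (h p) t) \<le> B" by blast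
qed

lemma rapid_seminorm:
  assumes "rapid e h"
  shows "\<exists>C M. C \<ge> 0 \<and> (\<forall>p\<in>params. schwartz_seminorm j k (h p) \<le> C * fst p ^ e * weight p ^ M)"
proof -
  obtain C M where C: "C \<ge> 0" "\<And>p s. p \<in> params \<Longrightarrow>
      (1 + \<bar>s\<bar>) ^ j * norm ((vderiv ^^ k) (h p) s) \<le> C * fst p ^ e * weight p ^ M"
    using rapid_bound[OF assms] by metis
  have "schwartz_seminorm j k (h p) \<le> C * fst p ^ e * weight p ^ M" if "p \<in> params" for p
    by (rule schwartz_seminorm_least) (rule order_trans[OF norm_power_scaleR_le C(2)[OF that]])
  then show ?thesis using C(1) by blast
qed

lemma rapid_total_seminorm:
  assumes "rapid e h"
  obtains C M where "C \<ge> 0" "\<And>p. p \<in> params \<Longrightarrow> total_seminorm n (h p) \<le> C * fst p ^ e * weight p ^ M"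
proof -
  obtain C M where C: "\<And>j k. C j k \<ge> 0"
    "\<And>j k p. p \<in> params \<Longrightarrow> schwartz_seminorm j k (h p) \<le> C j k * fst p ^ e * weight p ^ M j k"
    using rapid_seminorm[OF assms] by metis
  define M' where "M' = (\<Sum>j\<le>n. \<Sum>k\<le>n. M j k)"
  define C' where "C' = (\<Sum>j\<le>n. \<Sum>k\<le>n. C j k)"
  have M': "M j k \<le> M'" if "j \<le> n" "k \<le> n" for j k
  proof -
    have "M j k \<le> (\<Sum>k\<le>n. M j k)" using that by (intro member_le_sum) auto
    also have "\<dots> \<le> M'" unfolding M'_def using that by (intro member_le_sum[of j "{..n}" "\<lambda>j. \<Sum>k\<le>n. M j k"]) auto
    finally show ?thesis .
  qed
  have "total_seminorm n (h p) \<le> C' * fst p ^ e * weight p ^ M'" if p: "p \<in> params" for p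
  proof -
    have "total_seminorm n (h p) \<le> (\<Sum>j\<le>n. \<Sum>k\<le>n. C j k * fst p ^ e * weight p ^ M')"
      unfolding total_seminorm_def
    proof (intro sum_mono)
      fix j k assume jk: "j \<in> {..n}" "k \<in> {..n}"
      have "C j k * fst p ^ e * weight p ^ M j k \<le> C j k * fst p ^ e * weight p ^ M'"
        using jk M' C(1)[of j k] weight_ge(1)[OF p] params_pos[OF p]
        by (intro mult_left_mono power_increasing) auto
      then show "schwartz_seminorm j k (h p) \<le> C j k * fst p ^ e * weight p ^ M'"
        using C(2)[OF p, of j k] by linarith
    qed
    also have "\<dots> = C' * fst p ^ e * weight p ^ M'"
      unfolding C'_def by (simp only: sum_distrib_right)
    finally show ?thesis .
  qed
  moreover have "C' \<ge> 0" unfolding C'_def by (intro sum_nonneg C(1))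
  ultimately show ?thesis using that by blast
qed

text \<open>One surplus power of \<open>1 + \<bar>s\<bar>\<close> makes the part outside
  \<open>{-R..R}\<close> small uniformly near \<open>p\<close>; inside, the derivatives are
  uniformly continuous on a compact set.\<close>

lemma rapid_seminorm_continuous:
  assumes "rapid e h" "p \<in> params"
  shows "((\<lambda>q. schwartz_seminorm j k (\<lambda>s. h q s - h p s)) \<longlongrightarrow> 0) (at p within params)"
proof (rule tendstoI)
  fix \<delta> :: real assume "\<delta> > 0"
  define D where "D q s = (vderiv ^^ k) (h q) s" for q s
  obtain C M where C: "C \<ge> 0" "\<And>q s. q \<in> params \<Longrightarrow>
      (1 + \<bar>s\<bar>) ^ Suc j * norm (D q s) \<le> C * fst q ^ e * weight q ^ M"
    using rapid_bound[OF assms(1)] unfolding D_def by metis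
  define b where "b q = C * fst q ^ e * weight q ^ M" for q
  have "continuous_on params b"
    unfolding b_def by (intro continuous_intros continuous_on_weight)
  then have "(b \<longlongrightarrow> b p) (at p within params)" using assms(2) by (simp add: continuous_on_def)
  then have ev1: "\<forall>\<^sub>F q in at p within params. b q < b p + 1" by (rule order_tendstoD) simp
  have "b p \<ge> 0" unfolding b_def using C(1) weight_ge(1)[OF assms(2)] params_pos[OF assms(2)] by simp
  \<comment> \<open>Near \<open>p\<close> the surplus power bounds the tail by
    \<open>(2 * b p + 1) / R\<close>, which equals \<open>\<delta> / 2\<close>; below,
    \<open>\<eta>\<close> is set to give the same value on the compact part.\<close>
  define R where "R = (2 * b p + 1) * (2 / \<delta>)"
  have "R > 0" using \<open>b p \<ge> 0\<close> \<open>\<delta> > 0\<close> by (simp add: R_def)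
  obtain r where r: "r > 0" "cball p r \<subseteq> params"
    using open_params assms(2) open_contains_cball by blast
  define \<eta> where "\<eta> = \<delta> / (2 * (1 + R) ^ j)"
  have "\<eta> > 0" using \<open>\<delta> > 0\<close> \<open>R > 0\<close> by (simp add: \<eta>_def)
  have "level_bound e 0 (\<lambda>p. (vderiv ^^ k) (h p))"
    using assms controlled_iter[of k e 0 h k] unfolding rapid_def by simp
  then have "continuous_on (params \<times> UNIV) (\<lambda>(q, s). D q s)"
    unfolding level_bound_def D_def by blast
  then have "continuous_on (cball p r \<times> {-R..R}) (\<lambda>(q, s). D q s)"
    by (rule continuous_on_subset) (use r in auto)
  moreover have "compact (cball p r \<times> {-R..R})" by (intro compact_Times) auto
  ultimately have "uniformly_continuous_on (cball p r \<times> {-R..R}) (\<lambda>(q, s). D q s)"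
    by (rule compact_uniformly_continuous)
  then obtain d where d: "d > 0" "\<And>z z'. z \<in> cball p r \<times> {-R..R} \<Longrightarrow> z' \<in> cball p r \<times> {-R..R} \<Longrightarrow>
      dist z' z < d \<Longrightarrow> dist ((\<lambda>(q, s). D q s) z') ((\<lambda>(q, s). D q s) z) < \<eta>"
    using \<open>\<eta> > 0\<close> unfolding uniformly_continuous_on_def by metis
  have near: "norm (D q s - D p s) < \<eta>" if "dist q p < d" "dist q p < r" "s \<in> {-R..R}" for q s
  proof -
    have "dist (D q s) (D p s) < \<eta>"
      using d(2)[of "(p, s)" "(q, s)"] that r(1) by (simp add: dist_Pair_Pair dist_commute)
    then show ?thesis by (simp add: dist_norm)
  qed
  have "\<forall>\<^sub>F q in at p within params. dist q p < min d r \<and> q \<in> params"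
    using d(1) r(1) by (auto simp: eventually_at intro!: exI[of _ "min d r"])
  with ev1 show "\<forall>\<^sub>F q in at p within params. dist (schwartz_seminorm j k (\<lambda>s. h q s - h p s)) 0 < \<delta>"
  proof eventually_elim
    fix q assume bq: "b q < b p + 1" and "dist q p < min d r \<and> q \<in> params"
    then have q: "dist q p < d" "dist q p < r" "q \<in> params" by auto
    note sch = rapid_schwartz[OF assms(1) q(3)] rapid_schwartz[OF assms]
    have "schwartz_seminorm j k (\<lambda>s. h q s - h p s) \<le> \<delta> / 2"
    proof (rule schwartz_seminorm_least)
      fix s
      have eq: "norm (s ^ j *\<^sub>R (vderiv ^^ k) (\<lambda>s. h q s - h p s) s) = \<bar>s\<bar> ^ j * norm (D q s - D p s)"
        unfolding vderiv_funpow_diff[OF sch] by (simp add: D_def power_abs)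
      also have "\<dots> \<le> (1 + \<bar>s\<bar>) ^ j * norm (D q s - D p s)"
        by (intro mult_right_mono power_mono) auto
      also have "\<dots> \<le> \<delta> / 2"
      proof (cases "s \<in> {-R..R}")
        case True
        have "(1 + \<bar>s\<bar>) ^ j * norm (D q s - D p s) \<le> (1 + R) ^ j * \<eta>"
          using near[OF q(1,2) True] True by (intro mult_mono power_mono) auto
        also have "\<dots> = \<delta> / 2" using \<open>R > 0\<close> by (simp add: \<eta>_def)
        finally show ?thesis .
      next
        case False
        then have "R \<le> 1 + \<bar>s\<bar>" by auto
        have "R * ((1 + \<bar>s\<bar>) ^ j * norm (D q s - D p s)) \<le> (1 + \<bar>s\<bar>) * ((1 + \<bar>s\<bar>) ^ j * norm (D q s - D p s))"
          using \<open>R \<le> 1 + \<bar>s\<bar>\<close> by (intro mult_right_mono) auto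
        also have "\<dots> = (1 + \<bar>s\<bar>) ^ Suc j * norm (D q s - D p s)" by simp
        also have "\<dots> \<le> (1 + \<bar>s\<bar>) ^ Suc j * (norm (D q s) + norm (D p s))"
          by (intro mult_left_mono norm_triangle_ineq4) auto
        also have "\<dots> \<le> b q + b p"
          using C(2)[OF q(3), of s] C(2)[OF assms(2), of s] unfolding b_def distrib_left by linarith
        also have "\<dots> \<le> 2 * b p + 1" using bq by simp
        also have "\<dots> = R * (\<delta> / 2)" using \<open>\<delta> > 0\<close> by (simp add: R_def)
        finally show ?thesis using \<open>R > 0\<close> by (simp only: mult_le_cancel_left_pos)
      qed
      finally show "norm (s ^ j *\<^sub>R (vderiv ^^ k) (\<lambda>s. h q s - h p s) s) \<le> \<delta> / 2" .
    qed
    moreover have "0 \<le> schwartz_seminorm j k (\<lambda>s. h q s - h p s)"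
      by (rule schwartz_seminorm_nonneg[OF schwartz_diff(1)[OF sch]])
    ultimately show "dist (schwartz_seminorm j k (\<lambda>s. h q s - h p s)) 0 < \<delta>"
      using \<open>\<delta> > 0\<close> by (simp add: dist_norm)
  qed
qed

text \<open>\<open>V\<close> is abstract because the lemma is applied to dilations of the extension
  on the Schwartz space and to \<open>u\<close> on the Lizorkin space.\<close>

lemma rapid_apply_continuous:
  assumes "rapid e h" "seminorm_bounded V n B T" "\<And>p. p \<in> params \<Longrightarrow> h p \<in> V"
    and V: "\<And>a. a \<in> V \<Longrightarrow> (\<lambda>x. - 1 * a x) \<in> V" "\<And>a b. a \<in> V \<Longrightarrow> b \<in> V \<Longrightarrow> (\<lambda>x. a x - b x) \<in> V"
  shows "continuous_on params (\<lambda>p. T (h p))"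
  unfolding continuous_on_def
proof
  fix p assume p: "p \<in> params"
  have "((\<lambda>q. total_seminorm n (\<lambda>s. h q s - h p s)) \<longlongrightarrow> 0) (at p within params)"
    unfolding total_seminorm_def by (intro tendsto_null_sum rapid_seminorm_continuous[OF assms(1) p])
  then have lim: "((\<lambda>q. B * total_seminorm n (\<lambda>s. h q s - h p s)) \<longlongrightarrow> 0) (at p within params)"
    by (rule tendsto_mult_right_zero)
  have "\<forall>\<^sub>F q in at p within params. norm (T (h q) - T (h p)) \<le> B * total_seminorm n (\<lambda>s. h q s - h p s)"
    unfolding eventually_at_filter
  proof (intro always_eventually allI impI)
    fix q assume "q \<in> params"
    then have "T (h q) - T (h p) = T (\<lambda>s. h q s - h p s)"
      by (rule seminorm_bounded_diff[OF assms(2) assms(3) assms(3)[OF p] V(1)[OF assms(3)[OF p]], symmetric])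
    moreover
    have "norm (T (\<lambda>s. h q s - h p s)) \<le> B * total_seminorm n (\<lambda>s. h q s - h p s)"
      by (rule seminorm_boundedD(4)[OF assms(2)], rule V(2)) (use assms(3) p \<open>q \<in> params\<close> in auto)
    ultimately show "norm (T (h q) - T (h p)) \<le> B * total_seminorm n (\<lambda>s. h q s - h p s)" by simp
  qed
  then have "((\<lambda>q. T (h q) - T (h p)) \<longlongrightarrow> 0) (at p within params)"
    by (rule Lim_null_comparison[OF _ lim])
  then show "((\<lambda>q. T (h q)) \<longlongrightarrow> T (h p)) (at p within params)"
    using LIM_zero_iff by blast
qed

section \<open>Taylor remainders of the chirp\<close>

definition exp_rem :: "nat \<Rightarrow> real \<Rightarrow> complex" where
  "exp_rem N y = exp (\<i> * of_real y) - (\<Sum>n<N. (\<i> * of_real y) ^ n / fact n)"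

lemma norm_exp_rem: "norm (exp_rem N y) \<le> \<bar>y\<bar> ^ N"
proof (cases N)
  case 0
  then show ?thesis by (simp add: exp_rem_def)
next
  case (Suc n)
  have "norm (exp_rem N y) \<le> \<bar>y\<bar> ^ Suc n / fact n"
    using Taylor_exp[of "\<i> * of_real y" n] unfolding Suc exp_rem_def lessThan_Suc_atMost
    by (simp add: norm_mult)
  also have "\<dots> \<le> \<bar>y\<bar> ^ Suc n / 1"
    by (intro divide_left_mono) (auto simp: fact_ge_1)
  finally show ?thesis unfolding Suc by simp
qed

text \<open>For \<open>N = 0\<close> the truncated subtraction is intended: \<open>exp_rem 0\<close> is the exponential.\<close>

lemma exp_rem_deriv:
  "(exp_rem N has_vector_derivative \<i> * exp_rem (N - 1) y) (at y)"
proof -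
  \<comment> \<open>The remainder is extended to complex \<open>z\<close>, differentiated by the
    rules for complex derivatives, and restricted to the real line again.\<close>
  define G where "G z = exp (\<i> * z) - (\<Sum>n<N. (\<i> * z) ^ n / fact n)" for z :: complex
  have "(G has_field_derivative \<i> * exp_rem (N - 1) y) (at (of_real y))"
  proof -
    have "(G has_field_derivative \<i> * exp (\<i> * of_real y) -
        (\<Sum>n<N. of_nat n * (\<i> * of_real y) ^ (n - 1) * \<i> / fact n)) (at (of_real y))"
      unfolding G_def
      by (rule DERIV_diff, (auto intro!: derivative_eq_intros)[1], rule DERIV_sum)
        (auto intro!: derivative_eq_intros)
    moreover have "(\<Sum>n<N. of_nat n * (\<i> * of_real y) ^ (n - 1) * \<i> / fact n) =
        \<i> * (\<Sum>n<N - 1. (\<i> * of_real y) ^ n / fact n :: complex)"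
    proof (cases N)
      case (Suc M)
      have "of_nat (Suc n) * (\<i> * of_real y) ^ n * \<i> / fact (Suc n) = \<i> * ((\<i> * of_real y) ^ n / fact n :: complex)" for n
        by (simp add: field_simps del: of_nat_Suc)
      then show ?thesis
        unfolding Suc sum.lessThan_Suc_shift by (simp add: sum_distrib_left del: of_nat_Suc fact_Suc)
    qed simp
    ultimately show ?thesis unfolding exp_rem_def by (simp add: right_diff_distrib)
  qed
  then have "((\<lambda>y. G (of_real y)) has_vector_derivative \<i> * exp_rem (N - 1) y) (at y)"
    by (rule has_vector_derivative_real_field)
  moreover have "(\<lambda>y. G (of_real y)) = exp_rem N"
    unfolding G_def exp_rem_def by auto
  ultimately show ?thesis by simp
qed

lemma continuous_exp_rem: "continuous_on UNIV (exp_rem N)"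
  unfolding exp_rem_def by (intro continuous_intros) auto

text \<open>With \<open>a = c1 / 2\<close> and \<open>b = - c2\<close> this is the \<open>q\<close>
  of the overview. Its value is the same for all \<epsilon>, so the Taylor coefficients give one
  fixed set of Lizorkin functions for each point of \<open>Y\<close>.\<close>

definition phase :: "real \<Rightarrow> real \<Rightarrow> real \<times> real \<times> real \<Rightarrow> real \<Rightarrow> real" where
  "phase a b p s = a * s\<^sup>2 + b * snd (snd p) * s"

lemma phase_bound:
  assumes "p \<in> params"
  shows "\<bar>phase a b p s\<bar> \<le> (\<bar>a\<bar> + \<bar>b\<bar>) * weight p * (1 + \<bar>s\<bar>)\<^sup>2"
proof -
  note w = weight_ge[OF assms]
  have s: "s\<^sup>2 \<le> (1 + \<bar>s\<bar>)\<^sup>2" "\<bar>s\<bar> \<le> (1 + \<bar>s\<bar>)\<^sup>2"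
    by (auto simp: power2_eq_square algebra_simps)
  have "\<bar>a * s\<^sup>2\<bar> \<le> \<bar>a\<bar> * (weight p * (1 + \<bar>s\<bar>)\<^sup>2)"
    using mult_mono[of 1 "weight p" "s\<^sup>2" "(1 + \<bar>s\<bar>)\<^sup>2"] w s by (simp add: abs_mult mult_left_mono)
  moreover have "\<bar>b * snd (snd p) * s\<bar> \<le> \<bar>b\<bar> * (weight p * (1 + \<bar>s\<bar>)\<^sup>2)"
    using mult_mono[of "\<bar>snd (snd p)\<bar>" "weight p" "\<bar>s\<bar>" "(1 + \<bar>s\<bar>)\<^sup>2"] w s
    by (simp add: abs_mult mult_left_mono mult.assoc)
  ultimately show ?thesis
    unfolding phase_def using abs_triangle_ineq[of "a * s\<^sup>2" "b * snd (snd p) * s"]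
    by (simp add: algebra_simps)
qed

lemma controlled_linear:
  assumes "continuous_on params a" "continuous_on params b"
    and "\<And>p. p \<in> params \<Longrightarrow> norm (a p) \<le> A * fst p ^ e * weight p ^ M" "A \<ge> 0"
    and "\<And>p. p \<in> params \<Longrightarrow> norm (b p) \<le> B * fst p ^ e * weight p ^ M'" "B \<ge> 0"
  shows "controlled K e 1 (\<lambda>p s. a p * of_real s + b p)"
  using controlled_mult[OF controlled_const[OF assms(1,4,3)] controlled_id, where K = K]
    controlled_mono[OF controlled_const[OF assms(2,6,5)], of e 1 K]
  by (auto intro: controlled_add)

lemma exp_rem_phase_deriv:
  "((\<lambda>s. exp_rem N ((fst p)\<^sup>2 * phase a b p s)) has_vector_derivative
    (\<i> * of_real (2 * a * (fst p)\<^sup>2) * of_real s + \<i> * of_real (b * (fst p)\<^sup>2 * snd (snd p)))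
      * exp_rem (N - 1) ((fst p)\<^sup>2 * phase a b p s)) (at s)"
proof -
  have "((\<lambda>s. (fst p)\<^sup>2 * phase a b p s) has_vector_derivative
      (fst p)\<^sup>2 * (2 * a * s + b * snd (snd p))) (at s)"
    unfolding has_real_derivative_iff_has_vector_derivative[symmetric] phase_def
    by (auto intro!: derivative_eq_intros simp: algebra_simps)
  from vector_diff_chain_at[OF this exp_rem_deriv]
  show ?thesis by (simp add: o_def scaleR_conv_of_real algebra_simps)
qed

lemma level_bound_exp_rem:
  "level_bound (2 * N) (int (2 * N)) (\<lambda>p s. exp_rem N ((fst p)\<^sup>2 * phase a b p s))"
proof (rule level_boundI[where C = "(\<bar>a\<bar> + \<bar>b\<bar>) ^ N" and M = N])
  show "(\<lambda>s. exp_rem N ((fst p)\<^sup>2 * phase a b p s)) differentiable (at s)" for p s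
    by (rule differentiableI_vector[OF exp_rem_phase_deriv])
  show "continuous_on (params \<times> UNIV) (\<lambda>(p, s). exp_rem N ((fst p)\<^sup>2 * phase a b p s))"
    unfolding case_prod_beta phase_def
    by (rule continuous_on_compose2[OF continuous_exp_rem]) (auto intro!: continuous_intros)
  fix p :: "real \<times> real \<times> real" and s :: real
  assume p: "p \<in> params"
  have "norm (exp_rem N ((fst p)\<^sup>2 * phase a b p s)) \<le> \<bar>(fst p)\<^sup>2 * phase a b p s\<bar> ^ N"
    by (rule norm_exp_rem)
  also have "\<dots> \<le> ((fst p)\<^sup>2 * ((\<bar>a\<bar> + \<bar>b\<bar>) * weight p * (1 + \<bar>s\<bar>)\<^sup>2)) ^ N"
    unfolding abs_mult using phase_bound[OF p, of a b s]
    by (intro power_mono) (auto intro: mult_left_mono)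
  also have "\<dots> = (\<bar>a\<bar> + \<bar>b\<bar>) ^ N * fst p ^ (2 * N) * weight p ^ N * (1 + \<bar>s\<bar>) powi int (2 * N)"
    unfolding power_int_of_nat by (simp add: power_mult_distrib power_mult)
  finally show "norm (exp_rem N ((fst p)\<^sup>2 * phase a b p s)) \<le>
      (\<bar>a\<bar> + \<bar>b\<bar>) ^ N * fst p ^ (2 * N) * weight p ^ N * (1 + \<bar>s\<bar>) powi int (2 * N)" .
qed simp

text \<open>Differentiation lowers \<open>N\<close> by one and so loses
  \<open>\<epsilon>\<^sup>2\<close>, but the inner derivative carries a factor
  \<open>\<epsilon>\<^sup>2\<close>; the order \<open>2 * N\<close> thus survives in every
  derivative. Only the growth in \<open>s\<close> depends on \<open>K\<close>.\<close>

lemma controlled_exp_rem: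
  "\<exists>i. controlled K (2 * N) i (\<lambda>p s. exp_rem N ((fst p)\<^sup>2 * phase a b p s))"
proof (induction K arbitrary: N)
  case 0
  show ?case using level_bound_exp_rem by auto
next
  case (Suc K)
  obtain i where i: "controlled K (2 * (N - 1)) i (\<lambda>p s. exp_rem (N - 1) ((fst p)\<^sup>2 * phase a b p s))"
    using Suc.IH by blast
  have lin: "controlled K 2 1 (\<lambda>p s. \<i> * of_real (2 * a * (fst p)\<^sup>2) * of_real s
      + \<i> * of_real (b * (fst p)\<^sup>2 * snd (snd p)))"
  proof (rule controlled_linear[where A = "2 * \<bar>a\<bar>" and M = 0 and B = "\<bar>b\<bar>" and M' = 1])
    fix p assume p: "p \<in> params"
    show "norm (\<i> * of_real (2 * a * (fst p)\<^sup>2)) \<le> 2 * \<bar>a\<bar> * (fst p)\<^sup>2 * weight p ^ 0"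
      by (simp add: norm_mult norm_power abs_mult)
    show "norm (\<i> * of_real (b * (fst p)\<^sup>2 * snd (snd p))) \<le> \<bar>b\<bar> * (fst p)\<^sup>2 * weight p ^ 1"
      using weight_ge(4)[OF p] by (simp add: norm_mult norm_power abs_mult mult_left_mono)
  qed (auto intro!: continuous_intros)
  have "\<exists>i. controlled (Suc K) (2 * N) i (\<lambda>p s. exp_rem N ((fst p)\<^sup>2 * phase a b p s))"
  proof (intro exI, rule controlled_SucI)
    \<comment> \<open>The exponent \<open>2 * N\<close> is the growth of the remainder itself,
      \<open>1 + i\<close> that of its derivative.\<close>
    show "level_bound (2 * N) (max (int (2 * N)) (1 + i)) (\<lambda>p s. exp_rem N ((fst p)\<^sup>2 * phase a b p s))"
      by (rule level_bound_mono[OF level_bound_exp_rem]) auto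
    show "controlled K (2 * N) (max (int (2 * N)) (1 + i)) (\<lambda>p s.
      (\<i> * of_real (2 * a * (fst p)\<^sup>2) * of_real s + \<i> * of_real (b * (fst p)\<^sup>2 * snd (snd p)))
      * exp_rem (N - 1) ((fst p)\<^sup>2 * phase a b p s))"
      by (rule controlled_mono[OF controlled_mult[OF lin i]]) auto
  qed (rule exp_rem_phase_deriv)
  then show ?case .
qed

text \<open>A phase is the product of an affine function of \<open>s\<close> and \<open>s\<close>
  itself, so each factor raises the growth by 2.\<close>

lemma controlled_phase_power:
  "controlled K 0 (int (2 * n)) (\<lambda>p s. of_real (phase a b p s) ^ n)"
proof (induction n)
  case 0
  show ?case
    using controlled_const[of "\<lambda>_. 1" 1 0 0 K] by simp
next
  case (Suc n)
  have "controlled K 0 1 (\<lambda>p s. of_real a * of_real s + of_real (b * snd (snd p)))"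
  proof (rule controlled_linear[where A = "\<bar>a\<bar>" and M = 0 and B = "\<bar>b\<bar>" and M' = 1])
    fix p assume p: "p \<in> params"
    show "norm (complex_of_real (b * snd (snd p))) \<le> \<bar>b\<bar> * fst p ^ 0 * weight p ^ 1"
      using weight_ge(4)[OF p] by (simp add: norm_mult abs_mult mult_left_mono)
  qed (auto intro!: continuous_intros)
  from controlled_mult[OF controlled_mult[OF this controlled_id] Suc]
  show ?case
    by (simp add: phase_def algebra_simps power2_eq_square)
qed

section \<open>Regular functionals on test functions on \<open>Y\<close>\<close>

lemma schwartz_Y_differentiable:
  assumes "f \<in> schwartz_Y" "set ds \<subseteq> {partial_x, partial_xi}" "z \<in> Y"
  shows "foldr (\<lambda>d. d) ds f differentiable (at z)"
  using assms unfolding schwartz_Y_def smooth_Y_def by blast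

lemma schwartz_Y_continuous: "f \<in> schwartz_Y \<Longrightarrow> continuous_on Y f"
  using schwartz_Y_differentiable[of f "[]"]
  by (auto intro!: continuous_at_imp_continuous_on differentiable_imp_continuous_within)

text \<open>Equality on \<open>Y\<close> determines the partial derivatives on \<open>Y\<close>,
  since horizontal lines through \<open>Y\<close> stay in it and vertical ones meet it in an open
  set. This form can be iterated although nothing is known about the functions off
  \<open>Y\<close>.\<close>

lemma partial_diff:
  assumes "\<And>z. z \<in> Y \<Longrightarrow> A z = B z - C z"
    and "\<And>z. z \<in> Y \<Longrightarrow> B differentiable (at z)" "\<And>z. z \<in> Y \<Longrightarrow> C differentiable (at z)"
    and "d \<in> {partial_x, partial_xi}" "z \<in> Y"
  shows "d A z = d B z - d C z"
proof -
  obtain x \<xi> where z: "z = (x, \<xi>)" by force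
  have "\<xi> \<noteq> 0" using assms(5) unfolding z Y_def by auto
  have x: "((\<lambda>y. E (y, \<xi>)) has_vector_derivative partial_x E z) (at x)" if "E differentiable (at z)" for E
  proof -
    have "(E \<circ> (\<lambda>y. (y, \<xi>))) differentiable (at x)"
      using that unfolding z by (intro differentiable_chain_at differentiable_Pair) auto
    then show ?thesis unfolding z partial_x_def by (simp add: o_def vector_derivative_works)
  qed
  have xi: "((\<lambda>\<eta>. E (x, \<eta>)) has_vector_derivative partial_xi E z) (at \<xi>)" if "E differentiable (at z)" for E
  proof -
    have "(E \<circ> (\<lambda>\<eta>. (x, \<eta>))) differentiable (at \<xi>)"
      using that unfolding z by (intro differentiable_chain_at differentiable_Pair) auto
    then show ?thesis unfolding z partial_xi_def by (simp add: o_def vector_derivative_works)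
  qed
  have "((\<lambda>y. A (y, \<xi>)) has_vector_derivative partial_x B z - partial_x C z) (at x)"
    by (rule has_vector_derivative_transform_within_open
        [OF has_vector_derivative_diff[OF x[OF assms(2)[OF assms(5)]] x[OF assms(3)[OF assms(5)]]] open_UNIV UNIV_I])
      (use assms(1) \<open>\<xi> \<noteq> 0\<close> in \<open>auto simp: Y_def\<close>)
  moreover have "((\<lambda>\<eta>. A (x, \<eta>)) has_vector_derivative partial_xi B z - partial_xi C z) (at \<xi>)"
    by (rule has_vector_derivative_transform_within_open
        [OF has_vector_derivative_diff[OF xi[OF assms(2)[OF assms(5)]] xi[OF assms(3)[OF assms(5)]]],
          where S = "UNIV - {0}"])
      (use assms(1) \<open>\<xi> \<noteq> 0\<close> in \<open>auto simp: Y_def\<close>)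
  ultimately show ?thesis
    using assms(4) unfolding z partial_x_def partial_xi_def by (auto dest: vector_derivative_at)
qed

lemma foldr_partial_diff:
  assumes "f \<in> schwartz_Y" "g \<in> schwartz_Y" "set ds \<subseteq> {partial_x, partial_xi}" "z \<in> Y"
  shows "foldr (\<lambda>d. d) ds (\<lambda>z. f z - g z) z = foldr (\<lambda>d. d) ds f z - foldr (\<lambda>d. d) ds g z"
  using assms(3,4)
proof (induction ds arbitrary: z)
  case (Cons d ds)
  then have ds: "set ds \<subseteq> {partial_x, partial_xi}" "d \<in> {partial_x, partial_xi}" by auto
  show ?case
    using partial_diff[OF Cons.IH[OF ds(1)] schwartz_Y_differentiable[OF assms(1) ds(1)]
        schwartz_Y_differentiable[OF assms(2) ds(1)] ds(2) Cons.prems(2)]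
    by simp
qed simp

lemma schwartz_Y_weighted_bound:
  assumes "f \<in> schwartz_Y"
  shows "\<exists>B. \<forall>z\<in>Y. weighted_deriv_Y m l s r f z \<le> B"
proof -
  have "bdd_above (weighted_deriv_Y m l s r f ` Y)"
    using assms by (simp add: schwartz_Y_def)
  then show ?thesis unfolding bdd_above_def by auto
qed

lemma foldr_replicate_id: "foldr (\<lambda>d. d) (replicate l d) f = (d ^^ l) f"
  by (induction l) auto

lemma schwartz_Y_diff:
  assumes "f \<in> schwartz_Y" "g \<in> schwartz_Y"
  shows "(\<lambda>z. f z - g z) \<in> schwartz_Y"
proof -
  have "foldr (\<lambda>d. d) ds (\<lambda>z. f z - g z) differentiable (at z)"
    if "set ds \<subseteq> {partial_x, partial_xi}" "z \<in> Y" for ds z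
  proof -
    have "(\<lambda>z. foldr (\<lambda>d. d) ds f z - foldr (\<lambda>d. d) ds g z) differentiable (at z)"
      using schwartz_Y_differentiable[OF assms(1) that] schwartz_Y_differentiable[OF assms(2) that]
      by (rule differentiable_diff)
    then obtain D where "((\<lambda>z. foldr (\<lambda>d. d) ds f z - foldr (\<lambda>d. d) ds g z) has_derivative D) (at z)"
      unfolding differentiable_def by blast
    then have "(foldr (\<lambda>d. d) ds (\<lambda>z. f z - g z) has_derivative D) (at z)"
      by (rule has_derivative_transform_within_open[OF _ open_Y that(2)])
        (simp add: foldr_partial_diff[OF assms that(1)])
    then show ?thesis unfolding differentiable_def by blast
  qed
  moreover have "bdd_above (weighted_deriv_Y m l s r (\<lambda>z. f z - g z) ` Y)" for m l s r
  proof -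
    obtain B where B: "\<And>z. z \<in> Y \<Longrightarrow> weighted_deriv_Y m l s r f z \<le> B"
      using schwartz_Y_weighted_bound[OF assms(1), of m l s r] by blast
    obtain B' where B': "\<And>z. z \<in> Y \<Longrightarrow> weighted_deriv_Y m l s r g z \<le> B'"
      using schwartz_Y_weighted_bound[OF assms(2), of m l s r] by blast
    have "weighted_deriv_Y m l s r (\<lambda>z. f z - g z) z \<le> B + B'" if z: "z \<in> Y" for z
    proof -
      obtain x \<xi> where z': "z = (x, \<xi>)" by force
      let ?w = "\<bar>\<xi>\<bar> ^ s + inverse (\<bar>\<xi>\<bar> ^ s)"
      let ?d = "\<lambda>f. (partial_xi ^^ l) ((partial_x ^^ m) f) z"
      have "?d (\<lambda>z. f z - g z) = ?d f - ?d g"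
        using foldr_partial_diff[OF assms _ z, of "replicate l partial_xi @ replicate m partial_x"]
        unfolding foldr_append foldr_replicate_id by (simp add: set_replicate_conv_if)
      then have "norm (x ^ r *\<^sub>R ?d (\<lambda>z. f z - g z)) \<le> norm (x ^ r *\<^sub>R ?d f) + norm (x ^ r *\<^sub>R ?d g)"
        using norm_triangle_ineq4[of "x ^ r *\<^sub>R ?d f" "x ^ r *\<^sub>R ?d g"]
        by (simp only: scaleR_diff_right)
      then have "?w * norm (x ^ r *\<^sub>R ?d (\<lambda>z. f z - g z))
          \<le> ?w * (norm (x ^ r *\<^sub>R ?d f) + norm (x ^ r *\<^sub>R ?d g))"
        by (intro mult_left_mono) auto
      then show ?thesis
        using B[OF z] B'[OF z] unfolding weighted_deriv_Y_def z' case_prod_conv distrib_left by linarith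
    qed
    then show ?thesis unfolding bdd_above_def by blast
  qed
  ultimately show ?thesis unfolding schwartz_Y_def smooth_Y_def by blast
qed

lemma partial_zero: "(partial_xi ^^ l) ((partial_x ^^ m) (\<lambda>_. 0)) = (\<lambda>_. 0)"
proof -
  have "(partial_x ^^ m) (\<lambda>_. 0) = (\<lambda>_. 0)"
    by (induction m) (auto simp: partial_x_def)
  moreover have "(partial_xi ^^ l) (\<lambda>_. 0) = (\<lambda>_. 0)"
    by (induction l) (auto simp: partial_xi_def)
  ultimately show ?thesis by simp
qed

lemma Y_nonempty: "Y \<noteq> {}"
  by (auto simp: Y_def)

lemma schwartz_Y_seminorm_zero: "schwartz_Y_seminorm m l s r (\<lambda>_. 0) = 0"
  unfolding schwartz_Y_seminorm_def weighted_deriv_Y_def partial_zero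
  by (simp add: case_prod_beta Y_nonempty)

lemma schwartz_Y_seminorm_upper:
  assumes "f \<in> schwartz_Y" "(x, \<xi>) \<in> Y"
  shows "(\<bar>\<xi>\<bar> ^ s + inverse (\<bar>\<xi>\<bar> ^ s)) * (\<bar>x\<bar> ^ r * norm (f (x, \<xi>))) \<le> schwartz_Y_seminorm 0 0 s r f"
proof -
  have "weighted_deriv_Y 0 0 s r f (x, \<xi>) \<le> schwartz_Y_seminorm 0 0 s r f"
    unfolding schwartz_Y_seminorm_def using assms
    by (intro cSUP_upper) (auto simp: schwartz_Y_def)
  then show ?thesis by (simp add: weighted_deriv_Y_def power_abs)
qed

lemma schwartz_Y_seminorm_nonneg: "f \<in> schwartz_Y \<Longrightarrow> 0 \<le> schwartz_Y_seminorm 0 0 s r f"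
  by (rule order_trans[OF _ schwartz_Y_seminorm_upper[of f 0 1]]) (auto simp: Y_def)

text \<open>\<open>2 ^ M\<close> comes from bounding the weight by a product,
  \<open>4 ^ (M + 2)\<close> from splitting two powers of sums. The two surplus powers produce the
  integrable factor \<open>majorant\<close>.\<close>

definition majorant_const :: "nat \<Rightarrow> (real \<times> real \<Rightarrow> complex) \<Rightarrow> real" where
  "majorant_const M f = 2 ^ M * 4 ^ (M + 2) *
    (schwartz_Y_seminorm 0 0 (M + 2) 0 f + schwartz_Y_seminorm 0 0 (M + 2) (M + 2) f)"

definition majorant :: "real \<times> real \<Rightarrow> real" where
  "majorant z = 1 / ((1 + (fst z)\<^sup>2) * (1 + (snd z)\<^sup>2))"

text \<open>The quantity \<open>w = t + 1 / t\<close> with \<open>t = \<bar>\<xi>\<bar>\<close> is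
  at least 2 and dominates both ends of the \<xi>-axis: the weight is at most
  \<open>2 * (1 + \<bar>x\<bar>) * w\<close>, and \<open>1 + \<xi>\<^sup>2 = t * w\<close>. Powers
  of \<open>w\<close> are controlled by the factor \<open>t ^ n + inverse (t ^ n)\<close> of the
  seminorms.\<close>

lemma schwartz_Y_decay:
  assumes "f \<in> schwartz_Y" "z \<in> Y"
  shows "weight (1, z) ^ M * norm (f z) \<le> majorant_const M f * majorant z"
proof -
  obtain x \<xi> where z: "z = (x, \<xi>)" by force
  define t where "t = \<bar>\<xi>\<bar>"
  have t: "t > 0" using assms(2) by (simp add: z t_def Y_def)
  define w where "w = t + 1 / t"
  define n where "n = M + 2"
  have "w \<ge> 2"
  proof -
    have "0 \<le> (t - 1)\<^sup>2 / t" using t by simp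
    also have "\<dots> = w - 2" unfolding w_def using t by (simp add: field_simps power2_eq_square)
    finally show ?thesis by simp
  qed
  have "t \<le> w" using t by (simp add: w_def)
  have "weight (1, z) \<le> 2 * (1 + \<bar>x\<bar>) * w"
  proof -
    have "weight (1, z) = 2 + \<bar>x\<bar> + w" by (simp add: weight_def z w_def t_def)
    also have "\<dots> \<le> w + \<bar>x\<bar> * w + w"
      using \<open>w \<ge> 2\<close> mult_left_mono[of 1 w "\<bar>x\<bar>"] by simp
    also have "\<dots> \<le> 2 * (1 + \<bar>x\<bar>) * w" using \<open>w \<ge> 2\<close> by (simp add: algebra_simps)
    finally show ?thesis .
  qed
  moreover have "weight (1, z) \<ge> 0" by (simp add: weight_def z)
  ultimately have "weight (1, z) ^ M \<le> (2 * (1 + \<bar>x\<bar>) * w) ^ M" by (intro power_mono)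
  moreover have "1 + x\<^sup>2 \<le> (1 + \<bar>x\<bar>)\<^sup>2" by (simp add: power2_eq_square algebra_simps)
  moreover have "1 + \<xi>\<^sup>2 \<le> w\<^sup>2"
  proof -
    have "1 + \<xi>\<^sup>2 = t * w" using t by (simp add: w_def t_def power2_eq_square field_simps)
    also have "\<dots> \<le> w * w" using \<open>t \<le> w\<close> \<open>w \<ge> 2\<close> by (intro mult_right_mono) auto
    finally show ?thesis by (simp add: power2_eq_square)
  qed
  ultimately have "weight (1, z) ^ M * ((1 + x\<^sup>2) * (1 + \<xi>\<^sup>2))
      \<le> (2 * (1 + \<bar>x\<bar>) * w) ^ M * ((1 + \<bar>x\<bar>)\<^sup>2 * w\<^sup>2)"
    using \<open>w \<ge> 2\<close> by (intro mult_mono) auto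
  also have "\<dots> = 2 ^ M * ((1 + \<bar>x\<bar>) ^ n * w ^ n)"
    unfolding n_def power_add power_mult_distrib by (simp only: mult_ac)
  also have "\<dots> \<le> 2 ^ M * ((2 ^ n * (1 + \<bar>x\<bar> ^ n)) * (2 ^ n * (t ^ n + inverse (t ^ n))))"
  proof (intro mult_left_mono mult_mono)
    show "(1 + \<bar>x\<bar>) ^ n \<le> 2 ^ n * (1 + \<bar>x\<bar> ^ n)"
      using power_add_le[of 1 "\<bar>x\<bar>" n] by simp
    show "w ^ n \<le> 2 ^ n * (t ^ n + inverse (t ^ n))"
      using power_add_le[of t "1 / t" n] t by (simp add: w_def power_one_over inverse_eq_divide)
  qed (use \<open>w \<ge> 2\<close> in auto)
  also have "\<dots> = 2 ^ M * 4 ^ n * ((1 + \<bar>x\<bar> ^ n) * (t ^ n + inverse (t ^ n)))"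
    by (simp add: power_mult_distrib[symmetric] mult_ac)
  finally have "weight (1, z) ^ M * ((1 + x\<^sup>2) * (1 + \<xi>\<^sup>2)) * norm (f z)
      \<le> 2 ^ M * 4 ^ n * ((1 + \<bar>x\<bar> ^ n) * (t ^ n + inverse (t ^ n))) * norm (f z)"
    by (rule mult_right_mono) simp
  also have "\<dots> = 2 ^ M * 4 ^ n * ((t ^ n + inverse (t ^ n)) * (\<bar>x\<bar> ^ 0 * norm (f z))
      + (t ^ n + inverse (t ^ n)) * (\<bar>x\<bar> ^ n * norm (f z)))"
    by (simp add: algebra_simps)
  also have "\<dots> \<le> 2 ^ M * 4 ^ n * (schwartz_Y_seminorm 0 0 n 0 f + schwartz_Y_seminorm 0 0 n n f)"
    unfolding t_def z
    by (intro mult_left_mono add_mono schwartz_Y_seminorm_upper[OF assms(1) assms(2)[unfolded z]]) simp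
  finally have "weight (1, z) ^ M * norm (f z) * ((1 + x\<^sup>2) * (1 + \<xi>\<^sup>2)) \<le>
      2 ^ M * 4 ^ n * (schwartz_Y_seminorm 0 0 n 0 f + schwartz_Y_seminorm 0 0 n n f)"
    by (simp only: mult_ac)
  moreover have "(1 + x\<^sup>2) * (1 + \<xi>\<^sup>2) > 0"
    by (intro mult_pos_pos add_pos_nonneg) auto
  ultimately show ?thesis
    unfolding majorant_const_def majorant_def n_def[symmetric] z fst_conv snd_conv
    by (simp add: pos_le_divide_eq)
qed

lemma integrable_majorant: "integrable lborel majorant"
proof -
  have "integrable (lborel \<Otimes>\<^sub>M lborel) (\<lambda>z::real \<times> real. 1 / ((1 + (fst z)\<^sup>2) * (1 + (snd z)\<^sup>2)))"
  proof (rule lborel_pair.Fubini_integrable)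
    have n: "norm (1 / ((1 + x\<^sup>2) * (1 + y\<^sup>2))) = (1 / (1 + x\<^sup>2)) * (1 / (1 + y\<^sup>2))" for x y :: real
      by (simp add: abs_mult add_nonneg_nonneg)
    show "integrable lborel (\<lambda>x::real. LBINT y. norm (1 / ((1 + (fst (x, y))\<^sup>2) * (1 + (snd (x, y :: real))\<^sup>2))))"
    proof -
      have "(LBINT y. norm (1 / ((1 + (fst (x, y))\<^sup>2) * (1 + (snd (x, y))\<^sup>2))))
          = (1 / (1 + x\<^sup>2)) * (LBINT y. 1 / (1 + y\<^sup>2))" for x :: real
        by (simp only: fst_conv snd_conv n integral_mult_right_zero)
      then show ?thesis by (simp only: integrable_mult_left integrable_inverse_square)
    qed
    show "AE x in lborel. integrable lborel (\<lambda>y. 1 / ((1 + (fst (x, y))\<^sup>2) * (1 + (snd (x::real, y::real))\<^sup>2)))"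
    proof (rule AE_I2)
      fix x :: real
      have "(\<lambda>y. 1 / ((1 + (fst (x, y))\<^sup>2) * (1 + (snd (x, y))\<^sup>2))) = (\<lambda>y. (1 / (1 + x\<^sup>2)) * (1 / (1 + y\<^sup>2)))"
        by simp
      then show "integrable lborel (\<lambda>y. 1 / ((1 + (fst (x, y))\<^sup>2) * (1 + (snd (x, y :: real))\<^sup>2)))"
        by (simp only: integrable_mult_right integrable_inverse_square)
    qed
  qed measurable
  then show ?thesis by (simp add: lborel_prod majorant_def[abs_def])
qed

lemma dominated_product:
  assumes "f \<in> schwartz_Y" "C \<ge> 0" "\<And>z. z \<in> Y \<Longrightarrow> norm (F z) \<le> C * weight (1, z) ^ M"
  shows "norm (indicator Y z *\<^sub>R (F z * f z)) \<le> C * (majorant_const M f * majorant z)"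
proof (cases "z \<in> Y")
  case True
  have "norm (F z * f z) \<le> C * weight (1, z) ^ M * norm (f z)"
    unfolding norm_mult using assms(3)[OF True] by (rule mult_right_mono) simp
  also have "\<dots> \<le> C * (majorant_const M f * majorant z)"
    unfolding mult.assoc[of C] using schwartz_Y_decay[OF assms(1) True] assms(2) by (rule mult_left_mono)
  finally show ?thesis using True by simp
next
  case False
  have "majorant z \<ge> 0" "majorant_const M f \<ge> 0"
    unfolding majorant_def majorant_const_def using schwartz_Y_seminorm_nonneg[OF assms(1)]
    by (simp_all add: add_nonneg_nonneg)
  then show ?thesis using False assms(2) by simp
qed

lemma product_measurable:
  assumes "f \<in> schwartz_Y" "continuous_on Y F"
  shows "(\<lambda>z. indicator Y z *\<^sub>R (F z * f z)) \<in> borel_measurable lborel"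
  using borel_measurable_continuous_on_indicator[OF borel_open[OF open_Y]
      continuous_on_mult[OF assms(2) schwartz_Y_continuous[OF assms(1)]]]
  by simp

lemma regular_dual_YI:
  assumes "continuous_on Y F" "C \<ge> 0" "\<And>z. z \<in> Y \<Longrightarrow> norm (F z) \<le> C * weight (1, z) ^ M"
  shows "regular_dual_Y F"
proof -
  let ?p = "schwartz_Y_seminorm 0 0 (M + 2)"
  define K :: real where "K = 2 ^ M * 4 ^ (M + 2)"
  note bnd = dominated_product[OF _ assms(2,3)]
  have intD: "integrable lborel (\<lambda>z. C * (majorant_const M f * majorant z))" for f
    by (intro integrable_mult_right integrable_majorant)
  have int: "integrable lborel (\<lambda>z. indicator Y z *\<^sub>R (F z * f z))" if "f \<in> schwartz_Y" for f
  proof (rule Bochner_Integration.integrable_bound[OF intD product_measurable[OF that assms(1)]], rule AE_I2)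
    fix z
    show "norm (indicator Y z *\<^sub>R (F z * f z)) \<le> norm (C * (majorant_const M f * majorant z))"
      using bnd[OF that, of z] abs_ge_self[of "C * (majorant_const M f * majorant z)"]
      unfolding real_norm_def by (rule order_trans)
  qed
  let ?P = "{schwartz_Y_seminorm m l s r | m l s r. True}"
  have top: "topspace (seminorm_topology schwartz_Y ?P) = schwartz_Y"
    by (rule topspace_seminorm_topology[of "schwartz_Y_seminorm 0 0 0 0"]) (auto simp: schwartz_Y_seminorm_zero)
  define I where "I = (LINT z|lborel. majorant z)"
  have "I \<ge> 0" unfolding I_def by (rule integral_nonneg_AE) (auto simp: majorant_def add_nonneg_nonneg)
  \<comment> \<open>Each of the two seminorms is later bounded by the whole sum over
    \<open>F0\<close>, whence the factor 2; this avoids having to know that they are different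
    elements of the set.\<close>
  define F0 where "F0 = {?p 0, ?p (M + 2)}"
  have "regular_functional F \<in> dual (seminorm_topology schwartz_Y ?P)"
  proof (rule dual_seminorm_topologyI[OF top, of F0 "2 * C * K * I"])
    show "0 \<le> 2 * C * K * I" using assms(2) \<open>I \<ge> 0\<close> by (simp add: K_def)
    fix f assume f: "f \<in> schwartz_Y"
    note nn = schwartz_Y_seminorm_nonneg[OF f]
    have "norm (regular_functional F f) \<le> (LINT z|lborel. C * (majorant_const M f * majorant z))"
      unfolding regular_functional_def set_lebesgue_integral_def
      by (rule Bochner_Integration.integral_norm_bound_integral[OF int[OF f] intD bnd[OF f]])
    also have "\<dots> = C * (majorant_const M f * I)" unfolding I_def by (simp only: integral_mult_right_zero)
    also have "\<dots> \<le> C * (K * (2 * (\<Sum>p\<in>F0. p f)) * I)"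
      unfolding majorant_const_def K_def[symmetric]
    proof (intro mult_left_mono mult_right_mono)
      have "?p 0 f \<le> (\<Sum>p\<in>F0. p f)"
        by (rule member_le_sum[of _ F0 "\<lambda>p. p f"]) (use nn in \<open>auto simp: F0_def\<close>)
      moreover have "?p (M + 2) f \<le> (\<Sum>p\<in>F0. p f)"
        by (rule member_le_sum[of _ F0 "\<lambda>p. p f"]) (use nn in \<open>auto simp: F0_def\<close>)
      ultimately show "?p 0 f + ?p (M + 2) f
          \<le> 2 * (\<Sum>p\<in>F0. p f)" by linarith
    qed (use assms(2) \<open>I \<ge> 0\<close> in \<open>auto simp: K_def\<close>)
    finally show "norm (regular_functional F f) \<le> 2 * C * K * I * (\<Sum>p\<in>F0. p f)"
      by (simp only: mult_ac)
    show "regular_functional F (\<lambda>z. c * f z) = c * regular_functional F f" for c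
      unfolding regular_functional_def set_lebesgue_integral_def
      by (subst integral_mult_right_zero[symmetric]) (simp add: mult_ac)
    fix g assume g: "g \<in> schwartz_Y"
    show "(\<lambda>z. f z - g z) \<in> schwartz_Y" by (rule schwartz_Y_diff[OF f g])
    show "regular_functional F (\<lambda>z. f z + g z) = regular_functional F f + regular_functional F g"
      unfolding regular_functional_def set_lebesgue_integral_def
      by (subst Bochner_Integration.integral_add[OF int[OF f] int[OF g], symmetric])
        (simp add: distrib_left scaleR_add_right)
  qed (auto simp: F0_def schwartz_Y_seminorm_zero)
  then show ?thesis
    unfolding regular_dual_Y_def schwartz_Y_topology_def set_integrable_def using int by blast
qed

lemma regular_functional_convergence:
  fixes F :: "nat \<Rightarrow> real \<times> real \<Rightarrow> complex"
  assumes "\<And>i. continuous_on Y (F i)" "continuous_on Y G" "C \<ge> 0"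
    and "\<And>i z. z \<in> Y \<Longrightarrow> norm (F i z) \<le> C * weight (1, z) ^ M"
    and "\<And>z. z \<in> Y \<Longrightarrow> (\<lambda>i. F i z) \<longlonglongrightarrow> G z" and "f \<in> schwartz_Y"
  shows "(\<lambda>i. regular_functional (F i) f) \<longlonglongrightarrow> regular_functional G f"
  unfolding regular_functional_def set_lebesgue_integral_def
proof (rule integral_dominated_convergence)
  show "integrable lborel (\<lambda>z. C * (majorant_const M f * majorant z))"
    by (intro integrable_mult_right integrable_majorant)
  have "(\<lambda>i. indicator Y z *\<^sub>R (F i z * f z)) \<longlonglongrightarrow> indicator Y z *\<^sub>R (G z * f z)" for z
    using assms(5)[of z] by (cases "z \<in> Y") (auto intro: tendsto_mult_right)
  then show "AE z in lborel. (\<lambda>i. indicator Y z *\<^sub>R (F i z * f z)) \<longlonglongrightarrow> indicator Y z *\<^sub>R (G z * f z)"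
    by simp
  show "AE z in lborel. norm (indicator Y z *\<^sub>R (F i z * f z)) \<le> C * (majorant_const M f * majorant z)" for i
    by (rule AE_I2, rule dominated_product[OF assms(6,3,4)])
qed (rule product_measurable[OF assms(6) assms(1)] product_measurable[OF assms(6) assms(2)])+

section \<open>Dilations and homogeneity\<close>

text \<open>The order \<open>n\<close> is kept and the loss is an explicit power of \<open>r\<close>
  and \<open>1 / r\<close>; the last division by \<open>r\<close> is the Jacobian in
  \<open>dilate\<close>.\<close>

lemma seminorm_bounded_dilate:
  assumes T: "seminorm_bounded V n C T" and "V \<subseteq> schwartz" "r > 0"
    and V: "\<And>a. a \<in> V \<Longrightarrow> (\<lambda>x. a (x / r)) \<in> V"
  shows "seminorm_bounded V n (C * ((1 + r) ^ n * (1 + 1 / r) ^ n) / r) (dilate r T)"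
  unfolding seminorm_bounded_def
proof (intro conjI ballI allI)
  note T' = seminorm_boundedD[OF T]
  show "0 \<le> C * ((1 + r) ^ n * (1 + 1 / r) ^ n) / r" using T'(3) assms(3) by simp
  fix a assume a: "a \<in> V"
  show "dilate r T (\<lambda>x. c * a x) = c * dilate r T a" for c
    unfolding dilate_def using T'(2)[OF V[OF a], of c] by simp
  show "dilate r T (\<lambda>x. a x + b x) = dilate r T a + dilate r T b" if "b \<in> V" for b
    unfolding dilate_def using T'(1)[OF V[OF a] V[OF that]] by (simp add: add_divide_distrib)
  have "norm (T (\<lambda>x. a (x / r))) \<le> C * total_seminorm n (\<lambda>x. a (x / r))"
    by (rule T'(4)[OF V[OF a]])
  also have "\<dots> \<le> C * ((1 + r) ^ n * (1 + 1 / r) ^ n * total_seminorm n a)"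
    using T'(3) a assms(2,3) by (intro mult_left_mono total_seminorm_dilate) auto
  finally have "norm (T (\<lambda>x. a (x / r))) / r \<le> C * ((1 + r) ^ n * (1 + 1 / r) ^ n * total_seminorm n a) / r"
    using assms(3) by (intro divide_right_mono) auto
  then show "norm (dilate r T a) \<le> C * ((1 + r) ^ n * (1 + 1 / r) ^ n) / r * total_seminorm n a"
    unfolding dilate_def using assms(3) by (simp add: norm_divide)
qed

lemma seminorm_bounded_dilate_schwartz:
  assumes "seminorm_bounded schwartz n C T" "r > 0"
  shows "seminorm_bounded schwartz n (C * ((1 + r) ^ n * (1 + 1 / r) ^ n) / r) (dilate r T)"
  using schwartz_affine[of _ "1 / r" 0] assms(2)
  by (intro seminorm_bounded_dilate[OF assms(1) subset_refl assms(2)]) auto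

lemma seminorm_bounded_divide:
  assumes "seminorm_bounded V n C T"
  shows "seminorm_bounded V n (C * norm (inverse c)) (\<lambda>h. T h / c)"
  unfolding seminorm_bounded_def
proof (intro conjI ballI allI)
  note T = seminorm_boundedD[OF assms]
  show "0 \<le> C * norm (inverse c)" using T(3) by simp
  fix a assume a: "a \<in> V"
  show "T (\<lambda>x. d * a x) / c = d * (T a / c)" for d using T(2)[OF a, of d] by simp
  show "T (\<lambda>x. a x + b x) / c = T a / c + T b / c" if "b \<in> V" for b
    using T(1)[OF a that] by (simp add: add_divide_distrib)
  have "norm (T a) * norm (inverse c) \<le> C * total_seminorm n a * norm (inverse c)"
    by (rule mult_right_mono[OF T(4)[OF a]]) simp
  then show "norm (T a / c) \<le> C * norm (inverse c) * total_seminorm n a"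
    unfolding divide_inverse norm_mult by (simp only: mult_ac)
qed

lemma filterlim_mult_at_right_0:
  assumes "a > (0::real)"
  shows "filterlim (\<lambda>r. a * r) (at_right 0) (at_right 0)"
proof (rule tendsto_imp_filterlim_at_right)
  have "((\<lambda>r. a * r) \<longlongrightarrow> a * 0) (at_right 0)" by (intro tendsto_intros)
  then show "((\<lambda>r. a * r) \<longlongrightarrow> 0) (at_right 0)" by simp
  show "\<forall>\<^sub>F r in at_right 0. 0 < a * r"
    using eventually_at_right_less[of "0::real"] by eventually_elim (use assms in simp)
qed

text \<open>The limit is computed along \<open>r\<close> and along \<open>a * r\<close>, and slow
  variation removes the quotient of the values of \<open>L\<close>. The exponent is
  \<open>m + 1\<close> because the Jacobian of the dilation contributes one power of
  \<open>a\<close>.\<close>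

lemma quasiasymptotic_homogeneous:
  assumes L: "slowly_varying_at_0 L" and q: "quasiasymptotic f m L u"
    and h: "h \<in> lizorkin" and a: "a > 0"
  shows "u (\<lambda>x. h (x / a)) = of_real (a powr (m + 1)) * u h"
proof -
  obtain d where d: "d > 0" "\<And>r. 0 < r \<Longrightarrow> r \<le> d \<Longrightarrow> L r > 0"
    using slowly_varying_lower_bound[OF L] by metis
  define Q where "Q r h = dilate r f h / of_real (r powr m * L r)" for r h
  have Q: "((\<lambda>r. Q r h) \<longlongrightarrow> u h) (at_right 0)" if "h \<in> lizorkin" for h
    using q that unfolding quasiasymptotic_def Q_def by blast
  have "((\<lambda>r. Q (a * r) h) \<longlongrightarrow> u h) (at_right 0)"
    by (rule filterlim_compose[OF Q[OF h] filterlim_mult_at_right_0[OF a]])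
  moreover have "((\<lambda>r. L (a * r) / L r) \<longlongrightarrow> 1) (at_right 0)"
    using L a unfolding slowly_varying_at_0_def by blast
  ultimately have "((\<lambda>r. of_real (a powr (m + 1)) * of_real (L (a * r) / L r) * Q (a * r) h) \<longlongrightarrow>
      of_real (a powr (m + 1)) * of_real 1 * u h) (at_right 0)"
    by (intro tendsto_intros)
  moreover have "\<forall>\<^sub>F r in at_right 0. of_real (a powr (m + 1)) * of_real (L (a * r) / L r) * Q (a * r) h
      = Q r (\<lambda>x. h (x / a))"
  proof -
    have ev: "\<forall>\<^sub>F r in at_right 0. 0 < r \<and> r < min d (d / a)"
      unfolding eventually_at_right_field
      using d(1) a by (intro exI[of _ "min d (d / a)"]) auto
    then show ?thesis
    proof eventually_elim
      fix r assume "0 < r \<and> r < min d (d / a)"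
      then have r: "0 < r" "r \<le> d" "a * r \<le> d" using a by (auto simp: field_simps)
      have pos: "L r > 0" "L (a * r) > 0" using d(2) r a by auto
      have "dilate r f (\<lambda>x. h (x / a)) = of_real a * dilate (a * r) f h"
        unfolding dilate_def using r a by (simp add: mult.commute)
      then show "of_real (a powr (m + 1)) * of_real (L (a * r) / L r) * Q (a * r) h
          = Q r (\<lambda>x. h (x / a))"
        unfolding Q_def using r a pos by (simp add: powr_mult powr_add field_simps)
    qed
  qed
  ultimately have "((\<lambda>r. Q r (\<lambda>x. h (x / a))) \<longlongrightarrow> of_real (a powr (m + 1)) * of_real 1 * u h) (at_right 0)"
    using tendsto_cong by force
  then show ?thesis
    using tendsto_unique[OF trivial_limit_at_right_real Q[OF lizorkin_dilate[OF h]]] a by force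
qed

section \<open>The test functions paired with \<open>f\<close>\<close>

text \<open>For \<open>N = 0\<close> this is the test function of the rescaled transform, for larger
  \<open>N\<close> its Taylor remainder, so a single estimate serves both. The coefficient functions
  of the expansion are the \<open>phase_family\<close> below.\<close>

definition chirp_family :: "(real \<Rightarrow> complex) \<Rightarrow> real \<Rightarrow> real \<Rightarrow> nat \<Rightarrow> family" where
  "chirp_family g a b N p s =
     cnj (g (snd (snd p) * (s - fst (snd p)))) * exp_rem N ((fst p)\<^sup>2 * phase a b p s)"

definition phase_family :: "(real \<Rightarrow> complex) \<Rightarrow> real \<Rightarrow> real \<Rightarrow> nat \<Rightarrow> family" where
  "phase_family g a b n p s =
     cnj (g (snd (snd p) * (s - fst (snd p)))) * of_real (phase a b p s) ^ n"

lemma rapid_window: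
  "g \<in> schwartz \<Longrightarrow> rapid 0 (\<lambda>p s. cnj (g (snd (snd p) * (s - fst (snd p)))))"
  unfolding rapid_def using controlled_schwartz[OF schwartz_cnj] by blast

lemma rapid_chirp_family: "g \<in> schwartz \<Longrightarrow> rapid (2 * N) (chirp_family g a b N)"
  using rapid_mult[OF rapid_window controlled_exp_rem] unfolding chirp_family_def by simp

lemma rapid_phase_family: "g \<in> schwartz \<Longrightarrow> rapid 0 (phase_family g a b n)"
  using rapid_mult[OF rapid_window exI[of "\<lambda>i. controlled _ 0 i _", OF controlled_phase_power]]
  unfolding phase_family_def by simp

lemma phase_family_lizorkin:
  assumes g: "g \<in> lizorkin" and p: "p \<in> params"
  shows "phase_family g a b n p \<in> lizorkin"
proof (induction n)
  case 0
  show ?case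
    using lizorkin_cnj[OF lizorkin_affine[OF g params_nonzero[OF p]]]
    unfolding phase_family_def by simp
next
  case (Suc n)
  have eq: "phase_family g a b (Suc n) p =
      (\<lambda>s. of_real (a * s\<^sup>2 + (b * snd (snd p)) * s) * phase_family g a b n p s)"
    by (auto simp: phase_family_def phase_def)
  show ?case
    unfolding eq
    by (rule lizorkin_mult_poly[OF Suc])
      (use rapid_schwartz[OF rapid_phase_family[OF lizorkin_schwartz[OF g]] p, of a b "Suc n"] in \<open>simp add: eq\<close>)
qed

lemma chirp_family_expansion:
  "chirp_family g a b 0 p s =
    (\<Sum>n<N. ((\<i> * of_real ((fst p)\<^sup>2)) ^ n / fact n) * phase_family g a b n p s) + chirp_family g a b N p s"
  unfolding chirp_family_def phase_family_def exp_rem_def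
  by (simp add: algebra_simps power_mult_distrib sum_distrib_left)

section \<open>The rescaled transforms\<close>

text \<open>The condition needed for dominated convergence on \<open>Y\<close>: constant and
  exponent do not depend on the index, and the weight is frozen at \<epsilon> = 1.\<close>

definition poly_bounded :: "('i \<Rightarrow> real \<times> real \<Rightarrow> complex) \<Rightarrow> bool" where
  "poly_bounded A \<longleftrightarrow> (\<exists>C M. C \<ge> 0 \<and> (\<forall>i. \<forall>z\<in>Y. norm (A i z) \<le> C * weight (1, z) ^ M))"

lemma poly_boundedI:
  "C \<ge> 0 \<Longrightarrow> (\<And>i z. z \<in> Y \<Longrightarrow> norm (A i z) \<le> C * weight (1, z) ^ M) \<Longrightarrow> poly_bounded A"
  unfolding poly_bounded_def by blast

lemma in_params: "r > 0 \<Longrightarrow> z \<in> Y \<Longrightarrow> (r, z) \<in> params"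
  by (simp add: params_def)

lemma poly_bounded_add:
  assumes "poly_bounded A" "poly_bounded B"
  shows "poly_bounded (\<lambda>i z. A i z + B i z)"
proof -
  obtain C M where C: "C \<ge> 0" "\<And>i z. z \<in> Y \<Longrightarrow> norm (A i z) \<le> C * weight (1, z) ^ M"
    using assms(1) unfolding poly_bounded_def by blast
  obtain C' M' where C': "C' \<ge> 0" "\<And>i z. z \<in> Y \<Longrightarrow> norm (B i z) \<le> C' * weight (1, z) ^ M'"
    using assms(2) unfolding poly_bounded_def by blast
  show ?thesis
  proof (rule poly_boundedI[of "C + C'" _ "M + M'"])
    fix i z assume z: "z \<in> Y"
    have w: "1 \<le> weight (1, z)" using weight_ge(1)[OF in_params[OF _ z]] by simp
    have "C * weight (1, z) ^ M \<le> C * weight (1, z) ^ (M + M')"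
      "C' * weight (1, z) ^ M' \<le> C' * weight (1, z) ^ (M + M')"
      using C(1) C'(1) w by (intro mult_left_mono power_increasing; simp)+
    then show "norm (A i z + B i z) \<le> (C + C') * weight (1, z) ^ (M + M')"
      using C(2)[OF z, of i] C'(2)[OF z, of i] norm_triangle_ineq[of "A i z" "B i z"]
      unfolding distrib_right by linarith
  qed (use C(1) C'(1) in simp)
qed

lemma poly_bounded_mult:
  assumes "poly_bounded A" "poly_bounded B"
  shows "poly_bounded (\<lambda>i z. A i z * B i z)"
proof -
  obtain C M where C: "C \<ge> 0" "\<And>i z. z \<in> Y \<Longrightarrow> norm (A i z) \<le> C * weight (1, z) ^ M"
    using assms(1) unfolding poly_bounded_def by blast
  obtain C' M' where C': "C' \<ge> 0" "\<And>i z. z \<in> Y \<Longrightarrow> norm (B i z) \<le> C' * weight (1, z) ^ M'"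
    using assms(2) unfolding poly_bounded_def by blast
  show ?thesis
  proof (rule poly_boundedI[of "C * C'" _ "M + M'"])
    fix i z assume z: "z \<in> Y"
    have "norm (A i z * B i z) \<le> (C * weight (1, z) ^ M) * (C' * weight (1, z) ^ M')"
      unfolding norm_mult by (rule mult_mono'[OF C(2)[OF z] C'(2)[OF z]]) auto
    then show "norm (A i z * B i z) \<le> (C * C') * weight (1, z) ^ (M + M')"
      unfolding power_add by (simp only: mult_ac)
  qed (use C(1) C'(1) in simp)
qed

lemma poly_bounded_const: "(\<And>i z. z \<in> Y \<Longrightarrow> norm (A i z) \<le> C) \<Longrightarrow> poly_bounded A"
  by (rule poly_boundedI[of "max C 0" _ 0]) (auto simp: le_max_iff_disj)

lemma poly_bounded_sum:
  "finite I \<Longrightarrow> (\<And>n. n \<in> I \<Longrightarrow> poly_bounded (A n)) \<Longrightarrow> poly_bounded (\<lambda>i z. \<Sum>n\<in>I. A n i z)"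
proof (induction I rule: finite_induct)
  case empty
  show ?case by (rule poly_bounded_const[of _ 0]) simp
next
  case (insert n I)
  then show ?case by (simp add: poly_bounded_add)
qed

lemma poly_bounded_xi: "poly_bounded (\<lambda>i z. of_real \<bar>snd z\<bar>)"
  by (rule poly_boundedI[of 1 _ 1]) (use weight_ge(4)[OF in_params[of 1]] in auto)

lemma poly_bounded_apply:
  assumes h: "rapid 0 h" and T: "\<And>i. seminorm_bounded V n B (T i)"
    and V: "\<And>p. p \<in> params \<Longrightarrow> h p \<in> V"
  shows "poly_bounded (\<lambda>i z. T i (h (1, z)))"
proof -
  obtain C M where C: "C \<ge> 0" "\<And>p. p \<in> params \<Longrightarrow> total_seminorm n (h p) \<le> C * fst p ^ 0 * weight p ^ M"
    using rapid_total_seminorm[OF h] by metis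
  have B: "B \<ge> 0" by (rule seminorm_boundedD(3)[OF T])
  show ?thesis
  proof (rule poly_boundedI[of "B * C" _ M])
    fix i z assume z: "z \<in> Y"
    have p: "(1, z) \<in> params" using z by (rule in_params[rotated]) simp
    have "norm (T i (h (1, z))) \<le> B * total_seminorm n (h (1, z))"
      by (rule seminorm_boundedD(4)[OF T V[OF p]])
    also have "\<dots> \<le> B * (C * weight (1, z) ^ M)"
      using mult_left_mono[OF C(2)[OF p] B] by simp
    finally show "norm (T i (h (1, z))) \<le> B * C * weight (1, z) ^ M" by (simp only: mult.assoc)
  qed (use B C(1) in simp)
qed

text \<open>A nonnegative factor does not move the square root out of the principal half-plane. This
  separates \<open>1 / (2 * pi)\<close> from the kernel constant.\<close>

lemma csqrt_mult_pos:
  assumes "r \<ge> 0"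
  shows "csqrt (of_real r * z) = of_real (sqrt r) * csqrt z"
proof (cases "r = 0")
  case False
  then have r: "sqrt r > 0" using assms by simp
  show ?thesis
  proof (rule csqrt_unique)
    show "(of_real (sqrt r) * csqrt z)\<^sup>2 = of_real r * z"
      using assms by (simp add: power_mult_distrib of_real_power[symmetric] del: of_real_power)
    show "0 < Re (of_real (sqrt r) * csqrt z) \<or>
        Re (of_real (sqrt r) * csqrt z) = 0 \<and> 0 \<le> Im (of_real (sqrt r) * csqrt z)"
      using csqrt_principal[of z] r by (auto simp: zero_less_mult_iff)
  qed
qed simp

text \<open>The window dilation by \<open>1 / r\<^sup>2\<close> matches the scaling of x and \<xi>,
  so that \<open>t = r * s\<close> leaves the window argument \<open>\<xi> * (s - x)\<close>. The
  \<xi>-part of the kernel cancels against the exponential in front. One factor \<open>r\<close>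
  comes from \<open>\<bar>r * \<xi>\<bar>\<close>, the other from the Jacobian.\<close>

lemma frac_stockwell_rescaled:
  assumes f': "seminorm_bounded schwartz n B f'" and g: "g \<in> schwartz" and "r > 0" and z: "(x, \<xi>) \<in> Y"
  shows "exp (- \<i> * of_real (cot \<alpha> * (r * \<xi>)\<^sup>2 / 2)) *
       frac_stockwell \<alpha> (\<lambda>t. g (t / r\<^sup>2)) f' (r * x) (r * \<xi>) =
    csqrt ((1 - \<i> * of_real (cot \<alpha>)) / of_real (2 * pi)) * of_real (r\<^sup>2 * \<bar>\<xi>\<bar>) *
      dilate r f' (chirp_family g (cot \<alpha> / 2) (- csc \<alpha>) 0 (r, x, \<xi>))"
proof -
  define C where "C = csqrt ((1 - \<i> * of_real (cot \<alpha>)) / of_real (2 * pi))"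
  define E where "E = exp (\<i> * of_real (cot \<alpha> * (r * \<xi>)\<^sup>2 / 2))"
  define h where "h = chirp_family g (cot \<alpha> / 2) (- csc \<alpha>) 0 (r, x, \<xi>)"
  have h: "h \<in> schwartz"
    unfolding h_def by (rule rapid_schwartz[OF rapid_chirp_family[OF g] in_params[OF \<open>r > 0\<close> z]])
  have "cnj (g (r * \<xi> * (t - r * x) / r\<^sup>2)) * frac_kernel \<alpha> t (r * \<xi>) = (C * E) * h (t / r)" for t
  proof -
    have 1: "r * \<xi> * (t - r * x) / r\<^sup>2 = \<xi> * (t / r - x)"
      using \<open>r > 0\<close> by (simp add: field_simps power2_eq_square)
    have 2: "(t\<^sup>2 + (r * \<xi>)\<^sup>2) / 2 * cot \<alpha> - t * (r * \<xi>) * csc \<alpha> =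
        cot \<alpha> * (r * \<xi>)\<^sup>2 / 2 + r\<^sup>2 * phase (cot \<alpha> / 2) (- csc \<alpha>) (r, x, \<xi>) (t / r)"
      unfolding phase_def using \<open>r > 0\<close> by (simp add: field_simps power2_eq_square)
    show ?thesis
      unfolding 1 frac_kernel_def 2 C_def[symmetric] E_def h_def chirp_family_def
      by (simp add: exp_rem_def of_real_add distrib_left exp_add)
  qed
  then have "frac_stockwell \<alpha> (\<lambda>t. g (t / r\<^sup>2)) f' (r * x) (r * \<xi>)
      = of_real \<bar>r * \<xi>\<bar> * f' (\<lambda>t. (C * E) * h (t / r))"
    unfolding frac_stockwell_def by simp
  also have "f' (\<lambda>t. (C * E) * h (t / r)) = (C * E) * f' (\<lambda>t. h (t / r))"
    using schwartz_affine[OF h, of "1 / r" 0] \<open>r > 0\<close> by (intro seminorm_boundedD(2)[OF f']) simp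
  also have "f' (\<lambda>t. h (t / r)) = of_real r * dilate r f' h"
    unfolding dilate_def using \<open>r > 0\<close> by simp
  finally have "frac_stockwell \<alpha> (\<lambda>t. g (t / r\<^sup>2)) f' (r * x) (r * \<xi>)
      = E * (C * of_real (r\<^sup>2 * \<bar>\<xi>\<bar>) * dilate r f' h)"
    using \<open>r > 0\<close> by (simp add: abs_mult power2_eq_square)
  moreover have "exp (- \<i> * of_real (cot \<alpha> * (r * \<xi>)\<^sup>2 / 2)) * E = 1"
    unfolding E_def exp_add[symmetric] by simp
  ultimately show ?thesis
    unfolding C_def h_def by (simp add: mult.assoc[symmetric])
qed

text \<open>At \<alpha> = \<pi>/2 the kernel has no chirp, and the modulation cancels its remaining
  oscillation, leaving the bare window.\<close>

lemma stockwell_modulated: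
  assumes "c > 0"
  shows "stockwell g (modulate (\<xi> / c) u) (x * c) (\<xi> / c) =
    of_real (\<bar>\<xi>\<bar> / c) * u (\<lambda>t. of_real (sqrt (1 / (2 * pi))) * cnj (g (\<xi> * (t / c - x))))"
proof -
  have cot: "cot (pi / 2) = (0 :: real)" and csc: "csc (pi / 2) = 1"
    by (simp_all add: cot_def csc_def)
  have s: "csqrt ((1 - \<i> * of_real 0) / of_real (2 * pi)) = of_real (sqrt (1 / (2 * pi)))"
    using csqrt_mult_pos[of "1 / (2 * pi)" 1] by simp
  have "exp (\<i> * of_real (\<xi> / c * t)) * (cnj (g (\<xi> / c * (t - x * c))) * frac_kernel (pi / 2) t (\<xi> / c))
      = of_real (sqrt (1 / (2 * pi))) * cnj (g (\<xi> * (t / c - x)))" for t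
  proof -
    have 1: "\<xi> / c * (t - x * c) = \<xi> * (t / c - x)" using assms by (simp add: field_simps)
    have 2: "exp (\<i> * of_real (\<xi> / c * t)) * exp (\<i> * of_real ((t\<^sup>2 + (\<xi> / c)\<^sup>2) / 2 * 0 - t * (\<xi> / c) * 1)) = 1"
      unfolding exp_add[symmetric] by (simp add: field_simps)
    show ?thesis
      unfolding frac_kernel_def cot csc 1 s using 2 by (simp add: mult_ac)
  qed
  then show ?thesis
    unfolding stockwell_def frac_stockwell_def modulate_def using assms by simp
qed

lemma seminorm_bounded_sum:
  fixes N :: nat
  assumes T: "seminorm_bounded schwartz n B T" and h: "\<And>k. k < N \<Longrightarrow> h k \<in> schwartz"
  shows "(\<lambda>x. \<Sum>k<N. c k * h k x) \<in> schwartz \<and> T (\<lambda>x. \<Sum>k<N. c k * h k x) = (\<Sum>k<N. c k * T (h k))"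
  using h
proof (induction N)
  case 0
  show ?case using seminorm_boundedD(2)[OF T schwartz_zero, of 0] schwartz_zero by simp
next
  case (Suc N)
  then have IH: "(\<lambda>x. \<Sum>k<N. c k * h k x) \<in> schwartz"
    "T (\<lambda>x. \<Sum>k<N. c k * h k x) = (\<Sum>k<N. c k * T (h k))" by auto
  have hN: "h N \<in> schwartz" using Suc.prems by simp
  show ?case
    unfolding sum.lessThan_Suc
    using schwartz_add(1)[OF IH(1) schwartz_cmult[OF hN, of "c N"]]
      seminorm_boundedD(1)[OF T IH(1) schwartz_cmult[OF hN, of "c N"]]
      seminorm_boundedD(2)[OF T hN, of "c N"] IH(2)
    by simp
qed

lemma continuous_dilate_chirp:
  assumes "seminorm_bounded schwartz n B f'" "g \<in> schwartz" "r > 0"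
  shows "continuous_on Y (\<lambda>z. dilate r f' (chirp_family g a b N (r, z)))"
proof -
  from rapid_apply_continuous[OF rapid_chirp_family[OF assms(2)] seminorm_bounded_dilate_schwartz[OF assms(1,3)]
      rapid_schwartz[OF rapid_chirp_family[OF assms(2)]] schwartz_cmult schwartz_diff(1)]
  have "continuous_on params (\<lambda>p. dilate r f' (chirp_family g a b N p))" .
  then show ?thesis
    by (rule continuous_on_compose2) (auto intro!: continuous_intros in_params assms(3))
qed

text \<open>The inequality \<open>weight (r, z) \<le> (1 + r) * weight (1, z)\<close> separates the
  scale from the point of \<open>Y\<close>.\<close>

lemma dilate_chirp_bound:
  assumes f': "seminorm_bounded schwartz n B f'" and g: "g \<in> schwartz"
  shows "\<exists>K M. K \<ge> 0 \<and> (\<forall>r>0. \<forall>z\<in>Y. norm (dilate r f' (chirp_family g a b N (r, z)))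
    \<le> K * ((1 + r) ^ n * (1 + 1 / r) ^ n) / r * r ^ (2 * N) * ((1 + r) * weight (1, z)) ^ M)"
proof -
  obtain C M where C: "C \<ge> 0"
    "\<And>p. p \<in> params \<Longrightarrow> total_seminorm n (chirp_family g a b N p) \<le> C * fst p ^ (2 * N) * weight p ^ M"
    using rapid_total_seminorm[OF rapid_chirp_family[OF g]] by metis
  have B: "B \<ge> 0" by (rule seminorm_boundedD(3)[OF f'])
  have "norm (dilate r f' (chirp_family g a b N (r, z)))
      \<le> (B * C) * ((1 + r) ^ n * (1 + 1 / r) ^ n) / r * r ^ (2 * N) * ((1 + r) * weight (1, z)) ^ M"
    if "r > 0" "z \<in> Y" for r z
  proof -
    define D where "D = ((1 + r) ^ n * (1 + 1 / r) ^ n) / r"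
    have "D \<ge> 0" using that by (simp add: D_def)
    have p: "(r, z) \<in> params" using that by (rule in_params)
    note T = seminorm_bounded_dilate_schwartz[OF f' that(1)]
    have "weight (r, z) \<le> (1 + r) * weight (1, z)"
    proof -
      obtain x \<xi> where z: "z = (x, \<xi>)" by force
      define A where "A = \<bar>x\<bar> + \<bar>\<xi>\<bar> + 1 / \<bar>\<xi>\<bar>"
      have "A \<ge> 0" by (simp add: A_def)
      then have "1 + r + A \<le> (1 + r) * (2 + A)"
        using mult_nonneg_nonneg[of r A] that(1) by (simp add: algebra_simps)
      then show ?thesis by (simp add: weight_def z A_def add.assoc)
    qed
    moreover have "0 \<le> weight (r, z)" using weight_ge(1)[OF p] by simp
    ultimately have w: "weight (r, z) ^ M \<le> ((1 + r) * weight (1, z)) ^ M" by (intro power_mono)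
    have "norm (dilate r f' (chirp_family g a b N (r, z))) \<le> B * D * total_seminorm n (chirp_family g a b N (r, z))"
      using seminorm_boundedD(4)[OF T rapid_schwartz[OF rapid_chirp_family[OF g] p]] unfolding D_def by simp
    also have "\<dots> \<le> B * D * (C * r ^ (2 * N) * weight (r, z) ^ M)"
      using C(2)[OF p] B \<open>D \<ge> 0\<close> by (intro mult_left_mono) auto
    also have "\<dots> \<le> B * D * (C * r ^ (2 * N) * ((1 + r) * weight (1, z)) ^ M)"
      using w B C(1) \<open>D \<ge> 0\<close> that(1) by (intro mult_left_mono) auto
    finally show ?thesis unfolding D_def by (simp add: mult_ac)
  qed
  moreover have "B * C \<ge> 0" using B C(1) by simp
  ultimately show ?thesis by blast
qed

lemma chirp_remainder:
  assumes f': "seminorm_bounded schwartz n B f'" and g: "g \<in> schwartz"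
    and "c > 0" "d \<le> 1" and L: "\<And>r. 0 < r \<Longrightarrow> r \<le> d \<Longrightarrow> c * r\<^sup>2 \<le> L r"
  shows "\<exists>N K M. N > 0 \<and> K \<ge> 0 \<and> (\<forall>r z. 0 < r \<and> r \<le> d \<and> z \<in> Y \<longrightarrow>
    norm (dilate r f' (chirp_family g a b N (r, z)) / of_real (r powr m * L r)) \<le> K * r * weight (1, z) ^ M)"
proof -
  \<comment> \<open>Enough for \<open>2 * N \<ge> n + m + 4\<close>, whatever the sign of
    \<open>m\<close>.\<close>
  define N where "N = n + nat \<lceil>\<bar>m\<bar>\<rceil> + 2"
  obtain K M where K: "K \<ge> 0" "\<And>r z. r > 0 \<Longrightarrow> z \<in> Y \<Longrightarrow> norm (dilate r f' (chirp_family g a b N (r, z)))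
    \<le> K * ((1 + r) ^ n * (1 + 1 / r) ^ n) / r * r ^ (2 * N) * ((1 + r) * weight (1, z)) ^ M"
    using dilate_chirp_bound[OF f' g] by metis
  have "norm (dilate r f' (chirp_family g a b N (r, z)) / of_real (r powr m * L r))
      \<le> (K * 4 ^ n * 2 ^ M / c) * r * weight (1, z) ^ M" if r: "0 < r" "r \<le> d" and z: "z \<in> Y" for r z
  proof -
    have "r \<le> 1" using r assms(4) by linarith
    define W where "W = weight (1, z)"
    have "W \<ge> 1" unfolding W_def using weight_ge(1)[OF in_params[OF _ z]] by simp
    have "(1 + 1 / r) ^ n \<le> (2 / r) ^ n"
      using r \<open>r \<le> 1\<close> by (intro power_mono) (auto simp: field_simps)
    moreover have "(1 + r) ^ n \<le> 2 ^ n" using r \<open>r \<le> 1\<close> by (intro power_mono) auto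
    ultimately have "(1 + r) ^ n * (1 + 1 / r) ^ n \<le> 2 ^ n * (2 / r) ^ n"
      using r by (intro mult_mono) auto
    also have "\<dots> = 4 ^ n / r ^ n" by (simp add: power_divide power_mult_distrib[symmetric])
    finally have d: "(1 + r) ^ n * (1 + 1 / r) ^ n \<le> 4 ^ n / r ^ n" .
    have w: "((1 + r) * W) ^ M \<le> 2 ^ M * W ^ M"
      unfolding power_mult_distrib[symmetric] using r \<open>r \<le> 1\<close> \<open>W \<ge> 1\<close> by (intro power_mono mult_right_mono) auto
    \<comment> \<open>The factor \<open>r ^ n * r\<close> pays for the dilation,
      \<open>r\<^sup>2 * r powr m\<close> for the denominator through the lower bound of
      \<open>L\<close>, and the one \<open>r\<close> left over makes the remainder vanish in the
      limit.\<close>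
    have e: "r ^ (2 * N) \<le> r ^ n * r * (r * (r\<^sup>2 * r powr m))"
    proof -
      have "r ^ (2 * N) = r powr real (2 * N)" by (rule powr_realpow[OF r(1), symmetric])
      also have "\<dots> \<le> r powr (real n + 1 + (1 + (2 + m)))"
        using r \<open>r \<le> 1\<close> unfolding N_def by (intro powr_mono') (auto, linarith)
      also have "\<dots> = r ^ n * r * (r * (r\<^sup>2 * r powr m))"
        unfolding powr_add using r by (simp add: powr_realpow)
      finally show ?thesis .
    qed
    have "norm (dilate r f' (chirp_family g a b N (r, z)))
        \<le> K * ((1 + r) ^ n * (1 + 1 / r) ^ n) / r * r ^ (2 * N) * ((1 + r) * W) ^ M"
      unfolding W_def by (rule K(2)[OF r(1) z])
    also have "\<dots> \<le> K * (4 ^ n / r ^ n) / r * (r ^ n * r * (r * (r\<^sup>2 * r powr m))) * (2 ^ M * W ^ M)"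
      using K(1) r \<open>W \<ge> 1\<close>
      by (intro mult_mono divide_right_mono mult_left_mono d e w) (auto intro!: mult_nonneg_nonneg divide_nonneg_nonneg)
    also have "\<dots> = (K * 4 ^ n * 2 ^ M / c * r * W ^ M) * (r powr m * (c * r\<^sup>2))"
      using r assms(3) by (simp add: field_simps)
    also have "\<dots> \<le> (K * 4 ^ n * 2 ^ M / c * r * W ^ M) * (r powr m * L r)"
      using K(1) r \<open>W \<ge> 1\<close> assms(3) L[OF r] by (intro mult_left_mono) auto
    finally have le: "norm (dilate r f' (chirp_family g a b N (r, z)))
      \<le> (K * 4 ^ n * 2 ^ M / c * r * W ^ M) * (r powr m * L r)" .
    have "0 < c * r\<^sup>2" using assms(3) r by simp
    then have pos: "0 < r powr m * L r" using L[OF r] r by simp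
    then show ?thesis
      using le unfolding norm_divide norm_of_real W_def[symmetric] by (simp add: pos_divide_le_eq)
  qed
  moreover have "K * 4 ^ n * 2 ^ M / c \<ge> 0" using K(1) assms(3) by simp
  moreover have "N > 0" by (simp add: N_def)
  ultimately show ?thesis by blast
qed

text \<open>These are the two properties that make the limit function a regular element of the dual.
  The dummy index \<open>i\<close> gives access to the calculus of \<open>poly_bounded\<close> for a
  single function.\<close>

lemma
  assumes u: "seminorm_bounded lizorkin n B u" and g: "g \<in> lizorkin"
  defines "G \<equiv> \<lambda>a b z. of_real \<bar>snd z\<bar> * u (phase_family g a b 0 (1, z))"
  shows continuous_window_pairing: "continuous_on Y (G a b)"
    and poly_bounded_window_pairing: "poly_bounded (\<lambda>(i::nat) z. G a b z)"
proof -
  note gs = lizorkin_schwartz[OF g]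
  have "continuous_on params (\<lambda>p. u (phase_family g a b 0 p))"
    by (rule rapid_apply_continuous[OF rapid_phase_family[OF gs] u phase_family_lizorkin[OF g] lizorkin_cmult lizorkin_diff])
  then have "continuous_on Y (\<lambda>z. u (phase_family g a b 0 (1, z)))"
    by (rule continuous_on_compose2) (auto intro!: continuous_intros in_params)
  then show "continuous_on Y (G a b)" unfolding G_def by (intro continuous_intros)
  show "poly_bounded (\<lambda>(i::nat) z. G a b z)"
    unfolding G_def
    by (intro poly_bounded_mult poly_bounded_xi poly_bounded_apply[OF rapid_phase_family[OF gs] u phase_family_lizorkin[OF g]])
qed

text \<open>This is what remains of the assertion once the kernel constant and the factor
  \<open>\<epsilon>\<^sup>2\<close> are divided out.\<close>

lemma chirp_asymptotics:
  fixes a b :: real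
  assumes L: "slowly_varying_at_0 L" and qa: "quasiasymptotic f m L u"
    and f: "seminorm_bounded lizorkin nf Bf f" and u: "seminorm_bounded lizorkin nu Bu u"
    and f': "seminorm_bounded schwartz n B f'" and agree: "\<And>\<phi>. \<phi> \<in> lizorkin \<Longrightarrow> f' \<phi> = f \<phi>"
    and g: "g \<in> lizorkin" and \<Phi>: "\<Phi> \<in> schwartz_Y"
  defines "H \<equiv> \<lambda>r z. of_real \<bar>snd z\<bar> * (dilate r f' (chirp_family g a b 0 (r, z)) / of_real (r powr m * L r))"
    and "G \<equiv> \<lambda>z. of_real \<bar>snd z\<bar> * u (phase_family g a b 0 (1, z))"
  shows "((\<lambda>r. regular_functional (H r) \<Phi>) \<longlongrightarrow> regular_functional G \<Phi>) (at_right 0)"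
proof -
  note gs = lizorkin_schwartz[OF g]
  note contG = continuous_window_pairing[OF u g, of a b, folded G_def]
  obtain c d' where c: "c > 0" "d' > 0" "\<And>r. 0 < r \<Longrightarrow> r \<le> d' \<Longrightarrow> c * r\<^sup>2 \<le> L r"
    using slowly_varying_lower_bound[OF L] by metis
  define d where "d = min d' 1"
  have d: "d > 0" "d \<le> 1" "\<And>r. 0 < r \<Longrightarrow> r \<le> d \<Longrightarrow> c * r\<^sup>2 \<le> L r"
    using c by (auto simp: d_def)
  obtain N K M where N: "N > 0" and K: "K \<ge> 0" "\<And>r z. 0 < r \<Longrightarrow> r \<le> d \<Longrightarrow> z \<in> Y \<Longrightarrow>
    norm (dilate r f' (chirp_family g a b N (r, z)) / of_real (r powr m * L r)) \<le> K * r * weight (1, z) ^ M"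
    using chirp_remainder[OF f' gs c(1) d(2,3), where a = a and b = b and m = m] by metis
  \<comment> \<open>Limits along sequences in \<open>{0<..<d}\<close> suffice, and there the lower
    bound for \<open>L\<close> holds at every term, not just eventually.\<close>
  have "((\<lambda>r. regular_functional (H r) \<Phi>) \<longlongrightarrow> regular_functional G \<Phi>) (at 0 within {0<..<d})"
    unfolding tendsto_at_iff_sequentially comp_def
  proof (intro allI impI)
    fix X :: "nat \<Rightarrow> real"
    assume X: "\<forall>i. X i \<in> {0<..<d} - {0}" and X0: "X \<longlonglongrightarrow> 0"
    have Xp: "0 < X i" "X i \<le> d" "X i \<le> 1" for i
      using X[rule_format, of i] d(2) by auto
    have Xf: "filterlim X (at_right 0) sequentially"
      using X0 Xp(1) by (intro tendsto_imp_filterlim_at_right) auto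
    \<comment> \<open>\<open>S\<close> belongs to \<open>f\<close> and is used on the Lizorkin space
      only; everything that needs the extension \<open>f'\<close> is collected in
      \<open>R\<close>.\<close>
    define S where "S i \<phi> = dilate (X i) f \<phi> / of_real (X i powr m * L (X i))" for i \<phi>
    define R where "R i z = dilate (X i) f' (chirp_family g a b N (X i, z)) / of_real (X i powr m * L (X i))" for i z
    have Slim: "(\<lambda>i. S i \<phi>) \<longlonglongrightarrow> u \<phi>" if "\<phi> \<in> lizorkin" for \<phi>
      unfolding S_def
      by (rule filterlim_compose[OF qa[unfolded quasiasymptotic_def, rule_format, OF that] Xf])
    have dil: "(\<lambda>x. \<phi> (x / X i)) \<in> lizorkin" if "\<phi> \<in> lizorkin" for \<phi> i
      using lizorkin_dilate[OF that, of "X i"] Xp(1)[of i] by simp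
    have "\<exists>n C. \<forall>i. seminorm_bounded lizorkin n C (S i)"
    proof (rule lizorkin_uniform_boundedness)
      show "\<exists>n C. seminorm_bounded lizorkin n C (S i)" for i
        unfolding S_def
        using seminorm_bounded_divide[OF seminorm_bounded_dilate[OF f _ Xp(1) dil]] lizorkin_schwartz by blast
      show "\<exists>B. \<forall>i. norm (S i \<phi>) \<le> B" if "\<phi> \<in> lizorkin" for \<phi>
        using convergent_imp_Bseq[OF convergentI[OF Slim[OF that]]] unfolding Bseq_def by blast
    qed
    then obtain n1 C1 where S: "\<And>i. seminorm_bounded lizorkin n1 C1 (S i)" by blast
    define q where "q k i = (\<i> * of_real ((X i)\<^sup>2)) ^ k / (fact k :: complex)" for k i
    define P where "P k z = phase_family g a b k (1, z)" for k z
    have expand: "H (X i) z = of_real \<bar>snd z\<bar> *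
        ((\<Sum>k<N. q k i * S i (P k z)) + R i z)"
      if z: "z \<in> Y" for i z
    proof -
      have p: "(X i, z) \<in> params" by (rule in_params[OF Xp(1) z])
      note T = seminorm_bounded_dilate_schwartz[OF f' Xp(1)[of i]]
      \<comment> \<open>The scale enters only through the coefficients \<open>q\<close>, so
        \<open>S i\<close> is applied to a function fixed in \<open>i\<close>, as the
        quasiasymptotics require.\<close>
      have ph: "phase_family g a b k (X i, z) = P k z" for k
        unfolding P_def phase_family_def phase_def by simp
      \<comment> \<open>Dilation preserves the Lizorkin space, where \<open>f'\<close> and
        \<open>f\<close> coincide; the choice of the extension thus affects \<open>R\<close>
        alone.\<close>
      have dil_eq: "dilate (X i) f' (P k z) = dilate (X i) f (P k z)" for k
        using agree[OF dil[OF phase_family_lizorkin[OF g p]], of a b k i] unfolding dilate_def ph by simp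
      note sum = seminorm_bounded_sum[OF T rapid_schwartz[OF rapid_phase_family[OF gs] p], where N = N and c = "\<lambda>k. q k i"]
      have "chirp_family g a b 0 (X i, z) = (\<lambda>s. (\<Sum>k<N. q k i * phase_family g a b k (X i, z) s) + chirp_family g a b N (X i, z) s)"
        using chirp_family_expansion[of g a b "(X i, z)" _ N] unfolding q_def by (intro ext) simp
      then have "dilate (X i) f' (chirp_family g a b 0 (X i, z)) =
          (\<Sum>k<N. q k i * dilate (X i) f' (phase_family g a b k (X i, z))) + dilate (X i) f' (chirp_family g a b N (X i, z))"
        using seminorm_boundedD(1)[OF T conjunct1[OF sum] rapid_schwartz[OF rapid_chirp_family[OF gs] p]] conjunct2[OF sum]
        by simp
      then show ?thesis
        unfolding H_def S_def R_def ph dil_eq by (simp add: add_divide_distrib sum_divide_distrib)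
    qed
    have pb: "poly_bounded (\<lambda>i z. of_real \<bar>snd z\<bar> *
        ((\<Sum>k<N. q k i * S i (P k z)) + R i z))"
    proof (intro poly_bounded_mult poly_bounded_add poly_bounded_sum poly_bounded_xi)
      show "poly_bounded (\<lambda>i z. S i (P k z))" for k
        unfolding P_def
        by (rule poly_bounded_apply[OF rapid_phase_family[OF gs] S phase_family_lizorkin[OF g]])
      show "poly_bounded (\<lambda>i z. q k i)" for k
      proof (rule poly_bounded_const)
        fix i
        have "norm (q k i) = ((X i)\<^sup>2) ^ k / fact k"
          by (simp add: q_def norm_divide norm_power norm_mult)
        also have "\<dots> \<le> 1 / 1"
          using Xp[of i] by (intro frac_le power_le_one) (auto simp: fact_ge_1)
        finally show "norm (q k i) \<le> 1" by simp
      qed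
      show "poly_bounded R"
      proof (rule poly_boundedI[OF K(1)])
        fix i z assume z: "z \<in> Y"
        have "1 \<le> weight (1, z)" using weight_ge(1)[OF in_params[OF _ z]] by simp
        then have "K * X i * weight (1, z) ^ M \<le> K * 1 * weight (1, z) ^ M"
          using K(1) Xp(3) by (intro mult_right_mono mult_left_mono) auto
        then show "norm (R i z) \<le> K * weight (1, z) ^ M"
          using K(2)[OF Xp(1,2) z, of i] unfolding R_def by simp
      qed
    qed simp
    then obtain C2 M2 where C2: "C2 \<ge> 0" "\<And>i z. z \<in> Y \<Longrightarrow> norm (H (X i) z) \<le> C2 * weight (1, z) ^ M2"
      unfolding poly_bounded_def using expand by (metis (no_types, lifting))
    show "(\<lambda>i. regular_functional (H (X i)) \<Phi>) \<longlonglongrightarrow> regular_functional G \<Phi>"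
    proof (rule regular_functional_convergence[OF _ contG C2 _ \<Phi>])
      show "continuous_on Y (H (X i))" for i
        unfolding H_def divide_inverse by (intro continuous_intros continuous_dilate_chirp[OF f' gs Xp(1)])
      fix z assume z: "z \<in> Y"
      have p: "(1, z) \<in> params" by (rule in_params[OF _ z]) simp
      have R0: "(\<lambda>i. R i z) \<longlonglongrightarrow> 0"
      proof (rule Lim_null_comparison)
        show "\<forall>\<^sub>F i in sequentially. norm (R i z) \<le> K * X i * weight (1, z) ^ M"
          using K(2)[OF Xp(1,2) z] unfolding R_def by simp
        have "(\<lambda>i. K * X i * weight (1, z) ^ M) \<longlonglongrightarrow> K * 0 * weight (1, z) ^ M"
          by (intro tendsto_intros X0)
        then show "(\<lambda>i. K * X i * weight (1, z) ^ M) \<longlonglongrightarrow> 0" by simp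
      qed
      have "(\<lambda>i. q k i) \<longlonglongrightarrow> (\<i> * of_real (0\<^sup>2)) ^ k / fact k" for k
        unfolding q_def by (intro tendsto_intros X0) auto
      moreover have "P k z \<in> lizorkin" for k
        unfolding P_def by (rule phase_family_lizorkin[OF g p])
      ultimately have "(\<lambda>i. of_real \<bar>snd z\<bar> * ((\<Sum>k<N. q k i * S i (P k z)) + R i z)) \<longlonglongrightarrow>
          of_real \<bar>snd z\<bar> * ((\<Sum>k<N. (\<i> * of_real (0\<^sup>2)) ^ k / fact k * u (P k z)) + 0)"
        by (intro tendsto_intros R0 Slim)
      \<comment> \<open>Only \<open>k = 0\<close> survives, as \<open>0 ^ 0 = 1\<close>;
        \<open>N > 0\<close> guarantees that this term is in the sum.\<close>
      also have "(\<Sum>k<N. (\<i> * of_real (0\<^sup>2)) ^ k / fact k * u (P k z)) = u (P 0 z)"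
        using N by (cases N) (simp_all add: sum.lessThan_Suc_shift del: sum.lessThan_Suc)
      finally show "(\<lambda>i. H (X i) z) \<longlonglongrightarrow> G z"
        unfolding expand[OF z] G_def P_def by simp
    qed
  qed
  \<comment> \<open>The two filters agree because the sets coincide in the neighbourhood
    \<open>{..<d}\<close> of 0.\<close>
  moreover have "at 0 within {0<..<d} = at_right (0::real)"
    by (rule at_within_nhd[of 0 "{..<d}"]) (use d(1) in auto)
  ultimately show "((\<lambda>r. regular_functional (H r) \<Phi>) \<longlongrightarrow> regular_functional G \<Phi>) (at_right 0)"
    by simp
qed

section \<open>Sign of the cosecant and reduction to the rescaled pairing\<close>

lemma sin_pos_of_interval:
  assumes "\<alpha> \<in> {2 * of_int k * pi <..< (2 * of_int k + 1) * pi}"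
  shows "sin \<alpha> > 0"
proof -
  have "sin (\<alpha> - 2 * pi * of_int k) > 0"
    using assms by (intro sin_gt_zero) (auto simp: algebra_simps)
  moreover have "sin (\<alpha> - 2 * pi * of_int k) = sin \<alpha>"
    unfolding sin_diff using sin_integer_2pi[of "of_int k"] cos_integer_2pi[of "of_int k"] by simp
  ultimately show ?thesis by simp
qed

lemma regular_functional_cong:
  "(\<And>z. z \<in> Y \<Longrightarrow> F z = G z) \<Longrightarrow> regular_functional F \<Phi> = regular_functional G \<Phi>"
  unfolding regular_functional_def set_lebesgue_integral_def
  by (rule Bochner_Integration.integral_cong) (auto simp: indicator_def)

lemma regular_functional_cmult:
  "regular_functional (\<lambda>z. c * F z) \<Phi> = c * regular_functional F \<Phi>"
  unfolding regular_functional_def set_lebesgue_integral_def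
  by (subst integral_mult_right_zero[symmetric]) (simp add: mult.assoc)

theorem theorem3p1:
  fixes \<alpha> m c1 c2 :: real and k :: int and L :: "real \<Rightarrow> real"
    and f f' u :: "(real \<Rightarrow> complex) \<Rightarrow> complex" and g :: "real \<Rightarrow> complex"
  assumes "\<alpha> \<in> {2 * of_int k * pi <..< (2 * of_int k + 1) * pi}"
    and "c1 = cot \<alpha>" and "c2 = csc \<alpha>"
    and "slowly_varying_at_0 L"
    and "f \<in> dual lizorkin_topology" and "u \<in> dual lizorkin_topology"
    and "quasiasymptotic f m L u"
    and "is_extension f f'"
    and "g \<in> lizorkin" and "g \<noteq> (\<lambda>_. 0)"
  shows "asymptotic_Y
    (\<lambda>\<epsilon> (x, \<xi>). exp (- \<i> * of_real (c1 * (\<epsilon> * \<xi>)\<^sup>2 / 2)) *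
       frac_stockwell \<alpha> (\<lambda>t. g (t / \<epsilon>\<^sup>2)) f' (\<epsilon> * x) (\<epsilon> * \<xi>))
    (m + 2) L
    (\<lambda>(x, \<xi>). csqrt (1 - \<i> * of_real c1) / of_real (c2 powr m) *
       stockwell g (modulate (\<xi> / c2) u) (x * c2) (\<xi> / c2))"

proof -
  define F where "F = (\<lambda>\<epsilon> (x, \<xi>). exp (- \<i> * of_real (c1 * (\<epsilon> * \<xi>)\<^sup>2 / 2)) *
       frac_stockwell \<alpha> (\<lambda>t. g (t / \<epsilon>\<^sup>2)) f' (\<epsilon> * x) (\<epsilon> * \<xi>))"
  define G where "G = (\<lambda>(x, \<xi>). csqrt (1 - \<i> * of_real c1) / of_real (c2 powr m) *
       stockwell g (modulate (\<xi> / c2) u) (x * c2) (\<xi> / c2))"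
  define C where "C = csqrt ((1 - \<i> * of_real c1) / of_real (2 * pi))"
  \<comment> \<open>The interval for \<alpha> enters here: positivity makes \<open>c2 powr m\<close>
    meaningful and \<open>c2\<close> an admissible dilation factor for homogeneity.\<close>
  have "c2 > 0"
    unfolding assms(3) csc_def using sin_pos_of_interval[OF assms(1)] by simp
  let ?s = "complex_of_real (sqrt (1 / (2 * pi)))"
  have C: "csqrt (1 - \<i> * of_real c1) * ?s = C"
  proof -
    have "(1 - \<i> * of_real c1) / of_real (2 * pi) = of_real (1 / (2 * pi)) * (1 - \<i> * of_real c1)"
      unfolding of_real_divide by simp
    moreover have "0 \<le> 1 / (2 * pi)" by simp
    note csqrt_mult_pos[OF this, of "1 - \<i> * of_real c1"]
    ultimately show ?thesis unfolding C_def by (simp only: mult.commute)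
  qed
  obtain n B where f': "seminorm_bounded schwartz n B f'"
    using dual_schwartz_imp_bounded[of f'] assms(8) by (auto simp: is_extension_def)
  have agree: "f' \<phi> = f \<phi>" if "\<phi> \<in> lizorkin" for \<phi>
    using assms(8) that unfolding is_extension_def by blast
  have liz: "lizorkin \<subseteq> schwartz" using lizorkin_schwartz by blast
  obtain nf Bf where f: "seminorm_bounded lizorkin nf Bf f"
    using dual_imp_seminorm_bounded[OF assms(5)[unfolded lizorkin_topology_def] liz lizorkin_zero lizorkin_cmult]
    by blast
  obtain nu Bu where u: "seminorm_bounded lizorkin nu Bu u"
    using dual_imp_seminorm_bounded[OF assms(6)[unfolded lizorkin_topology_def] liz lizorkin_zero lizorkin_cmult]
    by blast
  note gs = lizorkin_schwartz[OF assms(9)]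
  let ?a = "c1 / 2" and ?b = "- c2"
  let ?D = "\<lambda>\<epsilon> z. dilate \<epsilon> f' (chirp_family g ?a ?b 0 (\<epsilon>, z))"
  define H where "H \<epsilon> z = of_real \<bar>snd z\<bar> *
    (?D \<epsilon> z / of_real (\<epsilon> powr m * L \<epsilon>))" for \<epsilon> z
  define G0 where "G0 z = of_real \<bar>snd z\<bar> * u (phase_family g ?a ?b 0 (1, z))" for z
  note core = chirp_asymptotics[OF assms(4,7) f u f' agree assms(9), where a = ?a and b = ?b, folded H_def G0_def]
  have Feq: "F \<epsilon> z = C * of_real (\<epsilon>\<^sup>2 * \<bar>snd z\<bar>) * ?D \<epsilon> z"
    if "\<epsilon> > 0" "z \<in> Y" for \<epsilon> z
  proof -
    obtain x \<xi> where z: "z = (x, \<xi>)" by force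
    show ?thesis
      using frac_stockwell_rescaled[OF f' gs that(1), of x \<xi> \<alpha>] that(2)
      unfolding F_def C_def z assms(2,3) by simp
  qed
  have Geq: "G z = C * G0 z" if "z \<in> Y" for z
  proof -
    obtain x \<xi> where z: "z = (x, \<xi>)" by force
    define \<phi> where "\<phi> = phase_family g ?a ?b 0 (1, z)"
    have \<phi>: "\<phi> \<in> lizorkin"
      unfolding \<phi>_def by (rule phase_family_lizorkin[OF assms(9) in_params[OF _ that]]) simp
    have "stockwell g (modulate (\<xi> / c2) u) (x * c2) (\<xi> / c2) =
        of_real (\<bar>\<xi>\<bar> / c2) * u (\<lambda>t. ?s * \<phi> (t / c2))"
      unfolding stockwell_modulated[OF \<open>c2 > 0\<close>] \<phi>_def phase_family_def z by simp
    also have "u (\<lambda>t. ?s * \<phi> (t / c2))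
        = ?s * u (\<lambda>t. \<phi> (t / c2))"
      using \<open>c2 > 0\<close> by (intro seminorm_boundedD(2)[OF u] lizorkin_dilate \<phi>) simp
    \<comment> \<open>Homogeneity gives \<open>c2 powr (m + 1)\<close>. One factor \<open>c2\<close>
      cancels against \<open>\<bar>\<xi>\<bar> / c2\<close>, the rest against the division by
      \<open>c2 powr m\<close> in \<open>G\<close>.\<close>
    also have "u (\<lambda>t. \<phi> (t / c2)) = of_real (c2 powr m * c2) * u \<phi>"
      using quasiasymptotic_homogeneous[OF assms(4,7) \<phi> \<open>c2 > 0\<close>] \<open>c2 > 0\<close> by (simp add: powr_add)
    finally have "stockwell g (modulate (\<xi> / c2) u) (x * c2) (\<xi> / c2) =
        of_real (c2 powr m) * (?s * (of_real \<bar>\<xi>\<bar> * u \<phi>))"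
      using \<open>c2 > 0\<close> by simp
    then have "G z = (csqrt (1 - \<i> * of_real c1) * ?s) * (of_real \<bar>\<xi>\<bar> * u \<phi>)"
      unfolding G_def z using \<open>c2 > 0\<close> by simp
    then show ?thesis unfolding C G0_def \<phi>_def[symmetric] by (simp add: z)
  qed
  have "regular_dual_Y (F \<epsilon>)" if "\<epsilon> > 0" for \<epsilon>
  proof -
    \<comment> \<open>Here \<epsilon> is fixed and need not be small, so the bound for the full
      chirp, with \<open>N = 0\<close> and constants depending on \<epsilon>, is enough.\<close>
    obtain K M where K: "K \<ge> 0" "\<And>z. z \<in> Y \<Longrightarrow> norm (?D \<epsilon> z)
        \<le> K * ((1 + \<epsilon>) ^ n * (1 + 1 / \<epsilon>) ^ n) / \<epsilon> * \<epsilon> ^ (2 * 0) * ((1 + \<epsilon>) * weight (1, z)) ^ M"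
      using dilate_chirp_bound[OF f' gs, of ?a ?b 0] \<open>\<epsilon> > 0\<close> by metis
    define K' where "K' = K * ((1 + \<epsilon>) ^ n * (1 + 1 / \<epsilon>) ^ n) / \<epsilon> * (1 + \<epsilon>) ^ M"
    have "K' \<ge> 0" using K(1) that by (simp add: K'_def)
    have "poly_bounded (\<lambda>(i::nat) z. ?D \<epsilon> z)"
      by (rule poly_boundedI[OF \<open>K' \<ge> 0\<close>, where M = M], rule order_trans[OF K(2)])
        (simp_all add: K'_def power_mult_distrib mult_ac)
    then have "poly_bounded (\<lambda>(i::nat) z. C * of_real (\<epsilon>\<^sup>2) * of_real \<bar>snd z\<bar> * ?D \<epsilon> z)"
      by (intro poly_bounded_mult poly_bounded_xi poly_bounded_const[OF order_refl])
    moreover have "C * of_real (\<epsilon>\<^sup>2) * of_real \<bar>snd z\<bar> * ?D \<epsilon> z = F \<epsilon> z"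
      if "z \<in> Y" for z
      using Feq[OF \<open>\<epsilon> > 0\<close> that] by simp
    ultimately obtain K2 M2 where K2: "K2 \<ge> 0" "\<And>z. z \<in> Y \<Longrightarrow> norm (F \<epsilon> z) \<le> K2 * weight (1, z) ^ M2"
      unfolding poly_bounded_def by (metis (no_types, lifting))
    have "continuous_on Y (\<lambda>z. C * of_real (\<epsilon>\<^sup>2 * \<bar>snd z\<bar>) * ?D \<epsilon> z)"
      by (intro continuous_intros continuous_dilate_chirp[OF f' gs that])
    then have "continuous_on Y (F \<epsilon>)" by (rule continuous_on_eq) (simp add: Feq[OF that])
    then show ?thesis using K2 by (rule regular_dual_YI)
  qed
  moreover have "regular_dual_Y G"
  proof -
    have "poly_bounded (\<lambda>(i::nat) z. C * G0 z)"
      by (intro poly_bounded_mult poly_bounded_const[OF order_refl]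
          poly_bounded_window_pairing[OF u assms(9), of ?a ?b, folded G0_def])
    then obtain K M where K: "K \<ge> 0" "\<And>z. z \<in> Y \<Longrightarrow> norm (G z) \<le> K * weight (1, z) ^ M"
      unfolding poly_bounded_def using Geq by (metis (no_types, lifting))
    have "continuous_on Y (\<lambda>z. C * G0 z)" by (intro continuous_intros
        continuous_window_pairing[OF u assms(9), of ?a ?b, folded G0_def])
    then have "continuous_on Y G" by (rule continuous_on_eq) (simp add: Geq)
    then show ?thesis using K by (rule regular_dual_YI)
  qed
  moreover have "((\<lambda>\<epsilon>. regular_functional (F \<epsilon>) \<Phi> / of_real (\<epsilon> powr (m + 2) * L \<epsilon>)) \<longlongrightarrow> regular_functional G \<Phi>) (at_right 0)"
    if \<Phi>: "\<Phi> \<in> schwartz_Y" for \<Phi>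
  proof -
    have "((\<lambda>\<epsilon>. C * regular_functional (H \<epsilon>) \<Phi>) \<longlongrightarrow> C * regular_functional G0 \<Phi>) (at_right 0)"
      by (intro tendsto_intros core \<Phi>)
    moreover have "C * regular_functional G0 \<Phi> = regular_functional G \<Phi>"
      unfolding regular_functional_cmult[symmetric] by (rule regular_functional_cong) (simp add: Geq)
    moreover have "\<forall>\<^sub>F \<epsilon> in at_right 0. C * regular_functional (H \<epsilon>) \<Phi>
        = regular_functional (F \<epsilon>) \<Phi> / of_real (\<epsilon> powr (m + 2) * L \<epsilon>)"
      using eventually_at_right_less[of "0::real"]
    proof eventually_elim
      case (elim \<epsilon>)
      have "\<epsilon> powr (m + 2) = \<epsilon>\<^sup>2 * \<epsilon> powr m" using elim by (simp add: powr_add)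
      \<comment> \<open>If \<open>L \<epsilon>\<close> is zero, both sides are zero by the
        convention for division, so the identity holds for all positive \<epsilon>.\<close>
      then have "C * H \<epsilon> z = inverse (of_real (\<epsilon> powr (m + 2) * L \<epsilon>)) * F \<epsilon> z" if "z \<in> Y" for z
        unfolding H_def Feq[OF elim that] using elim by (simp add: field_simps)
      then have "regular_functional (\<lambda>z. C * H \<epsilon> z) \<Phi>
          = regular_functional (\<lambda>z. inverse (of_real (\<epsilon> powr (m + 2) * L \<epsilon>)) * F \<epsilon> z) \<Phi>"
        by (rule regular_functional_cong)
      then show ?case unfolding regular_functional_cmult by (simp add: divide_inverse mult.commute)
    qed
    ultimately show ?thesis using tendsto_cong by force
  qed
  ultimately show ?thesis
    unfolding asymptotic_Y_def F_def[symmetric] G_def[symmetric] by blast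
qed

end
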